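(* Let $X,X_1,X_2,\dots$ be i.i.d. random vectors in $\mathbb{R}^p$ with $\mathbb{E}X=0$ and covariance matrix $\Sigma\neq 0$ with eigenvalues $\lambda_1\ge\dots\ge\lambda_p\ge0$. Let $0<\delta\le 1$, $q=2+\delta$, and assume $K_\delta<\infty$ and $D_\delta<\infty$. Let $\eta_1,\dots,\eta_p$ be i.i.d. $\chi^2_1$ random variables and $V=\sum_{j=1}^p \frac{\lambda_j}{f}(\eta_j-1)$. Let $R_n=(n|\bar X_n|_2^2-f_1)/f$ with $\bar X_n=n^{-1}\sum_{i=1}^nX_i$. Define, for $\psi>0$, $$L_\delta(n,\psi)=\psi^2\Big(\frac{\tilde K_0^2}{n}+\frac{\tilde K_0}{n^{1/2}}\Big)+\psi^q\Big[\frac{\tilde K_\delta^q}{n^{q-1}}+\frac{\mathbb{E}(X_1^T\Sigma X_1)^{q/2}}{n^{\delta/2}f^q}+\frac{\tilde D_\delta^q}{n^\delta}\Big],$$ where $\tilde K_\delta=K_\delta+c_\delta$, $\tilde K_0=K_0+c_0$, $\tilde D_\delta=D_\delta+d_\delta$, and let $\psi_n$ be the solution of $L_\delta(n,\psi)=\psi^{-1/2}$. Then there is a constant $C$ depending only on $\delta$ such that $$\sup_{t\in\mathbb{R}}|\mathbb{P}(R_n\le t)-\mathbb{P}(V\le t)|\le C\psi_n^{-1/2}.$$ In particular, in the asymptotic regime $n\to\infty$ with $p=p_n$ and the distribution of $X$ allowed to depend on $n$, if $$\frac{\tilde K_0^2}{n}+\frac{\tilde K_\delta^q}{n^{q-1}}+\frac{\mathbb{E}(X_1^T\Sigma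 X_1)^{q/2}}{n^{\delta/2}f^q}+\frac{\tilde D_\delta^q}{n^\delta}\to0,$$ then $\psi_n\to\infty$ and $\sup_t|\mathbb{P}(R_n\le t)-\mathbb{P}(V\le t)|\to0$.
   Context: For $k\ge1$, $f_k=[\mathrm{tr}(\Sigma^k)]^{1/k}$ and $f=f_2$. $|x|_2=(x^Tx)^{1/2}$. For $\delta\ge0$: $K_\delta^{2+\delta}=\mathbb{E}|(X_1^TX_1-f_1)/f|^{2+\delta}$ and $D_\delta^{2+\delta}=\mathbb{E}|X_1^TX_2/f|^{2+\delta}$ (so $K_0=\|X_1^TX_1-f_1\|_2/f$). $c_\delta=(1+\delta)^{1/2}\|\xi^2-1\|_{2+\delta}$ and $d_\delta=(1+\delta)^{1/2}\|\xi\|_{2+\delta}^2$ with $\xi\sim N(0,1)$, where $\|Z\|_q=(\mathbb{E}|Z|^q)^{1/q}$. *)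

theory Defs
  imports "HOL-Probability.Probability" "Jordan_Normal_Form.Char_Poly"
begin

(* Vectors in R^p are functions nat => real (extensional outside {..<p});
   a random vector in R^p has a law on vecM p. *)
definition vecM :: "nat \<Rightarrow> (nat \<Rightarrow> real) measure" where
  "vecM p = PiM {..<p} (\<lambda>_. borel)"

definition mtrace :: "real mat \<Rightarrow> real" where
  "mtrace A = (\<Sum>i<dim_row A. A $$ (i,i))"

(* covariance matrix Sigma = E[X X^T] of a (centred) law mu on R^p *)
definition covm :: "nat \<Rightarrow> (nat \<Rightarrow> real) measure \<Rightarrow> real mat" where
  "covm p \<mu> = mat p p (\<lambda>(i,j). \<integral>x. x i * x j \<partial>\<mu>)"

definition fk :: "nat \<Rightarrow> (nat \<Rightarrow> real) measure \<Rightarrow> nat \<Rightarrow> real" where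
  "fk p \<mu> k = (mtrace (covm p \<mu> ^\<^sub>m k)) powr (1 / real k)"

definition sqnorm :: "nat \<Rightarrow> (nat \<Rightarrow> real) \<Rightarrow> real" where
  "sqnorm p x = (\<Sum>j<p. (x j)\<^sup>2)"

definition dotp :: "nat \<Rightarrow> (nat \<Rightarrow> real) \<Rightarrow> (nat \<Rightarrow> real) \<Rightarrow> real" where
  "dotp p x y = (\<Sum>j<p. x j * y j)"

definition quadS :: "nat \<Rightarrow> (nat \<Rightarrow> real) measure \<Rightarrow> (nat \<Rightarrow> real) \<Rightarrow> real" where
  "quadS p \<mu> x = (\<Sum>i<p. \<Sum>j<p. x i * covm p \<mu> $$ (i,j) * x j)"

definition Kfun :: "nat \<Rightarrow> (nat \<Rightarrow> real) measure \<Rightarrow> (nat \<Rightarrow> real) \<Rightarrow> real" where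
  "Kfun p \<mu> x = \<bar>(sqnorm p x - fk p \<mu> 1) / fk p \<mu> 2\<bar>"

definition Dfun :: "nat \<Rightarrow> (nat \<Rightarrow> real) measure \<Rightarrow> (nat \<Rightarrow> real) \<times> (nat \<Rightarrow> real) \<Rightarrow> real" where
  "Dfun p \<mu> z = \<bar>dotp p (fst z) (snd z) / fk p \<mu> 2\<bar>"

definition Kd :: "nat \<Rightarrow> (nat \<Rightarrow> real) measure \<Rightarrow> real \<Rightarrow> real" where
  "Kd p \<mu> \<delta> = (\<integral>x. Kfun p \<mu> x powr (2 + \<delta>) \<partial>\<mu>) powr (1 / (2 + \<delta>))"

definition Dd :: "nat \<Rightarrow> (nat \<Rightarrow> real) measure \<Rightarrow> real \<Rightarrow> real" where
  "Dd p \<mu> \<delta> = (\<integral>z. Dfun p \<mu> z powr (2 + \<delta>) \<partial>(\<mu> \<Otimes>\<^sub>M \<mu>)) powr (1 / (2 + \<delta>))"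

definition stdN :: "real measure" where
  "stdN = density lborel std_normal_density"

definition chi2_1 :: "real measure" where
  "chi2_1 = distr stdN borel (\<lambda>x. x\<^sup>2)"

definition cd :: "real \<Rightarrow> real" where
  "cd \<delta> = sqrt (1 + \<delta>) * (\<integral>x. \<bar>x\<^sup>2 - 1\<bar> powr (2 + \<delta>) \<partial>stdN) powr (1 / (2 + \<delta>))"

definition dd :: "real \<Rightarrow> real" where
  "dd \<delta> = sqrt (1 + \<delta>) * ((\<integral>x. \<bar>x\<bar> powr (2 + \<delta>) \<partial>stdN) powr (1 / (2 + \<delta>)))\<^sup>2"

definition Qd :: "nat \<Rightarrow> (nat \<Rightarrow> real) measure \<Rightarrow> real \<Rightarrow> nat \<Rightarrow> real" where
  "Qd p \<mu> \<delta> n =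
     (Kd p \<mu> 0 + cd 0)\<^sup>2 / real n
     + (Kd p \<mu> \<delta> + cd \<delta>) powr (2 + \<delta>) / real n powr (1 + \<delta>)
     + (\<integral>x. quadS p \<mu> x powr ((2 + \<delta>) / 2) \<partial>\<mu>) / (real n powr (\<delta> / 2) * fk p \<mu> 2 powr (2 + \<delta>))
     + (Dd p \<mu> \<delta> + dd \<delta>) powr (2 + \<delta>) / real n powr \<delta>"

definition Ld :: "nat \<Rightarrow> (nat \<Rightarrow> real) measure \<Rightarrow> real \<Rightarrow> nat \<Rightarrow> real \<Rightarrow> real" where
  "Ld p \<mu> \<delta> n \<psi> =
     \<psi>\<^sup>2 * ((Kd p \<mu> 0 + cd 0)\<^sup>2 / real n + (Kd p \<mu> 0 + cd 0) / sqrt (real n))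
     + \<psi> powr (2 + \<delta>) *
       ((Kd p \<mu> \<delta> + cd \<delta>) powr (2 + \<delta>) / real n powr (1 + \<delta>)
        + (\<integral>x. quadS p \<mu> x powr ((2 + \<delta>) / 2) \<partial>\<mu>) / (real n powr (\<delta> / 2) * fk p \<mu> 2 powr (2 + \<delta>))
        + (Dd p \<mu> \<delta> + dd \<delta>) powr (2 + \<delta>) / real n powr \<delta>)"

definition admissible :: "nat \<Rightarrow> (nat \<Rightarrow> real) measure \<Rightarrow> real \<Rightarrow> bool" where
  "admissible p \<mu> \<delta> \<longleftrightarrow>
     prob_space \<mu> \<and> sets \<mu> = sets (vecM p) \<and>
     (\<forall>j<p. integrable \<mu> (\<lambda>x. x j) \<and> (\<integral>x. x j \<partial>\<mu>) = 0) \<and>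
     (\<forall>i<p. \<forall>j<p. integrable \<mu> (\<lambda>x. x i * x j)) \<and>
     covm p \<mu> \<noteq> 0\<^sub>m p p \<and>
     integrable \<mu> (\<lambda>x. Kfun p \<mu> x powr (2 + \<delta>)) \<and>
     integrable (\<mu> \<Otimes>\<^sub>M \<mu>) (\<lambda>z. Dfun p \<mu> z powr (2 + \<delta>))"

definition eigs_of :: "nat \<Rightarrow> (nat \<Rightarrow> real) measure \<Rightarrow> (nat \<Rightarrow> real) \<Rightarrow> bool" where
  "eigs_of p \<mu> lam \<longleftrightarrow>
     char_poly (covm p \<mu>) = (\<Prod>j<p. [:- lam j, 1:]) \<and>
     (\<forall>i j. i \<le> j \<longrightarrow> j < p \<longrightarrow> lam j \<le> lam i)"

definition sampleM :: "nat \<Rightarrow> (nat \<Rightarrow> real) measure \<Rightarrow> (nat \<Rightarrow> nat \<Rightarrow> real) measure" where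
  "sampleM n \<mu> = PiM {..<n} (\<lambda>_. \<mu>)"

definition Rn :: "nat \<Rightarrow> (nat \<Rightarrow> real) measure \<Rightarrow> nat \<Rightarrow> (nat \<Rightarrow> nat \<Rightarrow> real) \<Rightarrow> real" where
  "Rn p \<mu> n \<omega> =
     (real n * sqnorm p (\<lambda>j. (\<Sum>i<n. \<omega> i j) / real n) - fk p \<mu> 1) / fk p \<mu> 2"

definition probR :: "nat \<Rightarrow> (nat \<Rightarrow> real) measure \<Rightarrow> nat \<Rightarrow> real \<Rightarrow> real" where
  "probR p \<mu> n t = measure (sampleM n \<mu>) {\<omega> \<in> space (sampleM n \<mu>). Rn p \<mu> n \<omega> \<le> t}"

definition probV :: "nat \<Rightarrow> (nat \<Rightarrow> real) measure \<Rightarrow> (nat \<Rightarrow> real) \<Rightarrow> real \<Rightarrow> real" where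
  "probV p \<mu> lam t = measure (PiM {..<p} (\<lambda>_. chi2_1))
      {\<eta> \<in> space (PiM {..<p} (\<lambda>_. chi2_1)). (\<Sum>j<p. lam j / fk p \<mu> 2 * (\<eta> j - 1)) \<le> t}"

end

theory Submission
  imports Defs
begin

text \<open>The indicator of \<open>R\<^sub>n \<le> t\<close> is smoothed on the scale \<open>1 / \<psi>\<close>, and the \<open>X\<^sub>i\<close> are replaced one at a time by
Gaussian vectors \<open>Y\<^sub>i\<close> with the same covariance (Lindeberg). At a fixed value \<open>w\<close> of the remaining sum,
\<open>\<bar>w + X\<bar>\<^sup>2 = \<bar>w\<bar>\<^sup>2 + 2 w\<^sup>T X + \<bar>X\<bar>\<^sup>2\<close>; the second-order terms \<open>E (w\<^sup>T X)\<^sup>2 = w\<^sup>T \<Sigma> w\<close> agree for \<open>X\<close> and \<open>Y\<close>, and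
what remains is bounded by the moments \<open>E \<bar>w\<^sup>T X\<bar>\<^sup>q\<close> of the hybrid sums \<open>w\<close>, which Rosenthal's inequality
controls through \<open>D\<^sub>\<delta>\<close> and \<open>E (X\<^sup>T \<Sigma> X)\<^bsup>q/2\<^esup>\<close>. For Gaussian summands \<open>R\<^sub>n\<close> has exactly the law of \<open>V\<close>. Since
\<open>\<Sum>\<^sub>j \<lambda>\<^sub>j\<^sup>2 = f\<^sup>2\<close>, the characteristic function of \<open>V\<close> satisfies \<open>\<bar>\<phi>(s)\<bar>\<^sup>4 \<le> 1 / (1 + 4 s\<^sup>2)\<close>, so intervals of length \<open>h\<close> have
probability \<open>O(\<surd>h)\<close> and the smoothing costs \<open>O(\<psi> powr (-1/2))\<close>.\<close>

section \<open>Taylor expansion and powers\<close>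

text \<open>The squared norm has moments of order q = 2 + \<delta> only, with \<delta> \<le> 1.
  Every expansion therefore stops at second order, with a second derivative that is Hoelder of order
  \<delta>, and the test function is a spline for which this is explicit. Third moments of X and Y
  need not agree, so the cross moment of w^T X with |X|^2 - f_1 survives the cancellation of the
  second-order terms. It is at most f K_0 (w^T \<Sigma> w)^(1/2), which is of size n^(1/2) f^2 K_0
  for a hybrid sum w; after n replacements on the scale \<psi> / f this is the term of order
  \<psi>^2 K_0 / n^(1/2) in L. Adding c_\<delta> and c_0 to the K's covers the moments of |Y|^2 -
  f_1 as well; c_0 = sqrt 2 is the standard deviation of (|Y|^2 - f_1) / f. Moments pairing a vector
  with a Gaussian one are not compared with D: integrating the Gaussian vector first reduces them to
  E(X^T \<Sigma> X)^(q/2), which dominates f^q by Jensen.\<close>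

lemma taylor_holder:
  fixes \<phi> \<phi>' \<phi>'' :: "real \<Rightarrow> real"
  assumes d1: "\<And>x. (\<phi> has_real_derivative \<phi>' x) (at x)"
    and d2: "\<And>x. (\<phi>' has_real_derivative \<phi>'' x) (at x)"
    and H: "\<And>x y. \<bar>\<phi>'' x - \<phi>'' y\<bar> \<le> H * \<bar>x - y\<bar> powr \<delta>"
    and \<delta>: "0 < \<delta>"
  shows "\<bar>\<phi> (a + u) - \<phi> a - \<phi>' a * u - \<phi>'' a * u\<^sup>2 / 2\<bar> \<le> H / 2 * \<bar>u\<bar> powr (2 + \<delta>)"
proof (cases "u = 0")
  case False
  define diff where "diff m = (if m = 0 then \<phi> else if m = 1 then \<phi>' else \<phi>'')" for m :: nat
  \<comment> \<open>The Lagrange form of order two leaves \<open>\<phi>''\<close> at an intermediate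
    point \<open>t\<close>. Since t is no farther from \<open>a\<close> than \<open>a + u\<close>,
    the Hoelder bound trades it for \<open>\<phi>''\<close> at \<open>a\<close>.\<close>
  have "\<exists>t. (if a + u < a then a + u < t \<and> t < a else a < t \<and> t < a + u) \<and>
     \<phi> (a + u) = (\<Sum>m<2. diff m a / fact m * (a + u - a) ^ m) + diff 2 t / fact 2 * (a + u - a) ^ 2"
    by (rule Taylor[where a = "min a (a + u)" and b = "max a (a + u)"])
      (use False in \<open>auto simp: diff_def d1 d2\<close>)
  then obtain t where t1: "if a + u < a then a + u < t \<and> t < a else a < t \<and> t < a + u"
    and t2: "\<phi> (a + u) = (\<Sum>m<2. diff m a / fact m * (a + u - a) ^ m) + diff 2 t / fact 2 * (a + u - a) ^ 2"
    by blast
  have t: "\<bar>t - a\<bar> \<le> \<bar>u\<bar>" using t1 by (auto split: if_splits)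
  have e: "\<phi> (a + u) = \<phi> a + \<phi>' a * u + \<phi>'' t / 2 * u\<^sup>2"
    using t2 by (simp add: diff_def numeral_2_eq_2)
  have H0: "H \<ge> 0" using H[of 1 0] by simp
  have "\<bar>\<phi> (a + u) - \<phi> a - \<phi>' a * u - \<phi>'' a * u\<^sup>2 / 2\<bar> = \<bar>\<phi>'' t - \<phi>'' a\<bar> / 2 * u\<^sup>2"
  proof -
    have "\<phi> (a + u) - \<phi> a - \<phi>' a * u - \<phi>'' a * u\<^sup>2 / 2 = (\<phi>'' t - \<phi>'' a) / 2 * u\<^sup>2"
      unfolding e by (simp add: field_simps)
    then show ?thesis by (simp only: abs_mult abs_divide abs_numeral abs_power2)
  qed
  also have "\<dots> \<le> H * \<bar>u\<bar> powr \<delta> / 2 * u\<^sup>2"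
  proof -
    have "\<bar>t - a\<bar> powr \<delta> \<le> \<bar>u\<bar> powr \<delta>"
      using t \<delta> by (intro powr_mono2) auto
    then have "\<bar>\<phi>'' t - \<phi>'' a\<bar> \<le> H * \<bar>u\<bar> powr \<delta>"
      using H[of t a] H0 by (meson mult_left_mono order_trans)
    then show ?thesis by (intro mult_right_mono divide_right_mono) auto
  qed
  also have "\<dots> = H / 2 * \<bar>u\<bar> powr (2 + \<delta>)"
    using False by (simp add: powr_add)
  finally show ?thesis .
qed (use assms in auto)

text \<open>After division by a + b both terms lie in [0, 1] and sum to 1, and raising a number of
  [0, 1] to a power \<delta> \<le> 1 does not decrease it.\<close>

lemma powr_add_subadd:
  fixes a b \<delta> :: real
  assumes "0 \<le> a" "0 \<le> b" "0 < \<delta>" "\<delta> \<le> 1"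
  shows "(a + b) powr \<delta> \<le> a powr \<delta> + b powr \<delta>"
proof (cases "a + b = 0")
  case False
  then have s: "a + b > 0" using assms by auto
  have *: "x / (a + b) \<le> (x / (a + b)) powr \<delta>" if "0 \<le> x" "x \<le> a + b" for x
  proof (cases "x = 0")
    case False
    then have "(x / (a + b)) powr 1 \<le> (x / (a + b)) powr \<delta>"
      using that s assms by (intro powr_mono') (auto simp: field_simps)
    then show ?thesis using that s by simp
  qed (use assms in auto)
  have "1 = a / (a + b) + b / (a + b)" using s by (simp add: add_divide_distrib[symmetric])
  also have "\<dots> \<le> (a / (a + b)) powr \<delta> + (b / (a + b)) powr \<delta>"
    using assms by (intro add_mono *) auto
  also have "\<dots> = (a powr \<delta> + b powr \<delta>) / (a + b) powr \<delta>"
    using assms s by (simp add: powr_divide add_divide_distrib)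
  finally show ?thesis using s by (simp add: field_simps)
qed (use assms in \<open>auto simp: add_nonneg_eq_0_iff\<close>)

text \<open>Follows from subadditivity. Up to a constant factor, |s|^\<delta> is the second
  derivative of |s|^(2 + \<delta>), so this is the regularity that \<open>taylor_holder\<close> asks
  for.\<close>

lemma abs_powr_holder:
  fixes s t \<delta> :: real
  assumes "0 < \<delta>" "\<delta> \<le> 1"
  shows "\<bar>\<bar>s\<bar> powr \<delta> - \<bar>t\<bar> powr \<delta>\<bar> \<le> \<bar>s - t\<bar> powr \<delta>"
proof -
  have *: "\<bar>s\<bar> powr \<delta> \<le> \<bar>t\<bar> powr \<delta> + \<bar>s - t\<bar> powr \<delta>" for s t :: real
  proof -
    have "\<bar>s\<bar> powr \<delta> \<le> (\<bar>t\<bar> + \<bar>s - t\<bar>) powr \<delta>"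
      using assms by (intro powr_mono2) auto
    also have "\<dots> \<le> \<bar>t\<bar> powr \<delta> + \<bar>s - t\<bar> powr \<delta>"
      by (intro powr_add_subadd) (use assms in auto)
    finally show ?thesis .
  qed
  from *[of s t] *[of t s] show ?thesis unfolding abs_minus_commute[of t s] by linarith
qed

text \<open>Handles the point where the two branches of a piecewise power meet; on the open
  half-lines the derivative transfers from the smooth branch.\<close>

lemma has_real_derivative_zero_at_zero:
  fixes f :: "real \<Rightarrow> real"
  assumes "0 < r" and "\<And>h. \<bar>f h\<bar> \<le> \<bar>h\<bar> * \<bar>h\<bar> powr r"
  shows "(f has_real_derivative 0) (at 0)"
proof -
  have f0: "f 0 = 0" using assms(2)[of 0] by simp
  have "((\<lambda>h. (f (0 + h) - f 0) / h) \<longlongrightarrow> 0) (at 0)"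
  proof (rule Lim_null_comparison)
    show "\<forall>\<^sub>F h in at 0. norm ((f (0 + h) - f 0) / h) \<le> \<bar>h\<bar> powr r"
      using assms(2) by (auto simp: eventually_at_filter f0 abs_divide divide_le_eq mult.commute)
    have "((\<lambda>h. \<bar>h\<bar> powr r) \<longlongrightarrow> \<bar>0::real\<bar> powr r) (at 0)"
      using assms(1) by (intro tendsto_powr2 tendsto_intros) auto
    then show "((\<lambda>h::real. \<bar>h\<bar> powr r) \<longlongrightarrow> 0) (at 0)" using assms(1) by simp
  qed
  then show ?thesis by (simp add: DERIV_def)
qed

lemma has_real_derivative_abs_powr:
  assumes "1 < r"
  shows "((\<lambda>s::real. \<bar>s\<bar> powr r) has_real_derivative r * (sgn s * \<bar>s\<bar> powr (r - 1))) (at s)"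
proof -
  consider "s > 0" | "s < 0" | "s = 0" by linarith
  then show ?thesis
  proof cases
    case 1
    have "((\<lambda>s. s powr r) has_real_derivative r * s powr (r - 1)) (at s)"
      using 1 by (rule has_real_derivative_powr)
    then have "((\<lambda>s. \<bar>s\<bar> powr r) has_real_derivative r * s powr (r - 1)) (at s)"
      by (rule has_field_derivative_transform_within_open[where S = "{0<..}"]) (use 1 in auto)
    then show ?thesis using 1 by simp
  next
    case 2
    have "((\<lambda>s. (- s) powr r) has_real_derivative - (r * (- s) powr (r - 1))) (at s)"
      using 2 by (auto intro!: derivative_eq_intros)
    then have "((\<lambda>s. \<bar>s\<bar> powr r) has_real_derivative - (r * (- s) powr (r - 1))) (at s)"
      by (rule has_field_derivative_transform_within_open[where S = "{..<0}"]) (use 2 in auto)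
    then show ?thesis using 2 by simp
  next
    case 3
    have "\<bar>h\<bar> powr r = \<bar>h\<bar> * \<bar>h\<bar> powr (r - 1)" for h :: real
      by (cases "h = 0") (simp_all add: powr_diff)
    then show ?thesis using 3 assms
      by (auto intro!: has_real_derivative_zero_at_zero[of "r - 1"])
  qed
qed

lemma has_real_derivative_sgn_abs_powr:
  assumes "1 < r"
  shows "((\<lambda>s::real. sgn s * \<bar>s\<bar> powr r) has_real_derivative r * \<bar>s\<bar> powr (r - 1)) (at s)"
proof -
  consider "s > 0" | "s < 0" | "s = 0" by linarith
  then show ?thesis
  proof cases
    case 1
    have "((\<lambda>s. s powr r) has_real_derivative r * s powr (r - 1)) (at s)"
      using 1 by (rule has_real_derivative_powr)
    then have "((\<lambda>s. sgn s * \<bar>s\<bar> powr r) has_real_derivative r * s powr (r - 1)) (at s)"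
      by (rule has_field_derivative_transform_within_open[where S = "{0<..}"]) (use 1 in auto)
    then show ?thesis using 1 by simp
  next
    case 2
    have "((\<lambda>s. - ((- s) powr r)) has_real_derivative (r * (- s) powr (r - 1))) (at s)"
      using 2 by (auto intro!: derivative_eq_intros)
    then have "((\<lambda>s. sgn s * \<bar>s\<bar> powr r) has_real_derivative r * (- s) powr (r - 1)) (at s)"
      by (rule has_field_derivative_transform_within_open[where S = "{..<0}"]) (use 2 in auto)
    then show ?thesis using 2 by simp
  next
    case 3
    have "\<bar>h\<bar> powr r = \<bar>h\<bar> * \<bar>h\<bar> powr (r - 1)" for h :: real
      by (cases "h = 0") (simp_all add: powr_diff)
    then show ?thesis using 3 assms
      by (auto intro!: has_real_derivative_zero_at_zero[of "r - 1"] simp: abs_mult sgn_if)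
  qed
qed

text \<open>One step of Rosenthal's induction. The second derivative of |s|^q is (2 + \<delta>)(1 +
  \<delta>)|s|^\<delta>; its factor is at most 6 and Taylor halves it, hence both constants
  3.\<close>

lemma abs_powr_expansion:
  fixes s x \<delta> :: real
  assumes "0 < \<delta>" "\<delta> \<le> 1"
  shows "\<bar>s + x\<bar> powr (2 + \<delta>) \<le> \<bar>s\<bar> powr (2 + \<delta>) + (2 + \<delta>) * (sgn s * \<bar>s\<bar> powr (1 + \<delta>)) * x
           + 3 * (\<bar>s\<bar> powr \<delta> * x\<^sup>2) + 3 * \<bar>x\<bar> powr (2 + \<delta>)"
proof -
  let ?H = "(2 + \<delta>) * (1 + \<delta>)"
  have H: "?H \<le> 3 * 2" using assms by (intro mult_mono) auto
  have h: "\<bar>?H * \<bar>x\<bar> powr \<delta> - ?H * \<bar>y\<bar> powr \<delta>\<bar> \<le> ?H * \<bar>x - y\<bar> powr \<delta>" for x y :: real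
  proof -
    have "\<bar>?H * \<bar>x\<bar> powr \<delta> - ?H * \<bar>y\<bar> powr \<delta>\<bar> = ?H * \<bar>\<bar>x\<bar> powr \<delta> - \<bar>y\<bar> powr \<delta>\<bar>"
      using assms by (simp add: right_diff_distrib[symmetric] abs_mult)
    then show ?thesis using abs_powr_holder[OF assms, of x y] assms by (auto intro!: mult_left_mono)
  qed
  have d1: "((\<lambda>s. \<bar>s\<bar> powr (2 + \<delta>)) has_real_derivative (2 + \<delta>) * (sgn s * \<bar>s\<bar> powr (1 + \<delta>))) (at s)" for s
    using has_real_derivative_abs_powr[of "2 + \<delta>" s] assms by (simp add: algebra_simps)
  have d2: "((\<lambda>s. (2 + \<delta>) * (sgn s * \<bar>s\<bar> powr (1 + \<delta>))) has_real_derivative ?H * \<bar>s\<bar> powr \<delta>) (at s)" for s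
    using DERIV_cmult[OF has_real_derivative_sgn_abs_powr[of "1 + \<delta>" s], of "2 + \<delta>"] assms
    by (simp add: mult.assoc)
  have "\<bar>\<bar>s + x\<bar> powr (2 + \<delta>) - \<bar>s\<bar> powr (2 + \<delta>) - (2 + \<delta>) * (sgn s * \<bar>s\<bar> powr (1 + \<delta>)) * x
      - ?H * \<bar>s\<bar> powr \<delta> * x\<^sup>2 / 2\<bar> \<le> ?H / 2 * \<bar>x\<bar> powr (2 + \<delta>)"
    by (rule taylor_holder[OF d1 d2 h]) (use assms in auto)
  moreover have "?H / 2 * \<bar>x\<bar> powr (2 + \<delta>) \<le> 3 * \<bar>x\<bar> powr (2 + \<delta>)"
    using H by (intro mult_right_mono) auto
  moreover have "?H / 2 * (\<bar>s\<bar> powr \<delta> * x\<^sup>2) \<le> 3 * (\<bar>s\<bar> powr \<delta> * x\<^sup>2)"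
    using H by (intro mult_right_mono) auto
  ultimately show ?thesis unfolding abs_le_iff by (simp add: mult.assoc)
qed

text \<open>The sum is at most twice the larger term, and 2^q \<le> 2^3 = 8.\<close>

lemma abs_add_powr_le:
  fixes a b q :: real
  assumes "0 < q" "q \<le> 3"
  shows "\<bar>a + b\<bar> powr q \<le> 8 * (\<bar>a\<bar> powr q + \<bar>b\<bar> powr q)"
proof -
  have "\<bar>a + b\<bar> powr q \<le> (2 * max \<bar>a\<bar> \<bar>b\<bar>) powr q"
    using assms by (intro powr_mono2) auto
  also have "\<dots> = 2 powr q * max \<bar>a\<bar> \<bar>b\<bar> powr q" by (simp add: powr_mult)
  also have "\<dots> \<le> 8 * (\<bar>a\<bar> powr q + \<bar>b\<bar> powr q)"
  proof (intro mult_mono)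
    have "2 powr q \<le> 2 powr (3::real)" using assms by (intro powr_mono) auto
    then show "2 powr q \<le> (8::real)" by simp
  qed (auto simp: max_def)
  finally show ?thesis .
qed

section \<open>A smooth step function\<close>

text \<open>Truncated power, from which splines with integer knots are assembled.\<close>

definition pcub :: "nat \<Rightarrow> real \<Rightarrow> real" where
  "pcub m x = max 0 x ^ m"

lemma has_real_derivative_pcub:
  assumes "1 \<le> m"
  shows "(pcub (Suc m) has_real_derivative real (Suc m) * pcub m x) (at x)"
proof -
  have p: "pcub m = (\<lambda>x. max 0 x ^ m)" for m by (auto simp: pcub_def)
  consider "x > 0" | "x < 0" | "x = 0" by linarith
  then show ?thesis
  proof cases
    case 1
    have "((\<lambda>x. x ^ Suc m) has_real_derivative real (Suc m) * x ^ m) (at x)"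
      using DERIV_pow[of "Suc m" x] by simp
    then have "((\<lambda>x. x ^ Suc m) has_real_derivative real (Suc m) * pcub m x) (at x)"
      using 1 by (simp add: pcub_def)
    then show ?thesis
      by (rule has_field_derivative_transform_within_open[where S = "{0<..}"])
        (use 1 in \<open>auto simp: pcub_def\<close>)
  next
    case 2
    have "((\<lambda>x. 0) has_real_derivative real (Suc m) * pcub m x) (at x)"
      using 2 assms by (simp add: pcub_def zero_power)
    then show ?thesis
      by (rule has_field_derivative_transform_within_open[where S = "{..<0}"])
        (use 2 in \<open>auto simp: pcub_def\<close>)
  next
    case 3
    have "\<bar>max 0 h ^ Suc m\<bar> \<le> \<bar>h\<bar> * \<bar>h\<bar> powr real m" for h :: real
      using assms by (cases "h > 0") (auto simp: powr_realpow max_def mult_nonpos_nonneg)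
    then have "((\<lambda>x. max 0 x ^ Suc m) has_real_derivative 0) (at (0::real))"
      using assms by (intro has_real_derivative_zero_at_zero[of "real m"]) auto
    moreover have "real (Suc m) * pcub m x = 0"
      using 3 assms by (simp add: pcub_def zero_power)
    ultimately show ?thesis using 3 unfolding p[of "Suc m"] by simp
  qed
qed

text \<open>Third backward difference of the truncated power. Right of 3 it is the third difference
  of an ordinary monomial, hence 0 for m = 1, 2 and 3! = 6 for m = 3. \<open>bdiff 2\<close> is
  twice the quadratic B-spline.\<close>

definition bdiff :: "nat \<Rightarrow> real \<Rightarrow> real" where
  "bdiff m x = pcub m x - 3 * pcub m (x - 1) + 3 * pcub m (x - 2) - pcub m (x - 3)"

lemma has_real_derivative_bdiff:
  assumes "1 \<le> m"
  shows "(bdiff (Suc m) has_real_derivative real (Suc m) * bdiff m x) (at x)"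
proof -
  have s: "((\<lambda>x. pcub (Suc m) (x - c)) has_real_derivative real (Suc m) * pcub m (x - c)) (at x)" for c
    using DERIV_chain2[of "pcub (Suc m)" "real (Suc m) * pcub m (x - c)" "\<lambda>x. x - c" x 1 UNIV]
      has_real_derivative_pcub[OF assms, of "x - c"] DERIV_diff[OF DERIV_ident DERIV_const[of c], of x UNIV]
    by simp
  have b: "bdiff (Suc m) = (\<lambda>x. pcub (Suc m) (x - 0) - 3 * pcub (Suc m) (x - 1)
      + 3 * pcub (Suc m) (x - 2) - pcub (Suc m) (x - 3))"
    by (auto simp: bdiff_def)
  show ?thesis unfolding b
    by (rule DERIV_cong, (rule derivative_intros s)+) (simp add: bdiff_def algebra_simps)
qed

text \<open>The integral of the quadratic B-spline, hence a \<open>C\<^sup>2\<close> step from 1 down to 0 on \<open>[0, 3]\<close>.\<close>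
definition smooth_step :: "real \<Rightarrow> real" where
  "smooth_step x = 1 - bdiff 3 x / 6"

lemma smooth_step_deriv:
  "(smooth_step has_real_derivative - bdiff 2 x / 2) (at x)"
  "((\<lambda>x. - bdiff 2 x / 2) has_real_derivative - bdiff 1 x) (at x)"
proof -
  have "(bdiff 3 has_real_derivative 3 * bdiff 2 x) (at x)"
    using has_real_derivative_bdiff[of 2 x] by (simp add: numeral_3_eq_3 numeral_2_eq_2)
  from DERIV_diff[OF DERIV_const[of 1] DERIV_cdivide[OF this, of 6]]
  show "(smooth_step has_real_derivative - bdiff 2 x / 2) (at x)"
    unfolding smooth_step_def[abs_def] by simp
  have "(bdiff 2 has_real_derivative 2 * bdiff 1 x) (at x)"
    using has_real_derivative_bdiff[of 1 x] by (simp add: numeral_2_eq_2)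
  from DERIV_cdivide[OF this, of "-2"]
  show "((\<lambda>x. - bdiff 2 x / 2) has_real_derivative - bdiff 1 x) (at x)"
    by simp
qed

lemma smooth_step_le0: "x \<le> 0 \<Longrightarrow> smooth_step x = 1"
  by (simp add: smooth_step_def bdiff_def pcub_def)

lemma smooth_step_ge3:
  assumes "3 \<le> x" shows "smooth_step x = 0"
proof -
  have "bdiff 3 x = x ^ 3 - 3 * (x - 1) ^ 3 + 3 * (x - 2) ^ 3 - (x - 3) ^ 3"
    using assms by (simp add: bdiff_def pcub_def)
  also have "\<dots> = 6" by (simp add: power3_eq_cube algebra_simps)
  finally show ?thesis by (simp add: smooth_step_def)
qed

text \<open>Up to the factor -1/2 this is the derivative of \<open>smooth_step\<close>, so its sign
  gives monotonicity. On [1, 2] the parabola has its apex at 3/2 and falls to 1 at both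
  ends.\<close>

lemma bdiff2_nonneg: "0 \<le> bdiff 2 x"
proof -
  consider "x \<le> 0" | "0 < x" "x \<le> 1" | "1 < x" "x \<le> 2" | "2 < x" "x \<le> 3" | "3 < x" by linarith
  then show ?thesis
  proof cases
    case 3
    have "bdiff 2 x = 3 / 2 - 2 * (x - 3 / 2)\<^sup>2"
      using 3 by (simp add: bdiff_def pcub_def power2_eq_square field_simps)
    moreover have "(x - 3 / 2)\<^sup>2 \<le> (1 / 2)\<^sup>2"
      using 3 by (intro abs_le_square_iff[THEN iffD1]) (auto simp: abs_if)
    ultimately show ?thesis by (simp add: power2_eq_square)
  next
    case 4
    have "bdiff 2 x = (3 - x)\<^sup>2"
      using 4 by (simp add: bdiff_def pcub_def power2_eq_square field_simps)
    then show ?thesis by simp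
  qed (auto simp: bdiff_def pcub_def power2_eq_square field_simps)
qed

lemma smooth_step_antimono: "x \<le> y \<Longrightarrow> smooth_step y \<le> smooth_step x"
  by (rule DERIV_nonpos_imp_nonincreasing) (use smooth_step_deriv(1) bdiff2_nonneg in force)+

lemma smooth_step_bounds: "0 \<le> smooth_step x" "smooth_step x \<le> 1"
  using smooth_step_antimono[of x "max x 3"] smooth_step_ge3[of "max x 3"]
    smooth_step_antimono[of "min x 0" x] smooth_step_le0[of "min x 0"] by auto

lemma bdiff1_bound: "\<bar>bdiff 1 x\<bar> \<le> 2"
proof -
  consider "x \<le> 0" | "0 < x" "x \<le> 1" | "1 < x" "x \<le> 2" | "2 < x" "x \<le> 3" | "3 < x" by linarith
  then show ?thesis
    by cases (simp_all add: bdiff_def pcub_def abs_if)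
qed

text \<open>Each shifted \<open>pcub 1\<close> is 1-Lipschitz, and the binomial weights 1, 3, 3, 1
  sum to 8.\<close>

lemma bdiff1_lipschitz: "\<bar>bdiff 1 x - bdiff 1 y\<bar> \<le> 8 * \<bar>x - y\<bar>"
proof -
  have p: "\<bar>pcub 1 (x - c) - pcub 1 (y - c)\<bar> \<le> \<bar>x - y\<bar>" for c
    by (auto simp: pcub_def max_def)
  have "bdiff 1 x - bdiff 1 y = (pcub 1 (x - 0) - pcub 1 (y - 0)) + (- 3) * (pcub 1 (x - 1) - pcub 1 (y - 1))
      + 3 * (pcub 1 (x - 2) - pcub 1 (y - 2)) + (- 1) * (pcub 1 (x - 3) - pcub 1 (y - 3))"
    unfolding bdiff_def by simp
  also have "\<bar>\<dots>\<bar> \<le> \<bar>x - y\<bar> + 3 * \<bar>x - y\<bar> + 3 * \<bar>x - y\<bar> + 1 * \<bar>x - y\<bar>"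
    by (intro order_trans[OF abs_triangle_ineq] add_mono p)
      (simp_all only: abs_mult abs_minus_cancel abs_numeral abs_one mult_le_cancel_left p, use p in auto)
  finally show ?thesis by simp
qed

text \<open>A bounded Lipschitz function is Hoelder for every exponent up to 1: a distance of at
  most 1 is below its \<delta>-th power, and beyond distance 1 boundedness suffices.\<close>

lemma bdiff1_holder:
  assumes "0 < \<delta>" "\<delta> \<le> 1"
  shows "\<bar>bdiff 1 x - bdiff 1 y\<bar> \<le> 8 * \<bar>x - y\<bar> powr \<delta>"
proof (cases "\<bar>x - y\<bar> \<le> 1")
  case True
  have "\<bar>x - y\<bar> \<le> \<bar>x - y\<bar> powr \<delta>"
    using True powr_mono'[of \<delta> 1 "\<bar>x - y\<bar>"] assms by (cases "x = y") auto
  then have "8 * \<bar>x - y\<bar> \<le> 8 * \<bar>x - y\<bar> powr \<delta>" by simp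
  with bdiff1_lipschitz[of x y] show ?thesis by (rule order_trans)
next
  case False
  have "1 \<le> \<bar>x - y\<bar> powr \<delta>" using False assms by (intro ge_one_powr_ge_zero) auto
  moreover have "\<bar>bdiff 1 x - bdiff 1 y\<bar> \<le> 8"
    using abs_le_D1[OF bdiff1_bound[of x]] abs_le_D1[OF bdiff1_bound[of y]]
      abs_le_D2[OF bdiff1_bound[of x]] abs_le_D2[OF bdiff1_bound[of y]]
    by (intro abs_leI) linarith+
  ultimately show ?thesis by linarith
qed

text \<open>Later \<open>a\<close> is \<psi> / f and \<open>b\<close> is \<psi> (f_1 / f + t), so
  that the expansion runs in the raw variable |sum|^2 / n instead of R_n.\<close>

definition step_fun :: "real \<Rightarrow> real \<Rightarrow> real \<Rightarrow> real" where
  "step_fun a b y = smooth_step (a * y - b)"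

lemma step_fun_deriv:
  "(step_fun a b has_real_derivative - a * bdiff 2 (a * y - b) / 2) (at y)"
  "((\<lambda>y. - a * bdiff 2 (a * y - b) / 2) has_real_derivative - a\<^sup>2 * bdiff 1 (a * y - b)) (at y)"
proof -
  have l: "((\<lambda>y. a * y - b) has_real_derivative a) (at y)"
    by (auto intro!: derivative_eq_intros)
  have 1: "((\<lambda>y. smooth_step (a * y - b)) has_real_derivative (- bdiff 2 (a * y - b) / 2) * a) (at y)"
    by (rule DERIV_chain2[where f = smooth_step and g = "\<lambda>y. a * y - b", OF smooth_step_deriv(1) l])
  then show "(step_fun a b has_real_derivative - a * bdiff 2 (a * y - b) / 2) (at y)"
    unfolding step_fun_def[abs_def] by (rule DERIV_cong) simp
  have "((\<lambda>y. (- bdiff 2 (a * y - b) / 2)) has_real_derivative (- bdiff 1 (a * y - b)) * a) (at y)"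
    by (rule DERIV_chain2[where f = "\<lambda>y. - bdiff 2 y / 2" and g = "\<lambda>y. a * y - b", OF smooth_step_deriv(2) l])
  from DERIV_cmult[OF this, of a]
  have "((\<lambda>y. a * (- bdiff 2 (a * y - b) / 2)) has_real_derivative - a\<^sup>2 * bdiff 1 (a * y - b)) (at y)"
    by (rule DERIV_cong) (simp add: power2_eq_square)
  moreover have "(\<lambda>y. a * (- bdiff 2 (a * y - b) / 2)) = (\<lambda>y. - a * bdiff 2 (a * y - b) / 2)"
    by auto
  ultimately show "((\<lambda>y. - a * bdiff 2 (a * y - b) / 2) has_real_derivative - a\<^sup>2 * bdiff 1 (a * y - b)) (at y)"
    by (simp only:)
qed

text \<open>Two derivatives bring the factor a^2 and the rescaled distance brings a^\<delta>; this
  is the origin of \<psi>^q in L.\<close>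

lemma step_fun_holder:
  assumes "0 < \<delta>" "\<delta> \<le> 1" "0 < a"
  shows "\<bar>- a\<^sup>2 * bdiff 1 (a * x - b) - - a\<^sup>2 * bdiff 1 (a * y - b)\<bar> \<le> 8 * a powr (2 + \<delta>) * \<bar>x - y\<bar> powr \<delta>"
proof -
  have "\<bar>- a\<^sup>2 * bdiff 1 (a * x - b) - - a\<^sup>2 * bdiff 1 (a * y - b)\<bar>
      = a\<^sup>2 * \<bar>bdiff 1 (a * x - b) - bdiff 1 (a * y - b)\<bar>"
  proof -
    have "- a\<^sup>2 * bdiff 1 (a * x - b) - - a\<^sup>2 * bdiff 1 (a * y - b)
      = - (a\<^sup>2 * (bdiff 1 (a * x - b) - bdiff 1 (a * y - b)))" by (simp add: algebra_simps)
    then show ?thesis by (simp add: abs_mult)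
  qed
  also have "\<dots> \<le> a\<^sup>2 * (8 * \<bar>(a * x - b) - (a * y - b)\<bar> powr \<delta>)"
    by (intro mult_left_mono bdiff1_holder) (use assms in auto)
  also have "\<bar>(a * x - b) - (a * y - b)\<bar> = a * \<bar>x - y\<bar>"
    using assms by (simp add: right_diff_distrib[symmetric] abs_mult)
  also have "a\<^sup>2 * (8 * (a * \<bar>x - y\<bar>) powr \<delta>) = 8 * a powr (2 + \<delta>) * \<bar>x - y\<bar> powr \<delta>"
    using assms by (simp add: powr_mult powr_add powr_numeral)
  finally show ?thesis .
qed

section \<open>Rosenthal's inequality\<close>

text \<open>Weighted arithmetic-geometric mean inequality for t^r and 1 with weights 1/r and 1 -
  1/r, read off from the convexity of exp between 0 and r ln t.\<close>

lemma young_unit: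
  fixes t r :: real
  assumes "0 \<le> t" "1 \<le> r"
  shows "t \<le> t powr r / r + (1 - 1 / r)"
proof (cases "t = 0")
  case False
  have "exp ((1 - 1 / r) * 0 + (1 / r) * (r * ln t)) \<le> (1 - 1 / r) * exp 0 + (1 / r) * exp (r * ln t)"
    using convex_onD[OF exp_convex, of "1 / r" 0 "r * ln t"] assms by simp
  moreover have "exp (r * ln t) = t powr r" using False by (simp add: powr_def)
  ultimately show ?thesis using False assms by simp
qed (use assms in simp)

text \<open>Young's bound for f divided by its mean is integrated. The same pointwise bound yields
  the integrability of f, so only that of its r-th power is assumed.\<close>

lemma (in prob_space) jensen_powr:
  fixes f :: "'a \<Rightarrow> real"
  assumes [measurable]: "f \<in> borel_measurable M" and nn: "\<And>x. 0 \<le> f x" and r: "1 \<le> r"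
    and int: "integrable M (\<lambda>x. f x powr r)"
  shows "integrable M f" "(\<integral>x. f x \<partial>M) powr r \<le> (\<integral>x. f x powr r \<partial>M)"
proof -
  show i: "integrable M f"
  proof (rule Bochner_Integration.integrable_bound)
    show "integrable M (\<lambda>x. f x powr r / r + (1 - 1 / r))" using int by simp
    show "AE x in M. norm (f x) \<le> norm (f x powr r / r + (1 - 1 / r))"
      using young_unit[OF nn r] nn by (intro always_eventually) (smt (verit, best) real_norm_def)
  qed simp
  define a where "a = (\<integral>x. f x \<partial>M)"
  have a0: "0 \<le> a" unfolding a_def using nn by simp
  show "(\<integral>x. f x \<partial>M) powr r \<le> (\<integral>x. f x powr r \<partial>M)"
  proof (cases "a = 0")
    case True
    then show ?thesis unfolding a_def[symmetric] using r by simp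
  next
    case False
    then have a: "0 < a" using a0 by simp
    have "(\<integral>x. f x / a \<partial>M) \<le> (\<integral>x. f x powr r / (a powr r * r) + (1 - 1 / r) \<partial>M)"
    proof (rule integral_mono)
      show "f x / a \<le> f x powr r / (a powr r * r) + (1 - 1 / r)" for x
        using young_unit[of "f x / a" r] nn[of x] a r by (simp add: powr_divide)
    qed (use i int in auto)
    also have "\<dots> = (\<integral>x. f x powr r \<partial>M) / (a powr r * r) + (1 - 1 / r)"
      using int by (simp add: prob_space)
    finally have "1 / r \<le> (\<integral>x. f x powr r \<partial>M) / (a powr r * r)"
      using a by (simp add: a_def[symmetric])
    then have "a powr r \<le> (\<integral>x. f x powr r \<partial>M)"
      using a r by (simp add: field_simps)
    then show ?thesis by (simp add: a_def)
  qed
qed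

text \<open>Independence of one coordinate from the others. \<open>upd\<close> says that F ignores
  coordinate \<open>i\<close>, which lets the same F be integrated over both products.\<close>

lemma PiM_insert_mult:
  fixes F :: "('i \<Rightarrow> 'a) \<Rightarrow> real" and G :: "'a \<Rightarrow> real"
  assumes M: "\<And>i. prob_space (M i)" and i: "i \<notin> J"
    and F[measurable]: "F \<in> borel_measurable (PiM (insert i J) M)"
    and G: "integrable (M i) G"
    and FJ: "integrable (PiM J M) F" and upd: "\<And>\<omega> x. F (fun_upd \<omega> i x) = F \<omega>"
  shows "integrable (PiM (insert i J) M) (\<lambda>\<omega>. F \<omega> * G (\<omega> i))"
    and "(\<integral>\<omega>. F \<omega> * G (\<omega> i) \<partial>PiM (insert i J) M) = (\<integral>\<omega>. F \<omega> \<partial>PiM J M) * (\<integral>x. G x \<partial>M i)"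
proof -
  interpret J: prob_space "PiM J M" by (rule prob_space_PiM) (rule M)
  interpret i: prob_space "M i" by (rule M)
  interpret P: pair_sigma_finite "M i" "PiM J M" ..
  have [measurable]: "G \<in> borel_measurable (M i)" using G by simp
  have m: "(\<lambda>(x, X). fun_upd X i x) \<in> measurable (M i \<Otimes>\<^sub>M PiM J M) (PiM (insert i J) M)"
    by measurable
  have d: "PiM (insert i J) M = distr (M i \<Otimes>\<^sub>M PiM J M) (PiM (insert i J) M) (\<lambda>(x, X). fun_upd X i x)"
    by (rule distr_pair_PiM_eq_PiM[symmetric]) (rule M)+
  have FG[measurable]: "(\<lambda>\<omega>. F \<omega> * G (\<omega> i)) \<in> borel_measurable (PiM (insert i J) M)"
    by measurable
  have e: "(\<lambda>z. F ((\<lambda>(x, X). fun_upd X i x) z) * G (((\<lambda>(x, X). fun_upd X i x) z) i)) = (\<lambda>(x, X). G x * F X)"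
    by (auto simp: upd)
  have [measurable]: "F \<in> borel_measurable (PiM J M)" using FJ by simp
  have pr: "integrable (M i \<Otimes>\<^sub>M PiM J M) (\<lambda>(x, X). G x * F X)"
    by (rule P.Fubini_integrable) (use G FJ in \<open>auto simp: abs_mult\<close>)
  show "integrable (PiM (insert i J) M) (\<lambda>\<omega>. F \<omega> * G (\<omega> i))"
    by (subst d, subst integrable_distr_eq[OF m FG], subst e) (rule pr)
  show "(\<integral>\<omega>. F \<omega> * G (\<omega> i) \<partial>PiM (insert i J) M) = (\<integral>\<omega>. F \<omega> \<partial>PiM J M) * (\<integral>x. G x \<partial>M i)"
    by (subst d, subst integral_distr[OF m FG], subst e, subst P.integral_fst[OF pr, symmetric]) simp
qed

text \<open>The integrability claims come from |y|^a \<le> 1 + |y|^q for 0 \<le> a \<le> q. The two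
  inequalities are Jensen with exponents q/2 and 2/\<delta>; Rosenthal's induction uses the latter
  to bound E|S|^\<delta> through the variance.\<close>

lemma (in prob_space) powr_le_moments:
  fixes f :: "'a \<Rightarrow> real"
  assumes \<delta>: "0 < \<delta>" "\<delta> \<le> 1" and [measurable]: "f \<in> borel_measurable M"
    and int: "integrable M (\<lambda>x. \<bar>f x\<bar> powr (2 + \<delta>))"
  shows "integrable M f" "integrable M (\<lambda>x. (f x)\<^sup>2)" "integrable M (\<lambda>x. \<bar>f x\<bar> powr \<delta>)"
    "integrable M (\<lambda>x. sgn (f x) * \<bar>f x\<bar> powr (1 + \<delta>))"
    "(\<integral>x. (f x)\<^sup>2 \<partial>M) powr ((2 + \<delta>) / 2) \<le> (\<integral>x. \<bar>f x\<bar> powr (2 + \<delta>) \<partial>M)"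
    "(\<integral>x. \<bar>f x\<bar> powr \<delta> \<partial>M) \<le> (\<integral>x. (f x)\<^sup>2 \<partial>M) powr (\<delta> / 2)"
proof -
  have b: "\<bar>y\<bar> powr a \<le> 1 + \<bar>y\<bar> powr (2 + \<delta>)" if "0 \<le> a" "a \<le> 2 + \<delta>" for y a :: real
  proof (cases "\<bar>y\<bar> \<le> 1")
    case True
    then have "\<bar>y\<bar> powr a \<le> 1 powr a" using that by (intro powr_mono2) auto
    then show ?thesis by (simp add: add_increasing2)
  next
    case False
    then have "\<bar>y\<bar> powr a \<le> \<bar>y\<bar> powr (2 + \<delta>)" using that by (intro powr_mono) auto
    then show ?thesis by simp
  qed
  have d: "integrable M (\<lambda>x. 1 + \<bar>f x\<bar> powr (2 + \<delta>))" using int by simp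
  have ib: "integrable M h" if "h \<in> borel_measurable M" "\<And>x. \<bar>h x\<bar> \<le> 1 + \<bar>f x\<bar> powr (2 + \<delta>)" for h
    by (rule Bochner_Integration.integrable_bound[OF d that(1)])
      (rule always_eventually, rule allI, simp, rule that(2))
  show "integrable M f"
    by (rule ib, simp) (use b[of 1] \<delta> in simp)
  have sq: "(y)\<^sup>2 = \<bar>y\<bar> powr 2" for y :: real by (cases "y = 0") (auto simp: powr_numeral)
  show i2: "integrable M (\<lambda>x. (f x)\<^sup>2)"
  proof (rule ib)
    show "\<bar>(f x)\<^sup>2\<bar> \<le> 1 + \<bar>f x\<bar> powr (2 + \<delta>)" for x
    proof -
      have "\<bar>(f x)\<^sup>2\<bar> = \<bar>f x\<bar> powr 2" unfolding sq[symmetric] by (rule abs_power2)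
      then show ?thesis using b[of 2 "f x"] \<delta> by linarith
    qed
  qed simp
  show id: "integrable M (\<lambda>x. \<bar>f x\<bar> powr \<delta>)"
    by (rule ib, simp) (use b[of \<delta>] \<delta> in simp)
  show "integrable M (\<lambda>x. sgn (f x) * \<bar>f x\<bar> powr (1 + \<delta>))"
  proof (rule ib)
    have "\<bar>sgn y * \<bar>y\<bar> powr (1 + \<delta>)\<bar> = \<bar>y\<bar> powr (1 + \<delta>)" for y
      by (simp add: abs_mult abs_sgn_eq)
    then show "\<bar>sgn (f x) * \<bar>f x\<bar> powr (1 + \<delta>)\<bar> \<le> 1 + \<bar>f x\<bar> powr (2 + \<delta>)" for x
      using b[of "1 + \<delta>" "f x"] \<delta> by simp
  qed simp
  have e1: "((f x)\<^sup>2) powr ((2 + \<delta>) / 2) = \<bar>f x\<bar> powr (2 + \<delta>)" for x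
    unfolding sq[of "f x"] powr_powr by (rule arg_cong[where f = "(powr) \<bar>f x\<bar>"]) simp
  show "(\<integral>x. (f x)\<^sup>2 \<partial>M) powr ((2 + \<delta>) / 2) \<le> (\<integral>x. \<bar>f x\<bar> powr (2 + \<delta>) \<partial>M)"
    using jensen_powr(2)[of "\<lambda>x. (f x)\<^sup>2" "(2 + \<delta>) / 2"] int \<delta> unfolding e1 by simp
  have e2: "(\<bar>f x\<bar> powr \<delta>) powr (2 / \<delta>) = (f x)\<^sup>2" for x
    unfolding sq[of "f x"] powr_powr by (rule arg_cong[where f = "(powr) \<bar>f x\<bar>"]) (use \<delta> in simp)
  have "(\<integral>x. \<bar>f x\<bar> powr \<delta> \<partial>M) powr (2 / \<delta>) \<le> (\<integral>x. (f x)\<^sup>2 \<partial>M)"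
    using jensen_powr(2)[of "\<lambda>x. \<bar>f x\<bar> powr \<delta>" "2 / \<delta>"] i2 \<delta> unfolding e2 by simp
  then have "((\<integral>x. \<bar>f x\<bar> powr \<delta> \<partial>M) powr (2 / \<delta>)) powr (\<delta> / 2) \<le> (\<integral>x. (f x)\<^sup>2 \<partial>M) powr (\<delta> / 2)"
    using \<delta> by (intro powr_mono2) auto
  then show "(\<integral>x. \<bar>f x\<bar> powr \<delta> \<partial>M) \<le> (\<integral>x. (f x)\<^sup>2 \<partial>M) powr (\<delta> / 2)"
    unfolding powr_powr using \<delta> by simp
qed

text \<open>Rosenthal's inequality for \<open>2 < q \<le> 3\<close>: add one summand at a time and expand \<open>\<bar>s + x\<bar>\<^sup>q\<close> to second order.\<close>
lemma rosenthal_PiM: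
  fixes M :: "'i \<Rightarrow> 'a measure" and g :: "'i \<Rightarrow> 'a \<Rightarrow> real"
  assumes \<delta>: "0 < \<delta>" "\<delta> \<le> 1" and M: "\<And>i. prob_space (M i)" and "finite I"
    and g: "\<And>i. i \<in> I \<Longrightarrow> g i \<in> borel_measurable (M i)"
      "\<And>i. i \<in> I \<Longrightarrow> integrable (M i) (\<lambda>x. \<bar>g i x\<bar> powr (2 + \<delta>))"
      "\<And>i. i \<in> I \<Longrightarrow> (\<integral>x. g i x \<partial>M i) = 0"
  shows "integrable (PiM I M) (\<lambda>\<omega>. \<bar>\<Sum>i\<in>I. g i (\<omega> i)\<bar> powr (2 + \<delta>)) \<and>
    (\<integral>\<omega>. (\<Sum>i\<in>I. g i (\<omega> i))\<^sup>2 \<partial>PiM I M) = (\<Sum>i\<in>I. \<integral>x. (g i x)\<^sup>2 \<partial>M i) \<and>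
    (\<integral>\<omega>. \<bar>\<Sum>i\<in>I. g i (\<omega> i)\<bar> powr (2 + \<delta>) \<partial>PiM I M)
      \<le> 3 * ((\<Sum>i\<in>I. \<integral>x. (g i x)\<^sup>2 \<partial>M i) powr ((2 + \<delta>) / 2) + (\<Sum>i\<in>I. \<integral>x. \<bar>g i x\<bar> powr (2 + \<delta>) \<partial>M i))"
  using \<open>finite I\<close> g
\<comment> \<open>The second-moment identity is carried along because the mixed term, E|S|^\<delta>
  times the variance of the new summand, is bounded through the variance of S.\<close>
proof (induction I)
  case empty
  interpret prob_space "PiM {} M" by (rule prob_space_PiM) (rule M)
  show ?case using \<delta> by simp
next
  case (insert i J)
  let ?q = "2 + \<delta>"
  let ?P = "PiM (insert i J) M"
  interpret J: prob_space "PiM J M" by (rule prob_space_PiM) (rule M)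
  interpret i: prob_space "M i" by (rule M)
  define S where "S \<omega> = (\<Sum>j\<in>J. g j (\<omega> j))" for \<omega>
  define \<sigma> where "\<sigma> = (\<Sum>j\<in>J. \<integral>x. (g j x)\<^sup>2 \<partial>M j)"
  define \<tau> where "\<tau> = (\<integral>x. (g i x)\<^sup>2 \<partial>M i)"
  define m where "m = (\<integral>x. \<bar>g i x\<bar> powr ?q \<partial>M i)"
  define R where "R = (\<Sum>j\<in>J. \<integral>x. \<bar>g j x\<bar> powr ?q \<partial>M j)"
  have [measurable]: "g j \<in> borel_measurable (M j)" if "j = i \<or> j \<in> J" for j
    using insert.prems(1) that by auto
  have IH: "integrable (PiM J M) (\<lambda>\<omega>. \<bar>S \<omega>\<bar> powr ?q)"
    "(\<integral>\<omega>. (S \<omega>)\<^sup>2 \<partial>PiM J M) = \<sigma>" "(\<integral>\<omega>. \<bar>S \<omega>\<bar> powr ?q \<partial>PiM J M) \<le> 3 * (\<sigma> powr (?q / 2) + R)"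
    using insert.IH insert.prems unfolding S_def \<sigma>_def R_def by auto
  have Sm[measurable]: "S \<in> borel_measurable (PiM J M)" "S \<in> borel_measurable ?P"
    unfolding S_def by measurable
  have upd: "S (fun_upd \<omega> i x) = S \<omega>" for \<omega> x
    unfolding S_def using insert.hyps by (intro sum.cong) auto
  have gi: "integrable (M i) (\<lambda>x. \<bar>g i x\<bar> powr ?q)" and gi0: "(\<integral>x. g i x \<partial>M i) = 0"
    using insert.prems by auto
  note Sp = J.powr_le_moments[OF \<delta> Sm(1) IH(1)]
  have gim: "g i \<in> borel_measurable (M i)" by simp
  note gp = i.powr_le_moments[OF \<delta> gim gi]
  have pm: "integrable ?P (\<lambda>\<omega>. F (S \<omega>) * G (g i (\<omega> i)))"
    "(\<integral>\<omega>. F (S \<omega>) * G (g i (\<omega> i)) \<partial>?P) = (\<integral>\<omega>. F (S \<omega>) \<partial>PiM J M) * (\<integral>x. G (g i x) \<partial>M i)"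
    if "F \<in> borel_measurable borel" "integrable (PiM J M) (\<lambda>\<omega>. F (S \<omega>))" "integrable (M i) (\<lambda>x. G (g i x))"
    for F G :: "real \<Rightarrow> real"
    using that PiM_insert_mult[of M i J "\<lambda>\<omega>. F (S \<omega>)" "\<lambda>x. G (g i x)"] M insert.hyps upd by auto
  have q1: "integrable ?P (\<lambda>\<omega>. \<bar>S \<omega>\<bar> powr ?q)" "(\<integral>\<omega>. \<bar>S \<omega>\<bar> powr ?q \<partial>?P) = (\<integral>\<omega>. \<bar>S \<omega>\<bar> powr ?q \<partial>PiM J M)"
    using pm(1)[of "\<lambda>s. \<bar>s\<bar> powr ?q" "\<lambda>_. 1"] pm(2)[of "\<lambda>s. \<bar>s\<bar> powr ?q" "\<lambda>_. 1"] IH(1) by (simp_all add: i.prob_space)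
  have c: "integrable (PiM J M) (\<lambda>_. 1::real)" "(\<integral>\<omega>. (1::real) \<partial>PiM J M) = 1"
    by (rule J.integrable_const) (simp add: J.prob_space)
  have q2: "integrable ?P (\<lambda>\<omega>. \<bar>g i (\<omega> i)\<bar> powr ?q)" "(\<integral>\<omega>. \<bar>g i (\<omega> i)\<bar> powr ?q \<partial>?P) = m"
    using pm[of "\<lambda>_. 1" "\<lambda>s. \<bar>s\<bar> powr ?q", OF borel_measurable_const c(1) gi]
    unfolding c(2) mult_1 m_def[symmetric] .
  have q3: "integrable ?P (\<lambda>\<omega>. \<bar>S \<omega>\<bar> powr \<delta> * (g i (\<omega> i))\<^sup>2)"
     "(\<integral>\<omega>. \<bar>S \<omega>\<bar> powr \<delta> * (g i (\<omega> i))\<^sup>2 \<partial>?P) = (\<integral>\<omega>. \<bar>S \<omega>\<bar> powr \<delta> \<partial>PiM J M) * \<tau>"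
    using pm(1)[of "\<lambda>s. \<bar>s\<bar> powr \<delta>" "\<lambda>s. s\<^sup>2"] pm(2)[of "\<lambda>s. \<bar>s\<bar> powr \<delta>" "\<lambda>s. s\<^sup>2"] Sp(3) gp(2) by (simp_all add: \<tau>_def)
  \<comment> \<open>The first-order term factorises by independence and vanishes because the new
    summand has mean 0.\<close>
  have q4: "integrable ?P (\<lambda>\<omega>. (2 + \<delta>) * (sgn (S \<omega>) * \<bar>S \<omega>\<bar> powr (1 + \<delta>)) * g i (\<omega> i))"
     "(\<integral>\<omega>. (2 + \<delta>) * (sgn (S \<omega>) * \<bar>S \<omega>\<bar> powr (1 + \<delta>)) * g i (\<omega> i) \<partial>?P) = 0"
    using pm(1)[of "\<lambda>s. (2 + \<delta>) * (sgn s * \<bar>s\<bar> powr (1 + \<delta>))" "\<lambda>s. s"] pm(2)[of "\<lambda>s. (2 + \<delta>) * (sgn s * \<bar>s\<bar> powr (1 + \<delta>))" "\<lambda>s. s"] Sp(4) gp(1) gi0 by simp_all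
  have q5: "integrable ?P (\<lambda>\<omega>. (S \<omega>)\<^sup>2)" "(\<integral>\<omega>. (S \<omega>)\<^sup>2 \<partial>?P) = \<sigma>"
    using pm(1)[of "\<lambda>s. s\<^sup>2" "\<lambda>_. 1"] pm(2)[of "\<lambda>s. s\<^sup>2" "\<lambda>_. 1"] IH(2) Sp(2) by (simp_all add: i.prob_space)
  have q6: "integrable ?P (\<lambda>\<omega>. (g i (\<omega> i))\<^sup>2)" "(\<integral>\<omega>. (g i (\<omega> i))\<^sup>2 \<partial>?P) = \<tau>"
    using pm[of "\<lambda>_. 1" "\<lambda>s. s\<^sup>2", OF borel_measurable_const c(1) gp(2)]
    unfolding c(2) mult_1 \<tau>_def[symmetric] .
  have q7: "integrable ?P (\<lambda>\<omega>. 2 * S \<omega> * g i (\<omega> i))" "(\<integral>\<omega>. 2 * S \<omega> * g i (\<omega> i) \<partial>?P) = 0"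
    using pm(1)[of "\<lambda>s. 2 * s" "\<lambda>s. s"] pm(2)[of "\<lambda>s. 2 * s" "\<lambda>s. s"] Sp(1) gp(1) gi0 by simp_all
  have sum: "(\<Sum>j\<in>insert i J. g j (\<omega> j)) = S \<omega> + g i (\<omega> i)" for \<omega>
    using insert.hyps by (simp add: S_def)
  have int: "integrable ?P (\<lambda>\<omega>. \<bar>S \<omega> + g i (\<omega> i)\<bar> powr ?q)"
  proof (rule Bochner_Integration.integrable_bound)
    show "integrable ?P (\<lambda>\<omega>. 8 * (\<bar>S \<omega>\<bar> powr ?q + \<bar>g i (\<omega> i)\<bar> powr ?q))"
      using q1(1) q2(1) by simp
    show "AE \<omega> in ?P. norm (\<bar>S \<omega> + g i (\<omega> i)\<bar> powr ?q) \<le> norm (8 * (\<bar>S \<omega>\<bar> powr ?q + \<bar>g i (\<omega> i)\<bar> powr ?q))"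
      using abs_add_powr_le[of ?q] \<delta> by (intro always_eventually) auto
  qed simp
  have nn: "0 \<le> \<sigma>" "0 \<le> \<tau>" "0 \<le> m" "0 \<le> R"
    unfolding \<sigma>_def \<tau>_def m_def R_def by (auto intro!: sum_nonneg)
  have sq: "(\<integral>\<omega>. (S \<omega> + g i (\<omega> i))\<^sup>2 \<partial>?P) = \<sigma> + \<tau>"
  proof -
    have "(\<integral>\<omega>. (S \<omega> + g i (\<omega> i))\<^sup>2 \<partial>?P) = (\<integral>\<omega>. (S \<omega>)\<^sup>2 + 2 * S \<omega> * g i (\<omega> i) + (g i (\<omega> i))\<^sup>2 \<partial>?P)"
      by (intro Bochner_Integration.integral_cong) (auto simp: power2_eq_square algebra_simps)
    then show ?thesis using q5 q6 q7 by simp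
  qed
  have "(\<integral>\<omega>. \<bar>S \<omega> + g i (\<omega> i)\<bar> powr ?q \<partial>?P)
      \<le> (\<integral>\<omega>. \<bar>S \<omega>\<bar> powr ?q + (2 + \<delta>) * (sgn (S \<omega>) * \<bar>S \<omega>\<bar> powr (1 + \<delta>)) * g i (\<omega> i)
           + 3 * (\<bar>S \<omega>\<bar> powr \<delta> * (g i (\<omega> i))\<^sup>2) + 3 * \<bar>g i (\<omega> i)\<bar> powr ?q \<partial>?P)"
    by (rule integral_mono[OF int]) (use q1 q2 q3 q4 abs_powr_expansion[OF \<delta>] in auto)
  also have "\<dots> = (\<integral>\<omega>. \<bar>S \<omega>\<bar> powr ?q \<partial>PiM J M) + 3 * ((\<integral>\<omega>. \<bar>S \<omega>\<bar> powr \<delta> \<partial>PiM J M) * \<tau>) + 3 * m"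
    using q1 q2 q3 q4 by simp
  also have "\<dots> \<le> 3 * (\<sigma> powr (?q / 2) + R) + 3 * (\<sigma> powr (\<delta> / 2) * \<tau>) + 3 * m"
    using IH(3) Sp(6) nn unfolding IH(2) by (intro add_mono mult_left_mono mult_right_mono) auto
  \<comment> \<open>The mixed term is absorbed by \<sigma>^(q/2) + \<sigma>^(\<delta>/2) \<tau> =
    \<sigma>^(\<delta>/2) (\<sigma> + \<tau>) \<le> (\<sigma> + \<tau>)^(q/2). The constant 3
    therefore does not grow with the number of summands.\<close>
  also have "\<dots> \<le> 3 * ((\<sigma> + \<tau>) powr (?q / 2) + (R + m))"
  proof -
    have e: "?q / 2 = \<delta> / 2 + 1" by simp
    have p: "x powr (?q / 2) = x powr (\<delta> / 2) * x" if "0 \<le> x" for x :: real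
      using that unfolding e powr_add by simp
    have "\<sigma> powr (?q / 2) + \<sigma> powr (\<delta> / 2) * \<tau> = \<sigma> powr (\<delta> / 2) * (\<sigma> + \<tau>)"
      using nn by (simp add: p distrib_left)
    also have "\<dots> \<le> (\<sigma> + \<tau>) powr (\<delta> / 2) * (\<sigma> + \<tau>)"
      using nn \<delta> by (intro mult_right_mono powr_mono2) auto
    also have "\<dots> = (\<sigma> + \<tau>) powr (?q / 2)" using nn by (simp add: p)
    finally show ?thesis by simp
  qed
  finally show ?case
    using int sq insert.hyps unfolding sum
    by (simp add: \<sigma>_def \<tau>_def m_def R_def add.commute)
qed

section \<open>Concentration of weighted sums of centred chi-square variables\<close>

lemma prob_space_stdN: "prob_space stdN"
  unfolding stdN_def by (rule prob_space_normal_density) simp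

lemma sets_stdN [simp, measurable_cong]: "sets stdN = sets borel"
  by (simp add: stdN_def)

lemma space_stdN [simp]: "space stdN = UNIV"
  by (simp add: stdN_def)

lemma integral_stdN:
  fixes f :: "real \<Rightarrow> 'b::{banach, second_countable_topology}"
  assumes "f \<in> borel_measurable borel"
  shows "integral\<^sup>L stdN f = (\<integral>x. std_normal_density x *\<^sub>R f x \<partial>lborel)"
  unfolding stdN_def using assms by (intro integral_density) auto

text \<open>The integrand is a multiple of the centred normal density with variance 1 / (2
  a).\<close>

lemma integral_exp_neg_square:
  assumes "0 < a"
  shows "(\<integral>u. exp (- a * u\<^sup>2) \<partial>lborel) = sqrt (pi / a)"
proof -
  define \<sigma> where "\<sigma> = 1 / sqrt (2 * a)"
  have s2: "\<sigma>\<^sup>2 = 1 / (2 * a)" using assms by (simp add: \<sigma>_def power_divide)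
  have "exp (- a * u\<^sup>2) = sqrt (pi / a) * normal_density 0 \<sigma> u" for u
    unfolding normal_density_def s2 using assms by (simp add: real_sqrt_divide)
  then have "(\<integral>u. exp (- a * u\<^sup>2) \<partial>lborel) = sqrt (pi / a) * (\<integral>u. normal_density 0 \<sigma> u \<partial>lborel)"
    by simp
  also have "(\<integral>u. normal_density 0 \<sigma> u \<partial>lborel) = 1"
    using assms by (intro integral_normal_density) (simp add: \<sigma>_def)
  finally show ?thesis by simp
qed

text \<open>\<open>\<bar>\<phi>\<bar>\<^sup>2\<close> is a double integral of \<open>exp (i s (x\<^sup>2 - y\<^sup>2))\<close>; the shear \<open>x = v + u/2, y = v - u/2\<close> turns the phase into \<open>2 s u v\<close>.\<close>
lemma norm_char_square_stdN:
  "(cmod (\<integral>x. iexp (s * x\<^sup>2) \<partial>stdN))\<^sup>2 = 1 / sqrt (1 + 4 * s\<^sup>2)"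
proof -
  let ?f = "std_normal_density"
  define F where "F = (\<integral>x. iexp (s * x\<^sup>2) \<partial>stdN)"
  define h where "h x y = (?f x * ?f y) *\<^sub>R iexp (s * (x\<^sup>2 - y\<^sup>2))" for x y
  have hm[measurable]: "(\<lambda>z. h (fst z) (snd z)) \<in> borel_measurable (borel \<Otimes>\<^sub>M borel)"
    unfolding h_def by measurable
  have F: "F = (\<integral>x. ?f x *\<^sub>R iexp (s * x\<^sup>2) \<partial>lborel)"
    unfolding F_def by (rule integral_stdN) measurable
  have cF: "cnj F = (\<integral>x. ?f x *\<^sub>R iexp (- s * x\<^sup>2) \<partial>lborel)"
    unfolding F
    by (subst Bochner_Integration.integral_cnj[symmetric], intro Bochner_Integration.integral_cong refl) (simp add: exp_cnj)
  have int1: "integrable lborel (\<lambda>x. ?f x *\<^sub>R iexp (r * x\<^sup>2))" for r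
    by (rule Bochner_Integration.integrable_bound[where f = ?f]) auto
  have "F * cnj F = (\<integral>y. F * (?f y *\<^sub>R iexp (- s * y\<^sup>2)) \<partial>lborel)"
    unfolding cF by (rule integral_mult_right_zero[symmetric])
  also have "\<dots> = (\<integral>y. (\<integral>x. h x y \<partial>lborel) \<partial>lborel)"
  proof (intro Bochner_Integration.integral_cong refl)
    fix y
    have "F * (?f y *\<^sub>R iexp (- s * y\<^sup>2)) = (\<integral>x. (?f x *\<^sub>R iexp (s * x\<^sup>2)) * (?f y *\<^sub>R iexp (- s * y\<^sup>2)) \<partial>lborel)"
      unfolding F by (rule integral_mult_left_zero[symmetric])
    also have "\<dots> = (\<integral>x. h x y \<partial>lborel)"
      by (intro Bochner_Integration.integral_cong refl)
        (simp add: h_def exp_add[symmetric] algebra_simps mult_exp_exp)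
    finally show "F * (?f y *\<^sub>R iexp (- s * y\<^sup>2)) = (\<integral>x. h x y \<partial>lborel)" .
  qed
  \<comment> \<open>First half of the shear: u = x - y at fixed y, after which the order of
    integration is exchanged.\<close>
  also have "\<dots> = (\<integral>y. (\<integral>u. h (y + u) y \<partial>lborel) \<partial>lborel)"
    using lborel_integral_real_affine[of 1 "\<lambda>x. h x y" y for y] by simp
  also have "\<dots> = (\<integral>u. (\<integral>y. h (y + u) y \<partial>lborel) \<partial>lborel)"
  proof (rule lborel_pair.Fubini_integral[symmetric])
    have hb: "norm (h (y + u) y) = ?f (y + u) * ?f y" for y u
      by (simp add: h_def)
    have fi: "integrable lborel (\<lambda>u. ?f (y + u))" for y
      using lborel_integrable_real_affine[of ?f 1 y] by simp
    have f1: "(\<integral>u. ?f (y + u) \<partial>lborel) = 1" for y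
      using lborel_integral_real_affine[of 1 ?f y] by simp
    show "integrable (lborel \<Otimes>\<^sub>M lborel) (\<lambda>(y, u). h (y + u) y)"
    proof (rule lborel_pair.Fubini_integrable)
      show "(\<lambda>(y, u). h (y + u) y) \<in> borel_measurable (lborel \<Otimes>\<^sub>M lborel)"
        unfolding h_def by measurable
      show "integrable lborel (\<lambda>y. \<integral>u. norm (case (y, u) of (y, u) \<Rightarrow> h (y + u) y) \<partial>lborel)"
        by (simp add: hb f1)
      show "AE y in lborel. integrable lborel (\<lambda>u. case (y, u) of (y, u) \<Rightarrow> h (y + u) y)"
      proof (rule AE_I2)
        fix y
        show "integrable lborel (\<lambda>u. case (y, u) of (y, u) \<Rightarrow> h (y + u) y)"
          by (rule Bochner_Integration.integrable_bound[where f = "\<lambda>u. ?f (y + u) * ?f y"])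
            (use fi in \<open>auto simp: hb, simp add: h_def\<close>)
      qed
    qed
  qed
  also have "\<dots> = (\<integral>u. complex_of_real (1 / (2 * sqrt pi) * exp (- (1 / 4 + s\<^sup>2) * u\<^sup>2)) \<partial>lborel)"
  proof (intro Bochner_Integration.integral_cong refl)
    fix u :: real
    \<comment> \<open>Second half of the shear: y = v - u/2 with v = w / sqrt 2. This scaling turns
      exp(-v^2) into exp(-w^2 / 2), so the inner integral is the characteristic function of a
      standard normal at sqrt 2 * s * u, and the outer one is a Gaussian integral.\<close>
    have e: "h (- u / 2 + (1 / sqrt 2) * w + u) (- u / 2 + (1 / sqrt 2) * w)
        = complex_of_real (exp (- u\<^sup>2 / 4) / sqrt (2 * pi)) * (?f w *\<^sub>R iexp ((sqrt 2 * s * u) * w))" for w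
    proof -
      define v where "v = (1 / sqrt 2) * w"
      have v2: "v\<^sup>2 = w\<^sup>2 / 2" by (simp add: v_def power_divide)
      have "?f (v + u / 2) * ?f (v - u / 2) = exp (- (v + u / 2)\<^sup>2 / 2 + - (v - u / 2)\<^sup>2 / 2) / (2 * pi)"
        unfolding std_normal_density_def exp_add by simp
      also have "- (v + u / 2)\<^sup>2 / 2 + - (v - u / 2)\<^sup>2 / 2 = - w\<^sup>2 / 2 + - u\<^sup>2 / 4"
        using v2 by (simp add: power2_eq_square field_simps)
      also have "exp (- w\<^sup>2 / 2 + - u\<^sup>2 / 4) / (2 * pi) = exp (- u\<^sup>2 / 4) / sqrt (2 * pi) * ?f w"
        unfolding std_normal_density_def exp_add by simp
      finally have 1: "?f (v + u / 2) * ?f (v - u / 2) = exp (- u\<^sup>2 / 4) / sqrt (2 * pi) * ?f w" .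
      have "s * ((v + u / 2)\<^sup>2 - (v - u / 2)\<^sup>2) = 2 * s * u * v"
        by (simp add: power2_eq_square field_simps)
      also have "\<dots> = sqrt 2 * s * u * w"
        by (simp add: v_def field_simps)
      finally have 2: "s * ((v + u / 2)\<^sup>2 - (v - u / 2)\<^sup>2) = sqrt 2 * s * u * w" .
      have "h (v + u / 2) (v - u / 2) = (exp (- u\<^sup>2 / 4) / sqrt (2 * pi) * ?f w) *\<^sub>R iexp (sqrt 2 * s * u * w)"
        unfolding h_def 1 2 ..
      moreover have "- u / 2 + (1 / sqrt 2) * w + u = v + u / 2" "- u / 2 + (1 / sqrt 2) * w = v - u / 2"
        by (simp_all add: v_def)
      ultimately show ?thesis by (simp only: scaleR_conv_of_real of_real_mult mult.assoc)
    qed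
    have ch: "(\<integral>w. ?f w *\<^sub>R iexp (r * w) \<partial>lborel) = complex_of_real (exp (- r\<^sup>2 / 2))" for r
      using fun_cong[OF char_std_normal_distribution, of r] unfolding char_def
      by (subst (asm) integral_density) auto
    have "(\<integral>y. h (y + u) y \<partial>lborel) = (1 / sqrt 2) *\<^sub>R (\<integral>w. h (- u / 2 + (1 / sqrt 2) * w + u) (- u / 2 + (1 / sqrt 2) * w) \<partial>lborel)"
      using lborel_integral_real_affine[of "1 / sqrt 2" "\<lambda>y. h (y + u) y" "- u / 2"] by simp
    also have "\<dots> = (1 / sqrt 2) *\<^sub>R (complex_of_real (exp (- u\<^sup>2 / 4) / sqrt (2 * pi)) *
        complex_of_real (exp (- (sqrt 2 * s * u)\<^sup>2 / 2)))"
      unfolding e ch[symmetric] by (subst integral_mult_right_zero) simp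
    also have "\<dots> = complex_of_real ((1 / sqrt 2) * (exp (- u\<^sup>2 / 4) / sqrt (2 * pi)) * exp (- (sqrt 2 * s * u)\<^sup>2 / 2))"
      by (simp add: scaleR_conv_of_real)
    also have "(1 / sqrt 2) * (exp (- u\<^sup>2 / 4) / sqrt (2 * pi)) * exp (- (sqrt 2 * s * u)\<^sup>2 / 2)
        = 1 / (2 * sqrt pi) * exp (- (1 / 4 + s\<^sup>2) * u\<^sup>2)"
    proof -
      have "exp (- u\<^sup>2 / 4) * exp (- (sqrt 2 * s * u)\<^sup>2 / 2) = exp (- (1 / 4 + s\<^sup>2) * u\<^sup>2)"
        unfolding exp_add[symmetric] by (rule arg_cong[where f = exp]) (simp add: power_mult_distrib algebra_simps)
      then show ?thesis by (simp add: real_sqrt_mult field_simps)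
    qed
    finally show "(\<integral>y. h (y + u) y \<partial>lborel) = complex_of_real (1 / (2 * sqrt pi) * exp (- (1 / 4 + s\<^sup>2) * u\<^sup>2))" .
  qed
  also have "\<dots> = complex_of_real (1 / (2 * sqrt pi) * sqrt (pi / (1 / 4 + s\<^sup>2)))"
  proof -
    have "0 < 1 / 4 + s\<^sup>2" by (simp add: add_pos_nonneg)
    from integral_exp_neg_square[OF this] show ?thesis
      by (subst integral_complex_of_real) (simp only: integral_mult_right_zero)
  qed
  also have "1 / (2 * sqrt pi) * sqrt (pi / (1 / 4 + s\<^sup>2)) = 1 / sqrt (1 + 4 * s\<^sup>2)"
  proof -
    have "sqrt (1 + 4 * s\<^sup>2) = sqrt (4 * (1 / 4 + s\<^sup>2))" by simp
    also have "\<dots> = 2 * sqrt (1 / 4 + s\<^sup>2)" unfolding real_sqrt_mult by simp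
    finally show ?thesis by (simp add: real_sqrt_divide)
  qed
  finally have "F * cnj F = complex_of_real (1 / sqrt (1 + 4 * s\<^sup>2))" .
  then have "complex_of_real ((cmod F)\<^sup>2) = complex_of_real (1 / sqrt (1 + 4 * s\<^sup>2))"
    by (simp only: complex_norm_square)
  then show ?thesis unfolding F_def[symmetric] of_real_eq_iff .
qed

text \<open>Centring only contributes a factor of modulus 1. The fourth power is taken because it
  leaves a rational function of s, whose product over the coordinates can be bounded
  directly.\<close>

lemma norm_char_centred_chi2:
  "cmod (\<integral>x. iexp (s * (x\<^sup>2 - 1)) \<partial>stdN) ^ 4 = 1 / (1 + 4 * s\<^sup>2)"
proof -
  have "(\<integral>x. iexp (s * (x\<^sup>2 - 1)) \<partial>stdN) = (\<integral>x. iexp (- s) * iexp (s * x\<^sup>2) \<partial>stdN)"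
    by (intro Bochner_Integration.integral_cong refl) (simp add: mult_exp_exp algebra_simps)
  then have "cmod (\<integral>x. iexp (s * (x\<^sup>2 - 1)) \<partial>stdN) = cmod (\<integral>x. iexp (s * x\<^sup>2) \<partial>stdN)"
    by (simp add: norm_mult)
  moreover have "x ^ 4 = (x\<^sup>2)\<^sup>2" for x :: real by simp
  ultimately have "cmod (\<integral>x. iexp (s * (x\<^sup>2 - 1)) \<partial>stdN) ^ 4 = (1 / sqrt (1 + 4 * s\<^sup>2))\<^sup>2"
    by (simp only: norm_char_square_stdN)
  also have "\<dots> = 1 / (1 + 4 * s\<^sup>2)"
    by (simp add: power_divide)
  finally show ?thesis .
qed

text \<open>Only the constant and linear terms of the expanded product are kept. For b_j = 4 (s
  a_j)^2 they depend on the weights through their sum of squares alone, hence not on the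
  dimension.\<close>

lemma prod_one_plus_ge:
  fixes b :: "'i \<Rightarrow> real"
  assumes "finite I" "\<And>i. i \<in> I \<Longrightarrow> 0 \<le> b i"
  shows "1 + (\<Sum>i\<in>I. b i) \<le> (\<Prod>i\<in>I. 1 + b i)"
  using assms
proof (induction I)
  case (insert i I)
  have p: "1 \<le> (\<Prod>i\<in>I. 1 + b i)" using insert.prems by (intro prod_ge_1) auto
  have "1 + (\<Sum>i\<in>insert i I. b i) = (1 + (\<Sum>i\<in>I. b i)) + b i * 1"
    using insert.hyps by simp
  also have "\<dots> \<le> (\<Prod>i\<in>I. 1 + b i) + b i * (\<Prod>i\<in>I. 1 + b i)"
    using insert p by (intro add_mono mult_left_mono) auto
  also have "\<dots> = (\<Prod>i\<in>insert i I. 1 + b i)"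
    using insert.hyps by (simp add: algebra_simps)
  finally show ?case .
qed simp

text \<open>With \<open>a j\<close> = lambda_j / f this is V, as a function of standard normal
  coordinates instead of chi-square ones.\<close>

definition chi_form :: "nat \<Rightarrow> (nat \<Rightarrow> real) \<Rightarrow> (nat \<Rightarrow> real) \<Rightarrow> real" where
  "chi_form p a x = (\<Sum>j<p. a j * ((x j)\<^sup>2 - 1))"

lemma measurable_chi_form [measurable]:
  "chi_form p a \<in> borel_measurable (PiM {..<p} (\<lambda>_. stdN))"
  unfolding chi_form_def[abs_def] by measurable

text \<open>The bound is uniform in the spectrum. The exponent -1/2 is dictated by rank one, where
  the characteristic function of a single centred chi-square variable decays no faster.\<close>

lemma norm_char_chi_form:
  assumes "(\<Sum>j<p. (a j)\<^sup>2) = 1" "s \<noteq> 0"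
  shows "cmod (\<integral>x. iexp (s * chi_form p a x) \<partial>PiM {..<p} (\<lambda>_. stdN)) \<le> \<bar>2 * s\<bar> powr (- 1 / 2)"
proof -
  interpret product_sigma_finite "\<lambda>_::nat. stdN"
    using prob_space_stdN by (intro product_sigma_finite.intro prob_space_imp_sigma_finite)
  interpret S: prob_space stdN by (rule prob_space_stdN)
  have e: "iexp (s * chi_form p a x) = (\<Prod>j<p. iexp ((s * a j) * ((x j)\<^sup>2 - 1)))" for x
    unfolding chi_form_def exp_sum[OF finite_lessThan, symmetric]
    by (simp add: sum_distrib_left mult.assoc)
  have i: "integrable stdN (\<lambda>x. iexp (r * (x\<^sup>2 - 1)))" for r
    by (rule S.integrable_const_bound[of _ 1]) auto
  have "(\<integral>x. iexp (s * chi_form p a x) \<partial>PiM {..<p} (\<lambda>_. stdN))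
      = (\<Prod>j<p. \<integral>x. iexp ((s * a j) * (x\<^sup>2 - 1)) \<partial>stdN)"
    unfolding e by (rule product_integral_prod[OF finite_lessThan i])
  then have "cmod (\<integral>x. iexp (s * chi_form p a x) \<partial>PiM {..<p} (\<lambda>_. stdN)) ^ 4
      = (\<Prod>j<p. cmod (\<integral>x. iexp ((s * a j) * (x\<^sup>2 - 1)) \<partial>stdN) ^ 4)"
    by (simp only: prod_norm[symmetric] prod_power_distrib)
  also have "\<dots> = 1 / (\<Prod>j<p. 1 + 4 * (s * a j)\<^sup>2)"
    by (simp only: norm_char_centred_chi2 prod_dividef prod.neutral_const)
  also have "\<dots> \<le> 1 / (4 * s\<^sup>2)"
  proof (rule divide_left_mono)
    have "4 * s\<^sup>2 = (\<Sum>j<p. 4 * (s * a j)\<^sup>2)"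
      using assms(1) by (simp add: power_mult_distrib sum_distrib_left[symmetric])
    also have "\<dots> \<le> (\<Prod>j<p. 1 + 4 * (s * a j)\<^sup>2)"
      using prod_one_plus_ge[of "{..<p}" "\<lambda>j. 4 * (s * a j)\<^sup>2"] by simp
    finally show "4 * s\<^sup>2 \<le> (\<Prod>j<p. 1 + 4 * (s * a j)\<^sup>2)" .
    show "0 < (\<Prod>j<p. 1 + 4 * (s * a j)\<^sup>2) * (4 * s\<^sup>2)"
      using assms(2) by (intro mult_pos_pos prod_pos) (auto intro: add_pos_nonneg)
  qed simp
  also have "\<dots> = (\<bar>2 * s\<bar> powr (- 1 / 2)) ^ 4"
  proof -
    have "(\<bar>2 * s\<bar> powr (- 1 / 2)) ^ 4 = \<bar>2 * s\<bar> powr (- 2)"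
      by (subst powr_power) (use assms(2) in auto)
    also have "\<dots> = 1 / \<bar>2 * s\<bar> powr 2" by (rule powr_minus_divide)
    also have "\<bar>2 * s\<bar> powr 2 = \<bar>2 * s\<bar>\<^sup>2" by (rule powr_numeral) simp
    also have "\<dots> = 4 * s\<^sup>2" by (simp only: power2_abs power_mult_distrib) simp
    finally show ?thesis by simp
  qed
  finally show ?thesis by (rule power_le_imp_le_base[of _ 3, simplified]) simp
qed

text \<open>The singularity at 0 is integrable against a density bounded by 1, and the power is at
  most 1 where |x| > 1. The integral enters the constant of the concentration bound.\<close>

lemma integrable_stdN_powr_neg_half: "integrable stdN (\<lambda>x. \<bar>x\<bar> powr (- 1 / 2))"
proof -
  interpret S: prob_space stdN by (rule prob_space_stdN)
  define k where "k x = indicator {0..1} x * (x powr (- 1 / 2))" for x :: real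
  have kb: "integrable lborel k"
  proof -
    have "((\<lambda>x. x powr (- 1 / 2)) has_integral (1 powr (- 1 / 2 + 1) / (- 1 / 2 + 1))) {0..1::real}"
      by (rule has_integral_powr_from_0) auto
    then have "(\<lambda>x::real. x powr (- 1 / 2)) absolutely_integrable_on {0..1}"
      by (intro nonnegative_absolutely_integrable_1) (auto simp: integrable_on_def)
    then have "integrable lebesgue k"
      unfolding set_integrable_def k_def[abs_def] by simp
    then show ?thesis
      by (subst (asm) integrable_completion) (simp_all add: k_def[abs_def])
  qed
  have kb': "integrable lborel (\<lambda>x. k (- x))"
    using lborel_integrable_real_affine[OF kb, of "-1" 0] by simp
  have d: "std_normal_density x \<le> 1" for x
  proof -
    have "std_normal_density x \<le> (1 / sqrt (2 * pi)) * 1"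
      unfolding std_normal_density_def by (intro mult_left_mono) auto
    also have "\<dots> \<le> 1" using pi_gt3 by simp
    finally show ?thesis .
  qed
  have "integrable lborel (\<lambda>x. std_normal_density x *\<^sub>R \<bar>x\<bar> powr (- 1 / 2))"
  proof (rule Bochner_Integration.integrable_bound)
    show "integrable lborel (\<lambda>x. std_normal_density x + (k x + k (- x)))"
      using kb kb' by (intro Bochner_Integration.integrable_add integrable_normal_density) auto
    have "std_normal_density x * \<bar>x\<bar> powr (- 1 / 2) \<le> std_normal_density x + (k x + k (- x))" for x :: real
    proof (cases "\<bar>x\<bar> \<le> 1")
      case True
      have "std_normal_density x * \<bar>x\<bar> powr (- 1 / 2) \<le> 1 * \<bar>x\<bar> powr (- 1 / 2)"
        by (intro mult_right_mono d) auto
      also have "\<dots> \<le> k x + k (- x)"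
        using True by (cases "0 \<le> x") (auto simp: k_def indicator_def)
      finally show ?thesis using normal_density_nonneg[of 0 1 x] by linarith
    next
      case False
      have "\<bar>x\<bar> powr (- 1 / 2) \<le> \<bar>x\<bar> powr 0" using False by (intro powr_mono) auto
      also have "\<bar>x\<bar> powr 0 = 1" using False by auto
      finally have "std_normal_density x * \<bar>x\<bar> powr (- 1 / 2) \<le> std_normal_density x * 1"
        using False by (intro mult_left_mono) auto
      moreover have "0 \<le> k x + k (- x)" by (simp add: k_def)
      ultimately show ?thesis by linarith
    qed
    moreover have "0 \<le> k x + k (- x)" for x by (simp add: k_def)
    ultimately show "AE x in lborel. norm (std_normal_density x *\<^sub>R \<bar>x\<bar> powr (- 1 / 2))
        \<le> norm (std_normal_density x + (k x + k (- x)))"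
      by (intro AE_I2) (simp add: abs_mult add_nonneg_nonneg)
  qed simp
  then show ?thesis unfolding stdN_def by (subst integrable_density) auto
qed

text \<open>Esseen's smoothing argument: the indicator of \<open>[-1, 1]\<close> is dominated by a multiple of
  \<open>exp (-y\<^sup>2/2)\<close>, which is the average of \<open>exp (i \<xi> y)\<close> over a standard normal \<open>\<xi>\<close>.\<close>
lemma chi_form_concentration:
  assumes a: "(\<Sum>j<p. (a j)\<^sup>2) = 1" and h: "0 < h"
  shows "measure (PiM {..<p} (\<lambda>_. stdN)) {x \<in> space (PiM {..<p} (\<lambda>_. stdN)). \<bar>chi_form p a x - t\<bar> \<le> h}
    \<le> exp (1 / 2) * (\<integral>\<xi>. \<bar>\<xi>\<bar> powr (- 1 / 2) \<partial>stdN) * sqrt h"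
proof -
  let ?P = "PiM {..<p} (\<lambda>_. stdN)"
  interpret P: prob_space ?P by (rule prob_space_PiM) (rule prob_space_stdN)
  interpret S: prob_space stdN by (rule prob_space_stdN)
  interpret PS: pair_prob_space ?P stdN ..
  define y where "y x = (chi_form p a x - t) / h" for x
  have [measurable]: "y \<in> borel_measurable ?P" unfolding y_def[abs_def] by measurable
  let ?A = "{x \<in> space ?P. \<bar>chi_form p a x - t\<bar> \<le> h}"
  have eint: "integrable ?P (\<lambda>x. exp (- (y x)\<^sup>2 / 2))"
    by (rule P.integrable_const_bound[of _ 1]) auto
  have "measure ?P ?A = (\<integral>x. indicator ?A x \<partial>?P)" by simp
  also have "\<dots> \<le> (\<integral>x. exp (1 / 2) * exp (- (y x)\<^sup>2 / 2) \<partial>?P)"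
  proof (rule integral_mono)
    show "integrable ?P (indicator ?A :: _ \<Rightarrow> real)"
      by (rule P.integrable_const_bound[of _ 1]) (auto simp: indicator_def)
    show "indicator ?A x \<le> exp (1 / 2) * exp (- (y x)\<^sup>2 / 2)" for x
    proof (cases "x \<in> ?A")
      case True
      then have "\<bar>y x\<bar> \<le> 1" using h by (simp add: y_def abs_divide)
      then have "(y x)\<^sup>2 \<le> 1" by (simp add: abs_square_le_1)
      then have "0 \<le> 1 / 2 + - (y x)\<^sup>2 / 2" by simp
      then have "1 \<le> exp (1 / 2 + - (y x)\<^sup>2 / 2)" by simp
      then show ?thesis using True by (simp only: exp_add) simp
    qed simp
  qed (use eint in auto)
  also have "\<dots> = exp (1 / 2) * (\<integral>x. exp (- (y x)\<^sup>2 / 2) \<partial>?P)" by simp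
  also have "(\<integral>x. exp (- (y x)\<^sup>2 / 2) \<partial>?P) \<le> (\<integral>\<xi>. sqrt h * \<bar>\<xi>\<bar> powr (- 1 / 2) \<partial>stdN)"
  proof -
    have ch: "complex_of_real (exp (- (r)\<^sup>2 / 2)) = (\<integral>\<xi>. iexp (r * \<xi>) \<partial>stdN)" for r
      using fun_cong[OF char_std_normal_distribution, of r] by (simp add: char_def stdN_def)
    have "complex_of_real (\<integral>x. exp (- (y x)\<^sup>2 / 2) \<partial>?P) = (\<integral>x. (\<integral>\<xi>. iexp (y x * \<xi>) \<partial>stdN) \<partial>?P)"
      unfolding ch[symmetric] by simp
    also have "\<dots> = (\<integral>\<xi>. (\<integral>x. iexp (y x * \<xi>) \<partial>?P) \<partial>stdN)"
    proof (rule PS.Fubini_integral[symmetric])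
      show "integrable (?P \<Otimes>\<^sub>M stdN) (\<lambda>(x, \<xi>). iexp (y x * \<xi>))"
        by (rule PS.P.integrable_const_bound[of _ 1]) auto
    qed
    finally have "\<bar>\<integral>x. exp (- (y x)\<^sup>2 / 2) \<partial>?P\<bar> = cmod (\<integral>\<xi>. (\<integral>x. iexp (y x * \<xi>) \<partial>?P) \<partial>stdN)"
      by (metis norm_of_real)
    also have "\<dots> \<le> (\<integral>\<xi>. cmod (\<integral>x. iexp (y x * \<xi>) \<partial>?P) \<partial>stdN)"
      by (rule integral_norm_bound)
    also have "\<dots> \<le> (\<integral>\<xi>. sqrt h * \<bar>\<xi>\<bar> powr (- 1 / 2) \<partial>stdN)"
    proof (rule integral_mono_AE)
      show "integrable stdN (\<lambda>\<xi>. cmod (\<integral>x. iexp (y x * \<xi>) \<partial>?P))"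
      proof (rule integrable_norm, rule S.integrable_const_bound[of _ 1])
        show "(\<lambda>\<xi>. \<integral>x. iexp (y x * \<xi>) \<partial>?P) \<in> borel_measurable stdN"
          by (rule P.borel_measurable_lebesgue_integral) measurable
        have "cmod (\<integral>x. iexp (y x * \<xi>) \<partial>?P) \<le> (\<integral>x. cmod (iexp (y x * \<xi>)) \<partial>?P)" for \<xi>
          by (rule integral_norm_bound)
        then show "AE \<xi> in stdN. cmod (\<integral>x. iexp (y x * \<xi>) \<partial>?P) \<le> 1"
          by (simp add: P.prob_space)
      qed
      show "integrable stdN (\<lambda>\<xi>. sqrt h * \<bar>\<xi>\<bar> powr (- 1 / 2))"
        using integrable_stdN_powr_neg_half by simp
      \<comment> \<open>The pointwise bound fails at 0: there the left side is 1, while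
        \<open>0 powr (- 1 / 2)\<close> is 0.\<close>
      have "AE \<xi> in stdN. \<xi> \<noteq> 0"
        unfolding stdN_def by (subst AE_density) (auto intro: AE_mp[OF AE_lborel_singleton])
      then show "AE \<xi> in stdN. cmod (\<integral>x. iexp (y x * \<xi>) \<partial>?P) \<le> sqrt h * \<bar>\<xi>\<bar> powr (- 1 / 2)"
      proof (rule AE_mp, intro AE_I2 impI)
        fix \<xi> :: real assume \<xi>: "\<xi> \<noteq> 0"
        have "(\<integral>x. iexp (y x * \<xi>) \<partial>?P) = (\<integral>x. iexp (- (t * \<xi> / h)) * iexp ((\<xi> / h) * chi_form p a x) \<partial>?P)"
        proof (intro Bochner_Integration.integral_cong refl)
          fix x
          have "y x * \<xi> = - (t * \<xi> / h) + (\<xi> / h) * chi_form p a x"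
            using h by (simp add: y_def field_simps)
          then show "iexp (y x * \<xi>) = iexp (- (t * \<xi> / h)) * iexp ((\<xi> / h) * chi_form p a x)"
            by (simp only: of_real_add distrib_left exp_add)
        qed
        also have "cmod \<dots> = cmod (\<integral>x. iexp ((\<xi> / h) * chi_form p a x) \<partial>?P)"
          by (simp only: integral_mult_right_zero norm_mult norm_exp_i_times mult_1)
        also have "\<dots> \<le> \<bar>2 * (\<xi> / h)\<bar> powr (- 1 / 2)"
          using \<xi> h by (intro norm_char_chi_form[OF a]) auto
        also have "\<dots> \<le> \<bar>\<xi> / h\<bar> powr (- 1 / 2)"
          using \<xi> h by (intro powr_mono2') (auto simp: abs_mult intro!: divide_right_mono)
        also have "\<dots> = sqrt h * \<bar>\<xi>\<bar> powr (- 1 / 2)"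
          using h by (simp add: abs_divide powr_divide powr_minus powr_half_sqrt field_simps)
        finally show "cmod (\<integral>x. iexp (y x * \<xi>) \<partial>?P) \<le> sqrt h * \<bar>\<xi>\<bar> powr (- 1 / 2)" .
      qed
    qed
    finally show ?thesis by simp
  qed
  finally show ?thesis by (simp add: mult_ac)
qed

section \<open>Spectral theorem for real symmetric matrices\<close>

no_notation inner (infix "\<bullet>" 70)
no_notation vec_nth (infixl "$" 90)

text \<open>A Householder reflection moves the first coordinate vector to a given unit vector.\<close>
lemma householder:
  fixes v :: "real vec"
  assumes v: "v \<in> carrier_vec n" and n: "0 < n" and u: "v \<bullet> v = 1"
  shows "\<exists>W \<in> carrier_mat n n. transpose_mat W = W \<and> W * W = 1\<^sub>m n \<and> W *\<^sub>v unit_vec n 0 = v"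
proof (cases "v = unit_vec n 0")
  case True
  then show ?thesis by (intro bexI[of _ "1\<^sub>m n"]) auto
next
  case False
  \<comment> \<open>The reflection is I - 2 w w^T / |w|^2 with w = v - e_0.\<close>
  define w where "w i = v $ i - (if i = 0 then 1 else 0)" for i
  define s where "s = (\<Sum>k<n. (w k)\<^sup>2)"
  have vv: "(\<Sum>k<n. (v $ k)\<^sup>2) = 1"
    using u v by (simp add: scalar_prod_def lessThan_atLeast0 power2_eq_square)
  have "s = (\<Sum>k<n. (v $ k)\<^sup>2 + (if k = 0 then 1 - 2 * v $ 0 else 0))"
    unfolding s_def w_def by (intro sum.cong) (auto simp: power2_eq_square algebra_simps)
  also have "\<dots> = 2 - 2 * v $ 0" using n by (simp add: sum.distrib vv)
  \<comment> \<open>This uses |v| = 1 and is what makes the reflection send e_0 to e_0 + w =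
    v.\<close>
  finally have s: "s = - 2 * w 0" by (simp add: w_def)
  have "\<exists>i<n. w i \<noteq> 0"
  proof (rule ccontr)
    assume "\<not> (\<exists>i<n. w i \<noteq> 0)"
    then have "v = unit_vec n 0"
      by (intro eq_vecI) (use v in \<open>auto simp: w_def\<close>)
    then show False using False by simp
  qed
  then obtain i where i: "i < n" "w i \<noteq> 0" by blast
  then have s0: "s > 0" unfolding s_def
    by (intro sum_pos2[of _ i]) auto
  define W where "W = mat n n (\<lambda>(i,j). (if i = j then 1 else 0) - 2 * w i * w j / s)"
  have W: "W \<in> carrier_mat n n" by (simp add: W_def)
  have "transpose_mat W = W" by (rule eq_matI) (auto simp: W_def)
  moreover have "W * W = 1\<^sub>m n"
  proof (rule eq_matI)
    fix i j assume ij: "i < dim_row (1\<^sub>m n)" "j < dim_col (1\<^sub>m n :: real mat)"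
    then have ij: "i < n" "j < n" by auto
    define c where "c = 4 * w i * w j / s\<^sup>2"
    have "(W * W) $$ (i, j) = (\<Sum>k<n. W $$ (i, k) * W $$ (k, j))"
      using ij W by (simp add: scalar_prod_def lessThan_atLeast0)
    also have "\<dots> = (\<Sum>k<n. (if i = k then (if k = j then 1 else 0) else 0)
        - (if i = k then 2 * w k * w j / s else 0) - (if k = j then 2 * w i * w k / s else 0)
        + c * (w k)\<^sup>2)"
      using ij by (intro sum.cong) (auto simp: W_def c_def power2_eq_square algebra_simps)
    also have "\<dots> = (if i = j then 1 else 0) - 2 * w i * w j / s - 2 * w i * w j / s + c * s"
      using ij by (simp add: sum.distrib sum_subtractf sum_distrib_left[symmetric] s_def[symmetric])
    also have "\<dots> = (if i = j then 1 else 0)"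
      using s0 by (simp add: c_def power2_eq_square)
    finally show "(W * W) $$ (i, j) = 1\<^sub>m n $$ (i, j)" using ij by simp
  qed (use W in auto)
  moreover have "W *\<^sub>v unit_vec n 0 = v"
  proof (rule eq_vecI)
    fix i assume i: "i < dim_vec v"
    then have i: "i < n" using v by simp
    have "(W *\<^sub>v unit_vec n 0) $ i = W $$ (i, 0)"
      using W i n by simp
    also have "\<dots> = v $ i"
    proof -
      have "2 * w i * w 0 / s = - w i" using s s0 by (simp add: field_simps)
      then show ?thesis using i n by (simp add: W_def w_def)
    qed
    finally show "(W *\<^sub>v unit_vec n 0) $ i = v $ i" .
  qed (use v W in auto)
  ultimately show ?thesis using W by blast
qed

text \<open>Deflation: an eigenvector for \<open>l 0\<close>, moved to e_0 by a reflection, splits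
  off a one-by-one block, because symmetry clears the first row along with the first column.
  Cancelling its linear factor leaves the characteristic polynomial of the remaining block. Assuming
  the factorisation into real roots supplies real eigenvalues and fixes their order on the
  diagonal.\<close>

lemma symmetric_spectral:
  fixes A :: "real mat"
  assumes "A \<in> carrier_mat n n" "transpose_mat A = A" "char_poly A = (\<Prod>j<n. [:- l j, 1:])"
  shows "\<exists>U \<in> carrier_mat n n. transpose_mat U * U = 1\<^sub>m n \<and>
    transpose_mat U * A * U = mat n n (\<lambda>(i,j). if i = j then l i else 0)"
  using assms
proof (induction n arbitrary: A l)
  case 0
  then show ?case by (intro bexI[of _ "1\<^sub>m 0"]) auto
next
  case (Suc m A l)
  let ?n = "Suc m"
  note A = Suc.prems(1) and sym = Suc.prems(2) and cp = Suc.prems(3)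
  have "poly (char_poly A) (l 0) = 0"
    unfolding cp poly_prod by (rule prod_zero) (auto intro!: bexI[of _ 0])
  then have "eigenvalue A (l 0)" using eigenvalue_root_char_poly[OF A] by simp
  then obtain v0 where v0: "v0 \<in> carrier_vec ?n" "v0 \<noteq> 0\<^sub>v ?n" "A *\<^sub>v v0 = l 0 \<cdot>\<^sub>v v0"
    using A unfolding eigenvalue_def eigenvector_def by auto
  have pos: "0 < v0 \<bullet> v0"
  proof -
    have "0 \<le> v0 \<bullet> v0" by (simp add: scalar_prod_def sum_nonneg)
    moreover have "v0 \<bullet> v0 \<noteq> 0"
    proof
      assume "v0 \<bullet> v0 = 0"
      then have "(\<Sum>k\<in>{0..<?n}. v0 $ k * v0 $ k) = 0" using v0(1) by (simp add: scalar_prod_def)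
      then have "\<forall>k\<in>{0..<?n}. v0 $ k * v0 $ k = 0"
        by (subst (asm) sum_nonneg_eq_0_iff) auto
      then have "v0 = 0\<^sub>v ?n" using v0(1) by (intro eq_vecI) auto
      then show False using v0(2) by simp
    qed
    ultimately show ?thesis by simp
  qed
  define v where "v = (1 / sqrt (v0 \<bullet> v0)) \<cdot>\<^sub>v v0"
  have v: "v \<in> carrier_vec ?n" using v0 by (simp add: v_def)
  have vv: "v \<bullet> v = 1" unfolding v_def using v0(1) pos
    by (simp add: smult_scalar_prod_distrib[of _ ?n] scalar_prod_smult_distrib[of _ ?n])
  have Av: "A *\<^sub>v v = l 0 \<cdot>\<^sub>v v"
    unfolding v_def using A v0 by (simp add: mult_mat_vec smult_smult_assoc mult.commute)
  obtain W where W: "W \<in> carrier_mat ?n ?n" "transpose_mat W = W" "W * W = 1\<^sub>m ?n" "W *\<^sub>v unit_vec ?n 0 = v"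
    using householder[OF v _ vv] by auto
  define B where "B = W * A * W"
  have B: "B \<in> carrier_mat ?n ?n" using A W by (simp add: B_def)
  have Bsym: "transpose_mat B = B"
    unfolding B_def using A W sym
    by (simp add: transpose_mult[of _ ?n ?n _ ?n] assoc_mult_mat[of _ ?n ?n _ ?n _ ?n])
  have Be: "B *\<^sub>v unit_vec ?n 0 = l 0 \<cdot>\<^sub>v unit_vec ?n 0"
  proof -
    have "B *\<^sub>v unit_vec ?n 0 = W *\<^sub>v (A *\<^sub>v (W *\<^sub>v unit_vec ?n 0))"
      unfolding B_def using A W by (simp add: assoc_mult_mat_vec[of _ ?n ?n _ ?n])
    also have "\<dots> = l 0 \<cdot>\<^sub>v (W *\<^sub>v v)" unfolding W(4) Av using W v by (simp add: mult_mat_vec)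
    also have "W *\<^sub>v v = unit_vec ?n 0"
      using W by (metis assoc_mult_mat_vec one_mult_mat_vec unit_vec_carrier)
    finally show ?thesis .
  qed
  have B0: "B $$ (i, 0) = (if i = 0 then l 0 else 0)" if "i < ?n" for i
    using arg_cong[OF Be, of "\<lambda>x. x $ i"] that B by simp
  have B0': "B $$ (0, i) = (if i = 0 then l 0 else 0)" if "i < ?n" for i
  proof -
    have "B $$ (0, i) = transpose_mat B $$ (i, 0)" using that B by simp
    then show ?thesis using B0[OF that] unfolding Bsym by simp
  qed
  define D where "D = mat m m (\<lambda>(i,j). B $$ (Suc i, Suc j))"
  define L where "L = mat 1 1 (\<lambda>_. l 0)"
  have D: "D \<in> carrier_mat m m" and L: "L \<in> carrier_mat 1 1" by (simp_all add: D_def L_def)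
  have Bb: "B = four_block_mat L (0\<^sub>m 1 m) (0\<^sub>m m 1) D"
    by (rule eq_matI) (use B B0 B0' in \<open>auto simp: L_def D_def\<close>)
  have Dsym: "transpose_mat D = D"
  proof (rule eq_matI)
    fix i j assume "i < dim_row D" "j < dim_col D"
    then show "transpose_mat D $$ (i, j) = D $$ (i, j)"
      using arg_cong[OF Bsym, of "\<lambda>x. x $$ (Suc i, Suc j)"] B by (simp add: D_def)
  qed (use D in auto)
  \<comment> \<open>\<open>W\<close> is its own inverse, so conjugation by it is a similarity as
    well as an orthogonal change of basis.\<close>
  have "similar_mat A B"
    unfolding similar_mat_def similar_mat_wit_def B_def using A W
    by (intro exI[of _ W]) (simp add: Let_def assoc_mult_mat[of _ ?n ?n _ ?n _ ?n] assoc_mult_mat[of W ?n ?n W ?n _ ?n, symmetric])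
  then have "char_poly A = char_poly B" by (rule char_poly_similar)
  also have "\<dots> = [:- l 0, 1:] * char_poly D"
  proof -
    have "char_poly L = (\<Prod>a\<leftarrow>diag_mat L. [:- a, 1:])"
      by (rule char_poly_upper_triangular[OF L]) (auto simp: L_def)
    then have "char_poly L = [:- l 0, 1:]" by (simp add: diag_mat_def L_def)
    then show ?thesis
      unfolding Bb using char_poly_four_block_zeros_col[OF L zero_carrier_mat D] by simp
  qed
  finally have "[:- l 0, 1:] * char_poly D = [:- l 0, 1:] * (\<Prod>j<m. [:- l (Suc j), 1:])"
    unfolding cp prod.lessThan_Suc_shift by (simp only:)
  then have cpD: "char_poly D = (\<Prod>j<m. [:- l (Suc j), 1:])"
    by (subst (asm) mult_cancel_left) auto
  obtain U where U: "U \<in> carrier_mat m m" "transpose_mat U * U = 1\<^sub>m m"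
    "transpose_mat U * D * U = mat m m (\<lambda>(i,j). if i = j then l (Suc i) else 0)"
    using Suc.IH[OF D Dsym cpD] by auto
  define V where "V = four_block_mat (1\<^sub>m 1) (0\<^sub>m 1 m) (0\<^sub>m m 1) U"
  have V: "V \<in> carrier_mat ?n ?n" using U(1) unfolding V_def
    using four_block_carrier_mat[OF one_carrier_mat[of 1] U(1)] by simp
  have VT: "transpose_mat V = four_block_mat (1\<^sub>m 1) (0\<^sub>m 1 m) (0\<^sub>m m 1) (transpose_mat U)"
    unfolding V_def using U(1) by (subst transpose_four_block_mat[of _ 1 1 _ m _ m]) auto
  have VV: "transpose_mat V * V = 1\<^sub>m ?n"
    unfolding VT unfolding V_def using U(1,2)
    by (subst mult_four_block_mat[of _ 1 1 _ m _ m _ _ 1 _ m]) auto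
  have VBV: "transpose_mat V * B * V = mat ?n ?n (\<lambda>(i,j). if i = j then l i else 0)"
  proof -
    have "transpose_mat V * B = four_block_mat L (0\<^sub>m 1 m) (0\<^sub>m m 1) (transpose_mat U * D)"
      unfolding VT unfolding Bb using U(1) D L
      by (subst mult_four_block_mat[of _ 1 1 _ m _ m _ _ 1 _ m]) auto
    also have "\<dots> * V = four_block_mat L (0\<^sub>m 1 m) (0\<^sub>m m 1) (transpose_mat U * D * U)"
      unfolding V_def using U(1) D L
      by (subst mult_four_block_mat[of _ 1 1 _ m _ m _ _ 1 _ m]) auto
    also have "\<dots> = mat ?n ?n (\<lambda>(i,j). if i = j then l i else 0)"
      unfolding U(3) by (rule eq_matI) (auto simp: L_def)
    finally show ?thesis .
  qed
  show ?case
  proof (intro bexI[of _ "W * V"] conjI)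
    show "W * V \<in> carrier_mat ?n ?n" using W V by simp
    have T: "transpose_mat (W * V) = transpose_mat V * W"
      using W V by (simp add: transpose_mult[of _ ?n ?n _ ?n])
    have "transpose_mat (W * V) * (W * V) = transpose_mat V * ((W * W) * V)"
      unfolding T using W(1) V by (simp add: assoc_mult_mat[of _ ?n ?n _ ?n _ ?n])
    also have "\<dots> = 1\<^sub>m ?n" unfolding W(3) using V VV by simp
    finally show "transpose_mat (W * V) * (W * V) = 1\<^sub>m ?n" .
    have "transpose_mat (W * V) * A * (W * V) = transpose_mat V * B * V"
      unfolding T B_def using W(1) V A by (simp add: assoc_mult_mat[of _ ?n ?n _ ?n _ ?n])
    then show "transpose_mat (W * V) * A * (W * V) = mat ?n ?n (\<lambda>(i,j). if i = j then l i else 0)"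
      using VBV by simp
  qed
qed

text \<open>Entrywise form, suited to vectors that are functions: \<open>u\<close> has orthonormal
  columns and A = U diag(l) U^T. The latter needs U U^T = 1, which follows from U^T U = 1 for square
  matrices.\<close>

lemma symmetric_spectral_sums:
  fixes A :: "real mat"
  assumes A: "A \<in> carrier_mat n n" and "transpose_mat A = A" "char_poly A = (\<Prod>j<n. [:- l j, 1:])"
  obtains u where "\<And>i j. i < n \<Longrightarrow> j < n \<Longrightarrow> (\<Sum>k<n. u k i * u k j) = (if i = j then 1 else 0)"
    "\<And>i j. i < n \<Longrightarrow> j < n \<Longrightarrow> (\<Sum>k<n. u i k * l k * u j k) = A $$ (i, j)"
proof -
  obtain U where U: "U \<in> carrier_mat n n" "transpose_mat U * U = 1\<^sub>m n"
    "transpose_mat U * A * U = mat n n (\<lambda>(i,j). if i = j then l i else 0)"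
    using symmetric_spectral[OF assms] by auto
  let ?L = "mat n n (\<lambda>(i,j). if i = j then l i else 0)"
  have UU: "U * transpose_mat U = 1\<^sub>m n"
    using mat_mult_left_right_inverse[OF _ U(1) U(2)] U(1) by simp
  have "U * ?L * transpose_mat U = (U * transpose_mat U) * A * (U * transpose_mat U)"
    unfolding U(3)[symmetric] using U(1) A by (simp add: assoc_mult_mat[of _ n n _ n _ n])
  then have ULU: "U * ?L * transpose_mat U = A" unfolding UU using A by simp
  show ?thesis
  proof (rule that[of "\<lambda>i k. U $$ (i, k)"])
    fix i j assume ij: "i < n" "j < n"
    show "(\<Sum>k<n. U $$ (k, i) * U $$ (k, j)) = (if i = j then 1 else 0)"
      using arg_cong[OF U(2), of "\<lambda>x. x $$ (i, j)"] ij U(1)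
      by (simp add: scalar_prod_def lessThan_atLeast0)
    have "A $$ (i, j) = (U * ?L * transpose_mat U) $$ (i, j)" by (simp only: ULU)
    also have "\<dots> = (\<Sum>k<n. (U * ?L) $$ (i, k) * U $$ (j, k))"
      using ij U(1) by (simp add: scalar_prod_def lessThan_atLeast0 del: index_mult_mat)
        (simp add: scalar_prod_def)
    also have "\<dots> = (\<Sum>k<n. U $$ (i, k) * l k * U $$ (j, k))"
    proof (intro sum.cong refl)
      fix k assume k: "k \<in> {..<n}"
      have "(U * ?L) $$ (i, k) = (\<Sum>r<n. U $$ (i, r) * (if r = k then l r else 0))"
        using ij k U(1) by (simp add: scalar_prod_def lessThan_atLeast0)
      also have "\<dots> = (\<Sum>r<n. if r = k then U $$ (i, r) * l r else 0)"
        by (intro sum.cong) auto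
      also have "\<dots> = U $$ (i, k) * l k" using k by simp
      finally show "(U * ?L) $$ (i, k) * U $$ (j, k) = U $$ (i, k) * l k * U $$ (j, k)" by simp
    qed
    finally show "(\<Sum>k<n. U $$ (i, k) * l k * U $$ (j, k)) = A $$ (i, j)" by simp
  qed
qed

section \<open>Lindeberg replacement\<close>

lemma powr_le_one_plus:
  fixes y a b :: real
  assumes "0 \<le> y" "0 \<le> a" "a \<le> b"
  shows "y powr a \<le> 1 + y powr b"
proof (cases "y \<le> 1")
  case True
  then have "y powr a \<le> 1 powr a" using assms by (intro powr_mono2) auto
  then show ?thesis by (simp add: add_increasing2)
next
  case False
  then have "y powr a \<le> y powr b" using assms by (intro powr_mono) auto
  then show ?thesis by simp
qed

lemma sqnorm_nonneg: "0 \<le> sqnorm p x"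
  by (simp add: sqnorm_def sum_nonneg)

lemma dotp_commute: "dotp p x y = dotp p y x"
  by (simp add: dotp_def mult.commute)

text \<open>By Cauchy-Schwarz, linear forms inherit the moments of the norm.\<close>

lemma dotp_powr_le:
  assumes "0 \<le> q"
  shows "\<bar>dotp p w x\<bar> powr q \<le> sqnorm p w powr (q / 2) * sqnorm p x powr (q / 2)"
proof -
  have "(dotp p w x)\<^sup>2 \<le> sqnorm p w * sqnorm p x"
    unfolding dotp_def sqnorm_def by (rule Cauchy_Schwarz_ineq_sum)
  then have "((dotp p w x)\<^sup>2) powr (q / 2) \<le> (sqnorm p w * sqnorm p x) powr (q / 2)"
    using assms by (intro powr_mono2) auto
  moreover have "((dotp p w x)\<^sup>2) powr (q / 2) = \<bar>dotp p w x\<bar> powr q"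
  proof (cases "dotp p w x = 0")
    case False
    have "(dotp p w x)\<^sup>2 = \<bar>dotp p w x\<bar> powr 2" using False by simp
    then show ?thesis by (simp only: powr_powr) simp
  qed simp
  ultimately show ?thesis by (simp add: powr_mult sqnorm_nonneg)
qed

definition qform :: "nat \<Rightarrow> (nat \<Rightarrow> nat \<Rightarrow> real) \<Rightarrow> (nat \<Rightarrow> real) \<Rightarrow> real" where
  "qform p S x = (\<Sum>i<p. \<Sum>j<p. x i * S i j * x j)"

text \<open>Both the law of X and its Gaussian substitute are instances, so the second-order
  expansion is proved once. The moment condition concerns |X|^2 and is thus of order 4 + 2\<delta>
  in X.\<close>

locale cov_law = prob_space M for M :: "(nat \<Rightarrow> real) measure" +
  fixes p :: nat and S :: "nat \<Rightarrow> nat \<Rightarrow> real" and \<delta> :: real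
  assumes \<delta>: "0 < \<delta>" "\<delta> \<le> 1"
    and sets_law: "sets M = sets (vecM p)"
    and mean: "\<And>j. j < p \<Longrightarrow> (\<integral>x. x j \<partial>M) = 0"
    and cov: "\<And>i j. i < p \<Longrightarrow> j < p \<Longrightarrow> (\<integral>x. x i * x j \<partial>M) = S i j"
    and moment: "integrable M (\<lambda>x. sqnorm p x powr (2 + \<delta>))"
begin

lemma measurable_coord [measurable]: "j < p \<Longrightarrow> (\<lambda>x. x j) \<in> borel_measurable M"
  by (subst measurable_cong_sets[OF sets_law refl]) (simp add: vecM_def)

lemma measurable_sqnorm [measurable]: "sqnorm p \<in> borel_measurable M"
  unfolding sqnorm_def[abs_def] by measurable

lemma measurable_dotp [measurable]: "dotp p w \<in> borel_measurable M"
  unfolding dotp_def[abs_def] by measurable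

lemma integrable_sqnorm_powr:
  assumes "0 \<le> a" "a \<le> 2 + \<delta>"
  shows "integrable M (\<lambda>x. sqnorm p x powr a)"
proof (rule Bochner_Integration.integrable_bound)
  show "integrable M (\<lambda>x. 1 + sqnorm p x powr (2 + \<delta>))" using moment by simp
  show "AE x in M. norm (sqnorm p x powr a) \<le> norm (1 + sqnorm p x powr (2 + \<delta>))"
    using powr_le_one_plus[OF sqnorm_nonneg assms] by (intro AE_I2) simp
qed simp

lemma integrable_sqnorm: "integrable M (sqnorm p)"
  using integrable_sqnorm_powr[of 1] \<delta> sqnorm_nonneg[of p] by simp

lemma integrable_coord: "j < p \<Longrightarrow> integrable M (\<lambda>x. x j)"
  and integrable_coord2: "i < p \<Longrightarrow> j < p \<Longrightarrow> integrable M (\<lambda>x. x i * x j)"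
proof -
  have s: "(x j)\<^sup>2 \<le> sqnorm p x" if "j < p" for x :: "nat \<Rightarrow> real" and j
    unfolding sqnorm_def using that by (intro member_le_sum) auto
  have d: "integrable M (\<lambda>x. 1 + sqnorm p x)" using integrable_sqnorm by simp
  show "integrable M (\<lambda>x. x j)" if "j < p"
  proof (rule Bochner_Integration.integrable_bound[OF d])
    have "\<bar>x j\<bar> \<le> 1 + sqnorm p x" for x :: "nat \<Rightarrow> real"
    proof -
      have "2 * \<bar>x j\<bar> \<le> 1 + (x j)\<^sup>2"
        using zero_le_power2[of "\<bar>x j\<bar> - 1"] by (simp add: power2_diff)
      then show ?thesis using s[OF that, of x] by linarith
    qed
    then show "AE x in M. norm (x j) \<le> norm (1 + sqnorm p x)"
      using sqnorm_nonneg[of p] by (intro AE_I2) simp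
  qed (use that in simp)
  show "integrable M (\<lambda>x. x i * x j)" if "i < p" "j < p"
  proof (rule Bochner_Integration.integrable_bound[OF d])
    have "\<bar>x i * x j\<bar> \<le> 1 + sqnorm p x" for x :: "nat \<Rightarrow> real"
    proof -
      have "2 * \<bar>x i * x j\<bar> \<le> (x i)\<^sup>2 + (x j)\<^sup>2"
        using zero_le_power2[of "\<bar>x i\<bar> - \<bar>x j\<bar>"] by (simp add: power2_diff abs_mult)
      then show ?thesis using s[OF that(1), of x] s[OF that(2), of x] by linarith
    qed
    then show "AE x in M. norm (x i * x j) \<le> norm (1 + sqnorm p x)"
      using sqnorm_nonneg[of p] by (intro AE_I2) simp
  qed (use that in simp)
qed

lemma integral_sqnorm: "(\<integral>x. sqnorm p x \<partial>M) = (\<Sum>j<p. S j j)"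
  unfolding sqnorm_def power2_eq_square
  by (subst Bochner_Integration.integral_sum) (auto intro: integrable_coord2 simp: cov)

lemma integral_dotp: "(\<integral>x. dotp p w x \<partial>M) = 0"
  unfolding dotp_def
  by (subst Bochner_Integration.integral_sum) (auto intro: integrable_coord simp: mean)

lemma integral_dotp_square: "(\<integral>x. (dotp p w x)\<^sup>2 \<partial>M) = qform p S w"
proof -
  have "(dotp p w x)\<^sup>2 = (\<Sum>i<p. \<Sum>j<p. (w i * w j) * (x i * x j))" for x
    unfolding dotp_def power2_eq_square sum_product by (simp add: mult_ac)
  then have "(\<integral>x. (dotp p w x)\<^sup>2 \<partial>M) = (\<integral>x. (\<Sum>i<p. \<Sum>j<p. (w i * w j) * (x i * x j)) \<partial>M)"
    by simp
  also have "\<dots> = (\<Sum>i<p. \<Sum>j<p. (w i * w j) * S i j)"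
    by (subst Bochner_Integration.integral_sum, (auto intro!: Bochner_Integration.integrable_sum integrable_coord2)[1],
        intro sum.cong refl, subst Bochner_Integration.integral_sum)
      (auto intro!: integrable_coord2 simp: cov)
  finally show ?thesis by (simp add: qform_def mult_ac)
qed

lemma qform_nonneg: "0 \<le> qform p S w"
  unfolding integral_dotp_square[symmetric] by simp

lemma integrable_dotp_powr: "integrable M (\<lambda>x. \<bar>dotp p w x\<bar> powr (2 + \<delta>))"
proof (rule Bochner_Integration.integrable_bound)
  show "integrable M (\<lambda>x. sqnorm p w powr ((2 + \<delta>) / 2) * sqnorm p x powr ((2 + \<delta>) / 2))"
    using integrable_sqnorm_powr[of "(2 + \<delta>) / 2"] \<delta> by simp
  show "AE x in M. norm (\<bar>dotp p w x\<bar> powr (2 + \<delta>))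
      \<le> norm (sqnorm p w powr ((2 + \<delta>) / 2) * sqnorm p x powr ((2 + \<delta>) / 2))"
    using dotp_powr_le[of "2 + \<delta>" p w] \<delta> by (intro AE_I2) simp
qed simp

lemmas dotp_moments = powr_le_moments[OF \<delta> measurable_dotp integrable_dotp_powr]

text \<open>Divided by f, this is the variable behind the K's. It depends on the law through the
  trace of S only, so two laws with the same covariance share it.\<close>

definition dev :: "(nat \<Rightarrow> real) \<Rightarrow> real" where
  "dev x = sqnorm p x - (\<Sum>j<p. S j j)"

lemma measurable_dev [measurable]: "dev \<in> borel_measurable M"
  unfolding dev_def[abs_def] by measurable

lemma integrable_dev_powr: "integrable M (\<lambda>x. \<bar>dev x\<bar> powr (2 + \<delta>))"
proof (rule Bochner_Integration.integrable_bound)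
  let ?t = "\<bar>\<Sum>j<p. S j j\<bar> powr (2 + \<delta>)"
  show "integrable M (\<lambda>x. 8 * (sqnorm p x powr (2 + \<delta>) + ?t))" using moment by simp
  show "AE x in M. norm (\<bar>dev x\<bar> powr (2 + \<delta>)) \<le> norm (8 * (sqnorm p x powr (2 + \<delta>) + ?t))"
  proof (rule AE_I2)
    fix x
    show "norm (\<bar>dev x\<bar> powr (2 + \<delta>)) \<le> norm (8 * (sqnorm p x powr (2 + \<delta>) + ?t))"
      using abs_add_powr_le[of "2 + \<delta>" "sqnorm p x" "- (\<Sum>j<p. S j j)"] \<delta> sqnorm_nonneg[of p x]
      by (simp add: dev_def)
  qed
qed simp

lemmas dev_moments = powr_le_moments[OF \<delta> measurable_dev integrable_dev_powr]

lemma integral_dev: "(\<integral>x. dev x \<partial>M) = 0"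
  unfolding dev_def using integrable_sqnorm by (simp add: integral_sqnorm prob_space)

text \<open>The moment at a frozen \<open>w\<close>. Integrating \<open>w\<close> over the law of an
  independent copy of X gives f^q times the q-th power of D_\<delta>.\<close>

definition mom :: "(nat \<Rightarrow> real) \<Rightarrow> real" where
  "mom w = (\<integral>x. \<bar>dotp p w x\<bar> powr (2 + \<delta>) \<partial>M)"

lemma mom_nonneg: "0 \<le> mom w"
  by (simp add: mom_def)

lemma qform_powr_le_mom: "qform p S w powr ((2 + \<delta>) / 2) \<le> mom w"
  using dotp_moments(5)[of w] by (simp add: integral_dotp_square mom_def)

lemma mom_le: "mom w \<le> sqnorm p w powr ((2 + \<delta>) / 2) * (\<integral>x. sqnorm p x powr ((2 + \<delta>) / 2) \<partial>M)"
proof -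
  have "mom w \<le> (\<integral>x. sqnorm p w powr ((2 + \<delta>) / 2) * sqnorm p x powr ((2 + \<delta>) / 2) \<partial>M)"
    unfolding mom_def using integrable_sqnorm_powr[of "(2 + \<delta>) / 2"] \<delta>
    by (intro integral_mono integrable_dotp_powr dotp_powr_le) auto
  then show ?thesis by simp
qed

text \<open>The linear term vanishes, and the cross term in the square of \<open>2 w\<^sup>T x + dev x\<close>
  is split by \<open>2 a b \<le> \<theta> a\<^sup>2 + b\<^sup>2 / \<theta>\<close>.\<close>
lemma smooth_expansion:
  fixes \<phi> \<phi>' \<phi>'' :: "real \<Rightarrow> real"
  assumes d1: "\<And>x. (\<phi> has_real_derivative \<phi>' x) (at x)"
    and d2: "\<And>x. (\<phi>' has_real_derivative \<phi>'' x) (at x)"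
    and H: "\<And>x y. \<bar>\<phi>'' x - \<phi>'' y\<bar> \<le> H * \<bar>x - y\<bar> powr \<delta>"
    and c: "\<And>x. \<bar>\<phi>'' x\<bar> \<le> c" and b: "\<And>x. \<bar>\<phi> x\<bar> \<le> 1"
    and N: "0 < N" and \<theta>: "0 < \<theta>" and K: "(\<integral>x. (dev x)\<^sup>2 \<partial>M) \<le> K\<^sup>2"
  shows "\<bar>(\<integral>x. \<phi> (A + (2 * dotp p w x + dev x) / N) \<partial>M) - \<phi> A - \<phi>'' A / 2 * (4 * qform p S w / N\<^sup>2)\<bar>
    \<le> c / 2 * ((2 * (\<theta> * qform p S w + K\<^sup>2 / \<theta>) + K\<^sup>2) / N\<^sup>2)
      + 4 * H / N powr (2 + \<delta>) * (8 * mom w + (\<integral>x. \<bar>dev x\<bar> powr (2 + \<delta>) \<partial>M))"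
proof -
  let ?q = "2 + \<delta>"
  define a where "a x = dotp p w x" for x
  define u where "u x = (2 * a x + dev x) / N" for x
  have am[measurable]: "a \<in> borel_measurable M" unfolding a_def[abs_def] by measurable
  have um[measurable]: "u \<in> borel_measurable M" unfolding u_def[abs_def] by measurable
  have contp: "continuous_on UNIV \<phi>"
    using d1 by (intro continuous_at_imp_continuous_on) (auto intro: DERIV_isCont)
  then have pm[measurable]: "\<phi> \<in> borel_measurable borel" by (rule borel_measurable_continuous_onI)
  note ai = dotp_moments[of w, folded a_def]
  have H0: "0 \<le> H" using H[of 1 0] by simp
  have c0: "0 \<le> c" using c[of 0] by simp
  \<comment> \<open>The bound 2^q \<le> 8 enters twice: from splitting the sum and from the factor 2
    in front of the linear form.\<close>
  have uq: "\<bar>u x\<bar> powr ?q \<le> 8 / N powr ?q * (8 * \<bar>a x\<bar> powr ?q + \<bar>dev x\<bar> powr ?q)" for x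
  proof -
    have "\<bar>u x\<bar> powr ?q = \<bar>2 * a x + dev x\<bar> powr ?q / N powr ?q"
      using N by (simp add: u_def abs_divide powr_divide)
    also have "\<dots> \<le> (8 * (\<bar>2 * a x\<bar> powr ?q + \<bar>dev x\<bar> powr ?q)) / N powr ?q"
      by (intro divide_right_mono abs_add_powr_le) (use \<delta> in auto)
    also have "\<dots> \<le> (8 * (8 * \<bar>a x\<bar> powr ?q + \<bar>dev x\<bar> powr ?q)) / N powr ?q"
    proof (intro divide_right_mono mult_left_mono add_right_mono)
      have "2 powr ?q \<le> 2 powr 3" using \<delta> by (intro powr_mono) auto
      then have "2 powr ?q \<le> 8" by simp
      then show "\<bar>2 * a x\<bar> powr ?q \<le> 8 * \<bar>a x\<bar> powr ?q"
        by (simp add: abs_mult powr_mult mult_right_mono)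
    qed auto
    finally show ?thesis by simp
  qed
  have aq: "integrable M (\<lambda>x. \<bar>a x\<bar> powr ?q)"
    unfolding a_def by (rule integrable_dotp_powr)
  have uint: "integrable M (\<lambda>x. \<bar>u x\<bar> powr ?q)"
  proof (rule Bochner_Integration.integrable_bound)
    show "integrable M (\<lambda>x. 8 / N powr ?q * (8 * \<bar>a x\<bar> powr ?q + \<bar>dev x\<bar> powr ?q))"
      using aq integrable_dev_powr by simp
    show "AE x in M. norm (\<bar>u x\<bar> powr ?q) \<le> norm (8 / N powr ?q * (8 * \<bar>a x\<bar> powr ?q + \<bar>dev x\<bar> powr ?q))"
      using uq by (intro AE_I2) (simp add: order_trans[OF _ abs_ge_self])
  qed simp
  have uqi: "(\<integral>x. \<bar>u x\<bar> powr ?q \<partial>M) \<le> 8 / N powr ?q * (8 * mom w + (\<integral>x. \<bar>dev x\<bar> powr ?q \<partial>M))"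
  proof -
    have "(\<integral>x. \<bar>u x\<bar> powr ?q \<partial>M) \<le> (\<integral>x. 8 / N powr ?q * (8 * \<bar>a x\<bar> powr ?q + \<bar>dev x\<bar> powr ?q) \<partial>M)"
      by (intro integral_mono uint uq) (use aq integrable_dev_powr in simp)
    also have "\<dots> = 8 / N powr ?q * (8 * mom w + (\<integral>x. \<bar>dev x\<bar> powr ?q \<partial>M))"
      using aq integrable_dev_powr by (simp add: mom_def a_def)
    finally show ?thesis .
  qed
  note ui = powr_le_moments[OF \<delta> um uint]
  have u1: "(\<integral>x. u x \<partial>M) = 0"
    unfolding u_def using ai(1) dev_moments(1)
    by (simp add: integral_dev a_def integral_dotp)
  have ab: "integrable M (\<lambda>x. a x * dev x)"
  proof (rule Bochner_Integration.integrable_bound)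
    show "integrable M (\<lambda>x. (a x)\<^sup>2 + (dev x)\<^sup>2)" using ai(2) dev_moments(2) by simp
    have "\<bar>y * z\<bar> \<le> y\<^sup>2 + z\<^sup>2" for y z :: real
      using zero_le_power2[of "\<bar>y\<bar> - \<bar>z\<bar>"] mult_nonneg_nonneg[OF abs_ge_zero[of y] abs_ge_zero[of z]]
      unfolding power2_diff power2_abs abs_mult by linarith
    then show "AE x in M. norm (a x * dev x) \<le> norm ((a x)\<^sup>2 + (dev x)\<^sup>2)"
      by (intro AE_I2) simp
  qed simp
  have cross: "\<bar>\<integral>x. a x * dev x \<partial>M\<bar> \<le> (\<theta> * qform p S w + K\<^sup>2 / \<theta>) / 2"
  proof -
    have yz: "\<bar>y * z\<bar> \<le> (\<theta> * y\<^sup>2 + z\<^sup>2 / \<theta>) / 2" for y z :: real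
    proof -
      have "0 \<le> (\<theta> * \<bar>y\<bar> - \<bar>z\<bar>)\<^sup>2 / \<theta>" using \<theta> by simp
      also have "\<dots> = \<theta> * y\<^sup>2 + z\<^sup>2 / \<theta> - 2 * \<bar>y * z\<bar>"
        using \<theta> by (simp add: power2_diff power_mult_distrib abs_mult power2_eq_square[of \<theta>] diff_divide_distrib add_divide_distrib)
      finally show ?thesis by simp
    qed
    have "\<bar>\<integral>x. a x * dev x \<partial>M\<bar> \<le> (\<integral>x. \<bar>a x * dev x\<bar> \<partial>M)" by (rule integral_abs_bound)
    also have "\<dots> \<le> (\<integral>x. (\<theta> * (a x)\<^sup>2 + (dev x)\<^sup>2 / \<theta>) / 2 \<partial>M)"
      using ab ai(2) dev_moments(2) by (intro integral_mono yz) auto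
    also have "\<dots> = (\<theta> * qform p S w + (\<integral>x. (dev x)\<^sup>2 \<partial>M) / \<theta>) / 2"
      using ai(2) dev_moments(2) by (simp add: integral_dotp_square[of w, folded a_def])
    also have "\<dots> \<le> (\<theta> * qform p S w + K\<^sup>2 / \<theta>) / 2"
      using K \<theta> by (intro divide_right_mono add_left_mono) auto
    finally show ?thesis .
  qed
  \<comment> \<open>The first part depends on the law only through S and cancels when two laws are
    compared; the second contains third and fourth moments and can only be estimated.\<close>
  have u2: "(\<integral>x. (u x)\<^sup>2 \<partial>M) = 4 * qform p S w / N\<^sup>2 + (4 * (\<integral>x. a x * dev x \<partial>M) + (\<integral>x. (dev x)\<^sup>2 \<partial>M)) / N\<^sup>2"
  proof -
    have "(u x)\<^sup>2 = (4 * (a x)\<^sup>2 + 4 * (a x * dev x) + (dev x)\<^sup>2) / N\<^sup>2" for x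
      unfolding u_def by (simp add: power_divide power2_sum power_mult_distrib mult_ac)
    then have "(\<integral>x. (u x)\<^sup>2 \<partial>M) = (\<integral>x. (4 * (a x)\<^sup>2 + 4 * (a x * dev x) + (dev x)\<^sup>2) / N\<^sup>2 \<partial>M)"
      by simp
    also have "\<dots> = (4 * qform p S w + 4 * (\<integral>x. a x * dev x \<partial>M) + (\<integral>x. (dev x)\<^sup>2 \<partial>M)) / N\<^sup>2"
      using ai(2) ab dev_moments(2) by (simp add: integral_dotp_square[of w, folded a_def])
    finally show ?thesis by (simp add: add_divide_distrib)
  qed
  have pint: "integrable M (\<lambda>x. \<phi> (A + u x))"
    by (rule integrable_const_bound[of _ 1]) (use b in auto)
  define r where "r x = \<phi> (A + u x) - \<phi> A - \<phi>' A * u x - \<phi>'' A * (u x)\<^sup>2 / 2" for x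
  have rint: "integrable M r" unfolding r_def[abs_def] using pint ui(1,2) by simp
  have ri: "\<bar>\<integral>x. r x \<partial>M\<bar> \<le> H / 2 * (\<integral>x. \<bar>u x\<bar> powr ?q \<partial>M)"
  proof -
    have "\<bar>\<integral>x. r x \<partial>M\<bar> \<le> (\<integral>x. \<bar>r x\<bar> \<partial>M)" by (rule integral_abs_bound)
    also have "\<dots> \<le> (\<integral>x. H / 2 * \<bar>u x\<bar> powr ?q \<partial>M)"
      unfolding r_def using rint[unfolded r_def] uint
      by (intro integral_mono taylor_holder[OF d1 d2 H \<delta>(1)]) auto
    finally show ?thesis by simp
  qed
  have "(\<integral>x. r x \<partial>M) = (\<integral>x. \<phi> (A + u x) \<partial>M) - \<phi> A - \<phi>'' A / 2 * (\<integral>x. (u x)\<^sup>2 \<partial>M)"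
    unfolding r_def using pint ui(1,2) by (simp add: prob_space u1)
  then have "(\<integral>x. \<phi> (A + u x) \<partial>M) - \<phi> A - \<phi>'' A / 2 * (4 * qform p S w / N\<^sup>2)
      = \<phi>'' A / 2 * ((4 * (\<integral>x. a x * dev x \<partial>M) + (\<integral>x. (dev x)\<^sup>2 \<partial>M)) / N\<^sup>2) + (\<integral>x. r x \<partial>M)"
    unfolding u2 by (simp add: algebra_simps)
  also have "\<bar>\<dots>\<bar> \<le> c / 2 * ((2 * (\<theta> * qform p S w + K\<^sup>2 / \<theta>) + K\<^sup>2) / N\<^sup>2) + H / 2 * (\<integral>x. \<bar>u x\<bar> powr ?q \<partial>M)"
  proof (rule order_trans[OF abs_triangle_ineq], rule add_mono)
    have "\<bar>4 * (\<integral>x. a x * dev x \<partial>M) + (\<integral>x. (dev x)\<^sup>2 \<partial>M)\<bar> \<le> 2 * (\<theta> * qform p S w + K\<^sup>2 / \<theta>) + K\<^sup>2"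
    proof -
      have "\<bar>4 * X + Y\<bar> \<le> 2 * Z + Y'" if "\<bar>X\<bar> \<le> Z / 2" "0 \<le> Y" "Y \<le> Y'" for X Y Z Y' :: real
        using that by (auto simp: abs_if split: if_splits)
      from this[OF cross _ K] show ?thesis by simp
    qed
    then show "\<bar>\<phi>'' A / 2 * ((4 * (\<integral>x. a x * dev x \<partial>M) + (\<integral>x. (dev x)\<^sup>2 \<partial>M)) / N\<^sup>2)\<bar>
        \<le> c / 2 * ((2 * (\<theta> * qform p S w + K\<^sup>2 / \<theta>) + K\<^sup>2) / N\<^sup>2)"
      unfolding abs_mult abs_divide using c[of A] c0
      by (intro mult_mono divide_right_mono) (auto intro!: divide_right_mono)
  qed (rule ri)
  also have "H / 2 * (\<integral>x. \<bar>u x\<bar> powr ?q \<partial>M) \<le> H / 2 * (8 / N powr ?q * (8 * mom w + (\<integral>x. \<bar>dev x\<bar> powr ?q \<partial>M)))"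
    using H0 by (intro mult_left_mono uqi) auto
  also have "H / 2 * (8 / N powr ?q * (8 * mom w + (\<integral>x. \<bar>dev x\<bar> powr ?q \<partial>M)))
      = 4 * H / N powr ?q * (8 * mom w + (\<integral>x. \<bar>dev x\<bar> powr ?q \<partial>M))"
  proof -
    have "h / 2 * (8 / P * X) = 4 * h / P * X" for h P X :: real by simp
    then show ?thesis .
  qed
  finally show ?thesis unfolding u_def a_def by simp
qed

end

section \<open>Sums of samples that mix the two laws\<close>

definition vsum :: "nat set \<Rightarrow> (nat \<Rightarrow> nat \<Rightarrow> real) \<Rightarrow> nat \<Rightarrow> real" where
  "vsum J \<omega> j = (\<Sum>i\<in>J. \<omega> i j)"

lemma dotp_vsum: "dotp p (vsum J \<omega>) x = (\<Sum>i\<in>J. dotp p x (\<omega> i))"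
proof -
  have "dotp p (vsum J \<omega>) x = (\<Sum>j<p. \<Sum>i\<in>J. x j * \<omega> i j)"
    unfolding dotp_def vsum_def by (simp add: sum_distrib_left mult.commute)
  also have "\<dots> = (\<Sum>i\<in>J. dotp p x (\<omega> i))"
    unfolding dotp_def by (rule sum.swap)
  finally show ?thesis .
qed

lemma vsum_fun_upd:
  assumes "finite I" "k \<in> I"
  shows "vsum I (fun_upd \<omega> k y) j = vsum (I - {k}) \<omega> j + y j"
proof -
  have "(\<Sum>i\<in>I - {k}. fun_upd \<omega> k y i j) = (\<Sum>i\<in>I - {k}. \<omega> i j)"
    by (intro sum.cong) auto
  then show ?thesis
    unfolding vsum_def using assms by (simp add: sum.remove[of I k])
qed

lemma sqnorm_add: "sqnorm p (\<lambda>j. w j + y j) = sqnorm p w + 2 * dotp p w y + sqnorm p y"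
  unfolding sqnorm_def dotp_def by (simp add: power2_sum sum.distrib sum_distrib_left mult_ac)

text \<open>The laws share mean and covariance, which is all that the cancellation of the first- and
  second-order terms uses.\<close>

locale lindeberg = m: cov_law \<mu> p S \<delta> + v: cov_law \<nu> p S \<delta>
  for \<mu> \<nu> :: "(nat \<Rightarrow> real) measure" and p :: nat and S :: "nat \<Rightarrow> nat \<Rightarrow> real" and \<delta> :: real
begin

lemma measurable_hyb_coord [measurable (raw)]:
  assumes "\<And>i. \<kappa>s i \<in> {\<mu>, \<nu>}" "i \<in> J" "j < p"
  shows "(\<lambda>\<omega>. \<omega> i j) \<in> borel_measurable (PiM J \<kappa>s)"
proof -
  have "(\<lambda>x. x j) \<in> borel_measurable (\<kappa>s i)"
  proof -
    have "\<kappa>s i = \<mu> \<or> \<kappa>s i = \<nu>" using assms(1)[of i] by auto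
    then show ?thesis
      using m.measurable_coord[OF assms(3)] v.measurable_coord[OF assms(3)] by (elim disjE) simp_all
  qed
  then show ?thesis
    using assms(2) by (rule measurable_compose[OF measurable_component_singleton, rotated])
qed

lemma hyb_prob: "(\<And>i. \<kappa>s i \<in> {\<mu>, \<nu>}) \<Longrightarrow> prob_space (\<kappa>s i)"
  using m.prob_space_axioms v.prob_space_axioms by (metis insertE singletonD)

text \<open>With \<open>x\<close> fixed, Rosenthal applies to the real variables x^T X_i. All of
  them have variance x^T S x whichever law is drawn, and each q-th moment is at most the sum of the
  two possible ones.\<close>

lemma hyb_sum:
  assumes J: "finite J" and \<kappa>s: "\<And>i. \<kappa>s i \<in> {\<mu>, \<nu>}"
  shows "integrable (PiM J \<kappa>s) (\<lambda>\<omega>. \<bar>dotp p (vsum J \<omega>) x\<bar> powr (2 + \<delta>))"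
    and "(\<integral>\<omega>. (dotp p (vsum J \<omega>) x)\<^sup>2 \<partial>PiM J \<kappa>s) = card J * qform p S x"
    and "(\<integral>\<omega>. \<bar>dotp p (vsum J \<omega>) x\<bar> powr (2 + \<delta>) \<partial>PiM J \<kappa>s)
      \<le> 3 * ((card J * qform p S x) powr ((2 + \<delta>) / 2) + card J * (m.mom x + v.mom x))"
proof -
  have c: "P (\<kappa>s i)" if "P \<mu>" "P \<nu>" for P i
    using \<kappa>s[of i] that by auto
  note R = rosenthal_PiM[OF m.\<delta> hyb_prob[of \<kappa>s, OF \<kappa>s] J, of "\<lambda>i. dotp p x"]
  have R: "integrable (PiM J \<kappa>s) (\<lambda>\<omega>. \<bar>\<Sum>i\<in>J. dotp p x (\<omega> i)\<bar> powr (2 + \<delta>)) \<and>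
    (\<integral>\<omega>. (\<Sum>i\<in>J. dotp p x (\<omega> i))\<^sup>2 \<partial>PiM J \<kappa>s) = (\<Sum>i\<in>J. \<integral>z. (dotp p x z)\<^sup>2 \<partial>\<kappa>s i) \<and>
    (\<integral>\<omega>. \<bar>\<Sum>i\<in>J. dotp p x (\<omega> i)\<bar> powr (2 + \<delta>) \<partial>PiM J \<kappa>s)
      \<le> 3 * ((\<Sum>i\<in>J. \<integral>z. (dotp p x z)\<^sup>2 \<partial>\<kappa>s i) powr ((2 + \<delta>) / 2) + (\<Sum>i\<in>J. \<integral>z. \<bar>dotp p x z\<bar> powr (2 + \<delta>) \<partial>\<kappa>s i))"
    by (rule R; rule c)
      (rule m.measurable_dotp v.measurable_dotp m.integrable_dotp_powr v.integrable_dotp_powr m.integral_dotp v.integral_dotp)+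
  have s: "(\<integral>z. (dotp p x z)\<^sup>2 \<partial>\<kappa>s i) = qform p S x" for i
    by (rule c) (rule m.integral_dotp_square v.integral_dotp_square)+
  have q: "(\<integral>z. \<bar>dotp p x z\<bar> powr (2 + \<delta>) \<partial>\<kappa>s i) \<le> m.mom x + v.mom x" for i
    by (rule c) (use m.mom_nonneg v.mom_nonneg in \<open>simp_all add: m.mom_def[symmetric] v.mom_def[symmetric]\<close>)
  show "integrable (PiM J \<kappa>s) (\<lambda>\<omega>. \<bar>dotp p (vsum J \<omega>) x\<bar> powr (2 + \<delta>))"
    unfolding dotp_vsum using R by blast
  show "(\<integral>\<omega>. (dotp p (vsum J \<omega>) x)\<^sup>2 \<partial>PiM J \<kappa>s) = card J * qform p S x"
    unfolding dotp_vsum using R by (simp add: s)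
  have "(\<integral>\<omega>. \<bar>dotp p (vsum J \<omega>) x\<bar> powr (2 + \<delta>) \<partial>PiM J \<kappa>s)
      \<le> 3 * ((card J * qform p S x) powr ((2 + \<delta>) / 2) + (\<Sum>i\<in>J. \<integral>z. \<bar>dotp p x z\<bar> powr (2 + \<delta>) \<partial>\<kappa>s i))"
    unfolding dotp_vsum using R by (simp add: s)
  also have "\<dots> \<le> 3 * ((card J * qform p S x) powr ((2 + \<delta>) / 2) + card J * (m.mom x + v.mom x))"
    by (intro mult_left_mono add_left_mono sum_bounded_above q) simp
  finally show "(\<integral>\<omega>. \<bar>dotp p (vsum J \<omega>) x\<bar> powr (2 + \<delta>) \<partial>PiM J \<kappa>s)
      \<le> 3 * ((card J * qform p S x) powr ((2 + \<delta>) / 2) + card J * (m.mom x + v.mom x))" .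
qed

text \<open>The Rosenthal bound for at most N summands, averaged over x drawn from
  \<open>\<kappa>\<close>. When \<open>\<kappa>\<close> and \<open>\<mu>\<close> are the law of X,
  the integrals of the quadratic form and of \<open>m.mom\<close> are the moments of X^T \<Sigma> X
  and X_1^T X_2 that occur in L.\<close>

definition hyb_bound :: "(nat \<Rightarrow> real) measure \<Rightarrow> real \<Rightarrow> real" where
  "hyb_bound \<kappa> N = 3 * (N powr ((2 + \<delta>) / 2) * (\<integral>x. qform p S x powr ((2 + \<delta>) / 2) \<partial>\<kappa>)
     + N * ((\<integral>x. m.mom x \<partial>\<kappa>) + (\<integral>x. v.mom x \<partial>\<kappa>)))"

text \<open>Cauchy-Schwarz bounds both moment functions by multiples of |x|^q; Jensen bounds the
  power of the quadratic form by \<open>m.mom\<close>.\<close>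

lemma integrable_mom:
  assumes "cov_law \<kappa> p S \<delta>"
  shows "integrable \<kappa> (\<lambda>x. qform p S x powr ((2 + \<delta>) / 2))" "integrable \<kappa> m.mom" "integrable \<kappa> v.mom"
proof -
  interpret k: cov_law \<kappa> p S \<delta> by (rule assms)
  interpret km: pair_prob_space \<kappa> \<mu> ..
  interpret kv: pair_prob_space \<kappa> \<nu> ..
  have [measurable]: "(\<lambda>z. fst z j) \<in> borel_measurable (\<kappa> \<Otimes>\<^sub>M L)" if "j < p" for j and L :: "(nat \<Rightarrow> real) measure"
    by (rule measurable_compose[OF measurable_fst k.measurable_coord[OF that]])
  have [measurable]: "(\<lambda>z. snd z j) \<in> borel_measurable (\<kappa> \<Otimes>\<^sub>M \<mu>)" "(\<lambda>z. snd z j) \<in> borel_measurable (\<kappa> \<Otimes>\<^sub>M \<nu>)" if "j < p" for j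
    by (rule measurable_compose[OF measurable_snd m.measurable_coord[OF that]]
        measurable_compose[OF measurable_snd v.measurable_coord[OF that]])+
  have mm: "m.mom \<in> borel_measurable \<kappa>"
    unfolding m.mom_def[abs_def] dotp_def[abs_def]
    by (rule m.borel_measurable_lebesgue_integral) (simp add: case_prod_beta)
  have vm: "v.mom \<in> borel_measurable \<kappa>"
    unfolding v.mom_def[abs_def] dotp_def[abs_def]
    by (rule v.borel_measurable_lebesgue_integral) (simp add: case_prod_beta)
  have qm: "qform p S \<in> borel_measurable \<kappa>"
    unfolding qform_def[abs_def] by measurable
  let ?s = "\<lambda>x. sqnorm p x powr ((2 + \<delta>) / 2)"
  have si: "integrable \<kappa> ?s" using k.integrable_sqnorm_powr[of "(2 + \<delta>) / 2"] m.\<delta> by simp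
  let ?c = "\<lambda>L. \<integral>x. sqnorm p x powr ((2 + \<delta>) / 2) \<partial>L"
  show im: "integrable \<kappa> m.mom"
    by (rule Bochner_Integration.integrable_bound[OF integrable_mult_left[OF si, of "?c \<mu>"] mm])
      (use m.mom_le m.mom_nonneg in \<open>auto intro!: AE_I2 simp: abs_mult\<close>)
  show "integrable \<kappa> v.mom"
    by (rule Bochner_Integration.integrable_bound[OF integrable_mult_left[OF si, of "?c \<nu>"] vm])
      (use v.mom_le v.mom_nonneg in \<open>auto intro!: AE_I2 simp: abs_mult\<close>)
  show "integrable \<kappa> (\<lambda>x. qform p S x powr ((2 + \<delta>) / 2))"
    by (rule Bochner_Integration.integrable_bound[OF im])
      (use qm m.qform_powr_le_mom m.mom_nonneg in \<open>auto intro!: AE_I2\<close>)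
qed

lemma measurable_pair_dotp:
  assumes J: "finite J" and \<kappa>s: "\<And>i. \<kappa>s i \<in> {\<mu>, \<nu>}" and "cov_law \<kappa> p S \<delta>"
  shows "(\<lambda>(x, \<omega>). dotp p (vsum J \<omega>) x) \<in> borel_measurable (\<kappa> \<Otimes>\<^sub>M PiM J \<kappa>s)"
proof -
  interpret k: cov_law \<kappa> p S \<delta> by fact
  have [measurable]: "(\<lambda>z. fst z j) \<in> borel_measurable (\<kappa> \<Otimes>\<^sub>M PiM J \<kappa>s)" if "j < p" for j
    by (rule measurable_compose[OF measurable_fst k.measurable_coord[OF that]])
  have [measurable]: "(\<lambda>z. snd z i j) \<in> borel_measurable (\<kappa> \<Otimes>\<^sub>M PiM J \<kappa>s)" if "i \<in> J" "j < p" for i j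
    by (rule measurable_compose[OF measurable_snd measurable_hyb_coord[of \<kappa>s, OF \<kappa>s that]])
  show ?thesis unfolding dotp_def vsum_def case_prod_beta by measurable
qed

text \<open>The expansion produces E|w^T X|^q with a random hybrid sum w. Fubini exchanges the two
  integrations, so that \<open>hyb_sum\<close> applies at fixed x. The parameter N allows a sum with
  one index removed to be bounded as if it had n terms.\<close>

lemma hyb_mom:
  assumes J: "finite J" and \<kappa>s: "\<And>i. \<kappa>s i \<in> {\<mu>, \<nu>}" and k: "cov_law \<kappa> p S \<delta>"
    and N: "real (card J) \<le> N"
  shows "integrable (PiM J \<kappa>s) (\<lambda>\<omega>. cov_law.mom \<kappa> p \<delta> (vsum J \<omega>))"
    and "(\<integral>\<omega>. cov_law.mom \<kappa> p \<delta> (vsum J \<omega>) \<partial>PiM J \<kappa>s) \<le> hyb_bound \<kappa> N"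
    and "integrable (PiM J \<kappa>s) (\<lambda>\<omega>. qform p S (vsum J \<omega>))"
    and "(\<integral>\<omega>. qform p S (vsum J \<omega>) \<partial>PiM J \<kappa>s) \<le> N * (\<Sum>i<p. \<Sum>j<p. (S i j)\<^sup>2)"
proof -
  interpret k: cov_law \<kappa> p S \<delta> by fact
  interpret \<Omega>: prob_space "PiM J \<kappa>s" by (rule prob_space_PiM) (rule hyb_prob[of \<kappa>s, OF \<kappa>s])
  interpret P: pair_prob_space \<kappa> "PiM J \<kappa>s" ..
  note mp[measurable] = measurable_pair_dotp[of J \<kappa>s, OF J \<kappa>s k]
  define f where "f x \<omega> = dotp p (vsum J \<omega>) x" for x \<omega>
  have fm[measurable]: "case_prod f \<in> borel_measurable (\<kappa> \<Otimes>\<^sub>M PiM J \<kappa>s)"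
    unfolding f_def by measurable
  note h = hyb_sum[of J \<kappa>s, OF J \<kappa>s, folded f_def]
  note im = integrable_mom[OF k]
  let ?R = "\<lambda>x. 3 * (N powr ((2 + \<delta>) / 2) * qform p S x powr ((2 + \<delta>) / 2) + N * (m.mom x + v.mom x))"
  have Ri: "integrable \<kappa> ?R" using im by simp
  have N0: "0 \<le> N" using N by (meson of_nat_0_le_iff order_trans)
  have hR: "(\<integral>\<omega>. \<bar>f x \<omega>\<bar> powr (2 + \<delta>) \<partial>PiM J \<kappa>s) \<le> ?R x" for x
  proof -
    have "(real (card J) * qform p S x) powr ((2 + \<delta>) / 2) \<le> (N * qform p S x) powr ((2 + \<delta>) / 2)"
      using N m.qform_nonneg m.\<delta> by (intro powr_mono2 mult_right_mono) auto
    also have "\<dots> = N powr ((2 + \<delta>) / 2) * qform p S x powr ((2 + \<delta>) / 2)"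
      using N0 m.qform_nonneg by (simp add: powr_mult)
    finally have "(real (card J) * qform p S x) powr ((2 + \<delta>) / 2) \<le> N powr ((2 + \<delta>) / 2) * qform p S x powr ((2 + \<delta>) / 2)" .
    moreover have "real (card J) * (m.mom x + v.mom x) \<le> N * (m.mom x + v.mom x)"
      using N m.mom_nonneg v.mom_nonneg by (intro mult_right_mono) auto
    ultimately show ?thesis
      by (intro order_trans[OF h(3)[where x = x]] mult_left_mono add_mono) simp_all
  qed
  have pint: "integrable (\<kappa> \<Otimes>\<^sub>M PiM J \<kappa>s) (\<lambda>(x, \<omega>). \<bar>f x \<omega>\<bar> powr (2 + \<delta>))"
  proof (rule P.Fubini_integrable)
    show "integrable \<kappa> (\<lambda>x. \<integral>\<omega>. norm (case (x, \<omega>) of (x, \<omega>) \<Rightarrow> \<bar>f x \<omega>\<bar> powr (2 + \<delta>)) \<partial>PiM J \<kappa>s)"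
    proof (rule Bochner_Integration.integrable_bound[OF Ri])
      show "(\<lambda>x. \<integral>\<omega>. norm (case (x, \<omega>) of (x, \<omega>) \<Rightarrow> \<bar>f x \<omega>\<bar> powr (2 + \<delta>)) \<partial>PiM J \<kappa>s) \<in> borel_measurable \<kappa>"
        by (rule \<Omega>.borel_measurable_lebesgue_integral) measurable
      show "AE x in \<kappa>. norm (\<integral>\<omega>. norm (case (x, \<omega>) of (x, \<omega>) \<Rightarrow> \<bar>f x \<omega>\<bar> powr (2 + \<delta>)) \<partial>PiM J \<kappa>s) \<le> norm (?R x)"
        using hR by (intro AE_I2) (simp add: order_trans[OF _ abs_ge_self])
    qed
  qed (use h(1) in simp_all)
  have mom: "(\<integral>x. \<bar>f x \<omega>\<bar> powr (2 + \<delta>) \<partial>\<kappa>) = k.mom (vsum J \<omega>)" for \<omega>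
    by (simp add: f_def k.mom_def)
  show "integrable (PiM J \<kappa>s) (\<lambda>\<omega>. k.mom (vsum J \<omega>))"
    using P.integrable_snd[OF pint] unfolding mom .
  have "(\<integral>\<omega>. k.mom (vsum J \<omega>) \<partial>PiM J \<kappa>s) = (\<integral>x. (\<integral>\<omega>. \<bar>f x \<omega>\<bar> powr (2 + \<delta>) \<partial>PiM J \<kappa>s) \<partial>\<kappa>)"
    using P.Fubini_integral[OF pint] unfolding mom .
  also have "\<dots> \<le> (\<integral>x. ?R x \<partial>\<kappa>)"
    by (rule integral_mono[OF P.integrable_fst[OF pint] Ri hR])
  also have "\<dots> = hyb_bound \<kappa> N" using im by (simp add: hyb_bound_def)
  finally show "(\<integral>\<omega>. k.mom (vsum J \<omega>) \<partial>PiM J \<kappa>s) \<le> hyb_bound \<kappa> N" .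
  have "integrable (\<kappa> \<Otimes>\<^sub>M PiM J \<kappa>s) (\<lambda>z. \<bar>case_prod f z\<bar> powr (2 + \<delta>))"
    using pint unfolding case_prod_beta' .
  from P.P.powr_le_moments(2)[OF m.\<delta> fm this]
  have sq: "integrable (\<kappa> \<Otimes>\<^sub>M PiM J \<kappa>s) (\<lambda>(x, \<omega>). (f x \<omega>)\<^sup>2)"
    unfolding case_prod_beta' .
  have q: "(\<integral>x. (f x \<omega>)\<^sup>2 \<partial>\<kappa>) = qform p S (vsum J \<omega>)" for \<omega>
    unfolding f_def by (rule k.integral_dotp_square)
  show "integrable (PiM J \<kappa>s) (\<lambda>\<omega>. qform p S (vsum J \<omega>))"
    using P.integrable_snd[OF sq] unfolding q .
  have "(\<integral>\<omega>. qform p S (vsum J \<omega>) \<partial>PiM J \<kappa>s) = (\<integral>x. real (card J) * qform p S x \<partial>\<kappa>)"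
    using P.Fubini_integral[OF sq] unfolding q h(2) .
  also have "\<dots> = real (card J) * (\<Sum>i<p. \<Sum>j<p. \<integral>x. S i j * (x i * x j) \<partial>\<kappa>)"
  proof -
    have "(\<integral>x. qform p S x \<partial>\<kappa>) = (\<integral>x. (\<Sum>i<p. \<Sum>j<p. S i j * (x i * x j)) \<partial>\<kappa>)"
      unfolding qform_def by (simp add: mult_ac)
    also have "\<dots> = (\<Sum>i<p. \<Sum>j<p. \<integral>x. S i j * (x i * x j) \<partial>\<kappa>)"
      by (subst Bochner_Integration.integral_sum, (auto intro!: Bochner_Integration.integrable_sum k.integrable_coord2)[1],
          intro sum.cong refl, subst Bochner_Integration.integral_sum)
        (auto intro!: k.integrable_coord2)
    finally show ?thesis by simp
  qed
  also have "\<dots> = real (card J) * (\<Sum>i<p. \<Sum>j<p. (S i j)\<^sup>2)"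
    by (simp add: k.cov power2_eq_square)
  also have "\<dots> \<le> N * (\<Sum>i<p. \<Sum>j<p. (S i j)\<^sup>2)"
    using N by (intro mult_right_mono sum_nonneg) auto
  finally show "(\<integral>\<omega>. qform p S (vsum J \<omega>) \<partial>PiM J \<kappa>s) \<le> N * (\<Sum>i<p. \<Sum>j<p. (S i j)\<^sup>2)" .
qed

end

context lindeberg
begin

definition trS :: real where
  "trS = (\<Sum>j<p. S j j)"

text \<open>Telescopes over n replacements of one coordinate. Both laws are expanded around the same
  point, so the terms determined by S cancel, and the rest is averaged over the other coordinates by
  \<open>hyb_mom\<close>.\<close>

lemma lindeberg_swap:
  fixes \<phi> \<phi>' \<phi>'' :: "real \<Rightarrow> real"
  assumes d1: "\<And>x. (\<phi> has_real_derivative \<phi>' x) (at x)"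
    and d2: "\<And>x. (\<phi>' has_real_derivative \<phi>'' x) (at x)"
    and H: "\<And>x y. \<bar>\<phi>'' x - \<phi>'' y\<bar> \<le> H * \<bar>x - y\<bar> powr \<delta>"
    and c: "\<And>x. \<bar>\<phi>'' x\<bar> \<le> c" and b: "\<And>x. \<bar>\<phi> x\<bar> \<le> 1"
    and \<theta>: "0 < \<theta>" and Km: "(\<integral>x. (m.dev x)\<^sup>2 \<partial>\<mu>) \<le> K\<^sup>2" and Kv: "(\<integral>x. (v.dev x)\<^sup>2 \<partial>\<nu>) \<le> K\<^sup>2"
    and n: "1 \<le> n"
  shows "\<bar>(\<integral>\<omega>. \<phi> (sqnorm p (vsum {..<n} \<omega>) / n) \<partial>PiM {..<n} (\<lambda>_. \<mu>))
       - (\<integral>\<omega>. \<phi> (sqnorm p (vsum {..<n} \<omega>) / n) \<partial>PiM {..<n} (\<lambda>_. \<nu>))\<bar>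
    \<le> n * (c * ((2 * (\<theta> * (n * (\<Sum>i<p. \<Sum>j<p. (S i j)\<^sup>2)) + K\<^sup>2 / \<theta>) + K\<^sup>2) / (real n)\<^sup>2)
      + 4 * H / n powr (2 + \<delta>) * (8 * (hyb_bound \<mu> n + hyb_bound \<nu> n)
        + (\<integral>x. \<bar>m.dev x\<bar> powr (2 + \<delta>) \<partial>\<mu>) + (\<integral>x. \<bar>v.dev x\<bar> powr (2 + \<delta>) \<partial>\<nu>)))"
    (is "_ \<le> real n * ?B")
proof -
  \<comment> \<open>The first \<open>k\<close> coordinates have law \<open>\<mu>\<close> and the
    others \<open>\<nu>\<close>; thus \<open>hyb k\<close> and \<open>hyb (Suc k)\<close> differ at
    index \<open>k\<close> only.\<close>
  define hyb where "hyb k i = (if i < k then \<mu> else \<nu>)" for k i :: nat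
  have hyb: "hyb k i \<in> {\<mu>, \<nu>}" for k i by (simp add: hyb_def)
  define G where "G \<omega> = \<phi> (sqnorm p (vsum {..<n} \<omega>) / n)" for \<omega>
  define E where "E k = (\<integral>\<omega>. G \<omega> \<partial>PiM {..<n} (hyb k))" for k
  have contp: "continuous_on UNIV \<phi>"
    using d1 by (intro continuous_at_imp_continuous_on) (auto intro: DERIV_isCont)
  then have pm[measurable]: "\<phi> \<in> borel_measurable borel" by (rule borel_measurable_continuous_onI)
  have c0: "0 \<le> c" using c[of 0] by simp
  have H0: "0 \<le> H" using H[of 1 0] by simp
  have step: "\<bar>E (Suc k) - E k\<bar> \<le> ?B" if k: "k < n" for k
  proof -
    define J where "J = {..<n} - {k}"
    have J: "finite J" "k \<notin> J" "insert k J = {..<n}" using k by (auto simp: J_def)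
    have cJ: "real (card J) \<le> n" using k by (simp add: J_def)
    let ?\<Omega> = "PiM J (hyb k)"
    interpret \<Omega>: prob_space ?\<Omega> by (rule prob_space_PiM) (rule hyb_prob[of "hyb k", OF hyb])
    define W where "W \<omega> = vsum J \<omega>" for \<omega>
    define A where "A \<omega> = (sqnorm p (W \<omega>) + trS) / n" for \<omega>
    have Gm: "G \<in> borel_measurable (PiM {..<n} (hyb k'))" for k'
    proof -
      have [measurable]: "(\<lambda>\<omega>. \<omega> i j) \<in> borel_measurable (PiM {..<n} (hyb k'))" if "i \<in> {..<n}" "j < p" for i j
        by (rule measurable_hyb_coord[of "hyb k'", OF hyb that])
      show ?thesis unfolding G_def[abs_def] sqnorm_def[abs_def] vsum_def[abs_def] by measurable
    qed
    \<comment> \<open>The trace is moved into \<open>A\<close>, so that the increment caused by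
      \<open>y\<close> is centred under both laws.\<close>
    have Gup: "G (fun_upd \<omega> k y) = \<phi> (A \<omega> + (2 * dotp p (W \<omega>) y + m.dev y) / n)" for \<omega> y
    proof -
      have "vsum {..<n} (fun_upd \<omega> k y) = (\<lambda>j. W \<omega> j + y j)"
        unfolding W_def J_def using k by (intro ext vsum_fun_upd) auto
      then have "sqnorm p (vsum {..<n} (fun_upd \<omega> k y)) / n = A \<omega> + (2 * dotp p (W \<omega>) y + m.dev y) / n"
        by (simp add: sqnorm_add A_def m.dev_def trS_def add_divide_distrib diff_divide_distrib)
      then show ?thesis by (simp add: G_def)
    qed
    define \<Phi> where "\<Phi> \<kappa> \<omega> = (\<integral>y. \<phi> (A \<omega> + (2 * dotp p (W \<omega>) y + m.dev y) / n) \<partial>\<kappa>)" for \<kappa> \<omega>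
    have ins: "(\<integral>\<omega>. G \<omega> \<partial>PiM {..<n} (hyb k')) = (\<integral>\<omega>. \<Phi> (hyb k' k) \<omega> \<partial>?\<Omega>)" if "k' = k \<or> k' = Suc k" for k'
    proof -
      interpret product_sigma_finite "hyb k'"
        using hyb_prob[of "hyb k'", OF hyb] by (intro product_sigma_finite.intro prob_space_imp_sigma_finite)
      interpret L: prob_space "PiM {..<n} (hyb k')" by (rule prob_space_PiM) (rule hyb_prob[of "hyb k'", OF hyb])
      have "integrable (PiM {..<n} (hyb k')) G"
        by (rule L.integrable_const_bound[of _ 1]) (use b Gm in \<open>auto simp: G_def\<close>)
      then have "(\<integral>\<omega>. G \<omega> \<partial>PiM {..<n} (hyb k')) = (\<integral>\<omega>. \<Phi> (hyb k' k) \<omega> \<partial>PiM J (hyb k'))"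
        using product_integral_insert[OF J(1,2), of G] unfolding J(3) Gup \<Phi>_def by simp
      \<comment> \<open>Index \<open>k\<close> is missing from \<open>J\<close>, so the two
        neighbouring hybrids restrict to the same product measure.\<close>
      also have "PiM J (hyb k') = ?\<Omega>"
        using that by (intro PiM_cong refl) (auto simp: hyb_def J_def)
      finally show ?thesis .
    qed
    have E1: "E (Suc k) = (\<integral>\<omega>. \<Phi> \<mu> \<omega> \<partial>?\<Omega>)" and E0: "E k = (\<integral>\<omega>. \<Phi> \<nu> \<omega> \<partial>?\<Omega>)"
      unfolding E_def using ins[of "Suc k"] ins[of k] by (simp_all add: hyb_def)
    have \<Phi>i: "integrable ?\<Omega> (\<Phi> \<kappa>)" if "\<kappa> \<in> {\<mu>, \<nu>}" for \<kappa>
    proof -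
      interpret k: cov_law \<kappa> p S \<delta> using that m.cov_law_axioms v.cov_law_axioms by auto
      interpret P: pair_prob_space ?\<Omega> \<kappa> ..
      show ?thesis
      proof (rule \<Omega>.integrable_const_bound[of _ 1])
        have [measurable]: "(\<lambda>z. snd z j) \<in> borel_measurable (?\<Omega> \<Otimes>\<^sub>M \<kappa>)" if "j < p" for j
          by (rule measurable_compose[OF measurable_snd k.measurable_coord[OF that]])
        have [measurable]: "(\<lambda>z. fst z i j) \<in> borel_measurable (?\<Omega> \<Otimes>\<^sub>M \<kappa>)" if "i \<in> J" "j < p" for i j
          by (rule measurable_compose[OF measurable_fst measurable_hyb_coord[of "hyb k", OF hyb that]])
        show "\<Phi> \<kappa> \<in> borel_measurable ?\<Omega>"
          unfolding \<Phi>_def[abs_def] A_def W_def m.dev_def sqnorm_def dotp_def vsum_def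
          by (rule k.borel_measurable_lebesgue_integral) (simp add: case_prod_beta)
        have "\<bar>\<Phi> \<kappa> \<omega>\<bar> \<le> 1" for \<omega>
        proof -
          have "\<bar>\<Phi> \<kappa> \<omega>\<bar> \<le> (\<integral>y. \<bar>\<phi> (A \<omega> + (2 * dotp p (W \<omega>) y + m.dev y) / n)\<bar> \<partial>\<kappa>)"
            unfolding \<Phi>_def by (rule integral_abs_bound)
          also have "\<dots> \<le> (\<integral>y. 1 \<partial>\<kappa>)"
            by (rule integral_mono') (use b in auto)
          finally show ?thesis by (simp add: k.prob_space)
        qed
        then show "AE \<omega> in ?\<Omega>. norm (\<Phi> \<kappa> \<omega>) \<le> 1" by simp
      qed
    qed
    have n0: "0 < real n" using n by simp
    define bnd where "bnd \<omega> = c * ((2 * (\<theta> * qform p S (W \<omega>) + K\<^sup>2 / \<theta>) + K\<^sup>2) / (real n)\<^sup>2)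
      + 4 * H / n powr (2 + \<delta>) * (8 * (m.mom (W \<omega>) + v.mom (W \<omega>))
        + (\<integral>x. \<bar>m.dev x\<bar> powr (2 + \<delta>) \<partial>\<mu>) + (\<integral>x. \<bar>v.dev x\<bar> powr (2 + \<delta>) \<partial>\<nu>))" for \<omega>
    have pw: "\<bar>\<Phi> \<mu> \<omega> - \<Phi> \<nu> \<omega>\<bar> \<le> bnd \<omega>" for \<omega>
    proof -
      have ab: "\<bar>x - y\<bar> \<le> 2 * d + (e + f)" if "\<bar>x - a - g\<bar> \<le> d + e" "\<bar>y - a - g\<bar> \<le> d + f" for x y a g d e f :: real
        using that by (auto simp: abs_if split: if_splits)
      note se = m.smooth_expansion[OF d1 d2 H c b n0 \<theta> Km] v.smooth_expansion[OF d1 d2 H c b n0 \<theta> Kv]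
      have "\<bar>\<Phi> \<mu> \<omega> - \<Phi> \<nu> \<omega>\<bar> \<le> 2 * (c / 2 * ((2 * (\<theta> * qform p S (W \<omega>) + K\<^sup>2 / \<theta>) + K\<^sup>2) / (real n)\<^sup>2))
        + (4 * H / n powr (2 + \<delta>) * (8 * m.mom (W \<omega>) + (\<integral>x. \<bar>m.dev x\<bar> powr (2 + \<delta>) \<partial>\<mu>))
         + 4 * H / n powr (2 + \<delta>) * (8 * v.mom (W \<omega>) + (\<integral>x. \<bar>v.dev x\<bar> powr (2 + \<delta>) \<partial>\<nu>)))"
        unfolding \<Phi>_def by (rule ab[OF se])
      also have "\<dots> = bnd \<omega>"
      proof -
        have *: "2 * (c / 2 * X) + (Y * (8 * a + a') + Y * (8 * b + b')) = c * X + Y * (8 * (a + b) + a' + b')"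
          for X Y a a' b b' :: real by (simp add: algebra_simps)
        show ?thesis unfolding bnd_def by (rule *)
      qed
      finally show ?thesis .
    qed
    note hm = hyb_mom[of J "hyb k" \<mu> n, OF J(1) hyb m.cov_law_axioms cJ, folded W_def]
    note hv = hyb_mom[of J "hyb k" \<nu> n, OF J(1) hyb v.cov_law_axioms cJ, folded W_def]
    have bi: "integrable ?\<Omega> bnd"
      unfolding bnd_def[abs_def] using hm(1,3) hv(1) by simp
    have "\<bar>E (Suc k) - E k\<bar> = \<bar>\<integral>\<omega>. \<Phi> \<mu> \<omega> - \<Phi> \<nu> \<omega> \<partial>?\<Omega>\<bar>"
      unfolding E1 E0 using \<Phi>i by simp
    also have "\<dots> \<le> (\<integral>\<omega>. \<bar>\<Phi> \<mu> \<omega> - \<Phi> \<nu> \<omega>\<bar> \<partial>?\<Omega>)" by (rule integral_abs_bound)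
    also have "\<dots> \<le> (\<integral>\<omega>. bnd \<omega> \<partial>?\<Omega>)"
      by (intro integral_mono pw bi) (use \<Phi>i in simp)
    also have "\<dots> = c * ((2 * (\<theta> * (\<integral>\<omega>. qform p S (W \<omega>) \<partial>?\<Omega>) + K\<^sup>2 / \<theta>) + K\<^sup>2) / (real n)\<^sup>2)
      + 4 * H / n powr (2 + \<delta>) * (8 * ((\<integral>\<omega>. m.mom (W \<omega>) \<partial>?\<Omega>) + (\<integral>\<omega>. v.mom (W \<omega>) \<partial>?\<Omega>))
        + (\<integral>x. \<bar>m.dev x\<bar> powr (2 + \<delta>) \<partial>\<mu>) + (\<integral>x. \<bar>v.dev x\<bar> powr (2 + \<delta>) \<partial>\<nu>))"
      unfolding bnd_def using hm(1,3) hv(1) by (simp add: \<Omega>.prob_space)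
    also have "\<dots> \<le> ?B"
      by (intro add_mono mult_left_mono divide_right_mono hm(2,4) hv(2) order_refl) (use c0 H0 \<theta> in auto)
    finally show ?thesis .
  qed
  have tel: "\<bar>E k - E 0\<bar> \<le> k * ?B" if "k \<le> n" for k
    using that
  proof (induction k)
    case (Suc k)
    have "\<bar>E (Suc k) - E 0\<bar> \<le> \<bar>E (Suc k) - E k\<bar> + \<bar>E k - E 0\<bar>" by linarith
    also have "\<dots> \<le> ?B + k * ?B" using Suc step[of k] by (intro add_mono) auto
    finally show ?case by (simp only: of_nat_Suc distrib_right mult_1)
  qed simp
  have "E n = (\<integral>\<omega>. G \<omega> \<partial>PiM {..<n} (\<lambda>_. \<mu>))" "E 0 = (\<integral>\<omega>. G \<omega> \<partial>PiM {..<n} (\<lambda>_. \<nu>))"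
    unfolding E_def by (intro arg_cong2[where f = "integral\<^sup>L"] PiM_cong refl; simp add: hyb_def)+
  then show ?thesis using tel[of n] unfolding G_def by simp
qed

end

section \<open>Moments of linear and quadratic forms in standard normals\<close>

text \<open>Stability of the normal law, by characteristic functions. This includes zero
  coefficients; one occurs at the start of the induction on the number of summands.\<close>

lemma distr_stdN_pair:
  assumes "a\<^sup>2 + b\<^sup>2 = c\<^sup>2"
  shows "distr (stdN \<Otimes>\<^sub>M stdN) borel (\<lambda>(x, y). a * x + b * y) = distr stdN borel (\<lambda>x. c * x)"
proof (rule Levy_uniqueness)
  interpret S: prob_space stdN by (rule prob_space_stdN)
  interpret SS: pair_prob_space stdN stdN ..
  show "real_distribution (distr (stdN \<Otimes>\<^sub>M stdN) borel (\<lambda>(x, y). a * x + b * y))"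
    by (rule SS.P.real_distribution_distr) measurable
  show "real_distribution (distr stdN borel (\<lambda>x. c * x))"
    by (rule S.real_distribution_distr) measurable
  have ch: "(\<integral>\<xi>. iexp (r * \<xi>) \<partial>stdN) = complex_of_real (exp (- (r)\<^sup>2 / 2))" for r
    using fun_cong[OF char_std_normal_distribution, of r] by (simp add: char_def stdN_def)
  show "char (distr (stdN \<Otimes>\<^sub>M stdN) borel (\<lambda>(x, y). a * x + b * y)) = char (distr stdN borel (\<lambda>x. c * x))"
  proof
    fix t
    have "char (distr (stdN \<Otimes>\<^sub>M stdN) borel (\<lambda>(x, y). a * x + b * y)) t
        = (\<integral>z. (case z of (x, y) \<Rightarrow> iexp (t * (a * x + b * y))) \<partial>(stdN \<Otimes>\<^sub>M stdN))"
      unfolding char_def by (subst integral_distr) (auto simp: case_prod_beta')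
    also have "\<dots> = (\<integral>x. (\<integral>y. iexp (t * (a * x + b * y)) \<partial>stdN) \<partial>stdN)"
      by (rule SS.integral_fst[symmetric]) (rule SS.P.integrable_const_bound[of _ 1], auto)
    also have "\<dots> = (\<integral>x. iexp ((t * a) * x) * complex_of_real (exp (- (t * b)\<^sup>2 / 2)) \<partial>stdN)"
    proof (intro Bochner_Integration.integral_cong refl)
      fix x
      have "(\<integral>y. iexp (t * (a * x + b * y)) \<partial>stdN) = (\<integral>y. iexp ((t * a) * x) * iexp ((t * b) * y) \<partial>stdN)"
        by (intro Bochner_Integration.integral_cong refl) (simp add: mult_exp_exp algebra_simps)
      then show "(\<integral>y. iexp (t * (a * x + b * y)) \<partial>stdN) = iexp ((t * a) * x) * complex_of_real (exp (- (t * b)\<^sup>2 / 2))"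
        by (simp only: integral_mult_right_zero ch)
    qed
    also have "\<dots> = complex_of_real (exp (- (t * a)\<^sup>2 / 2)) * complex_of_real (exp (- (t * b)\<^sup>2 / 2))"
      by (simp only: integral_mult_left_zero ch)
    also have "\<dots> = complex_of_real (exp (- (t * c)\<^sup>2 / 2))"
    proof -
      have "- (t * a)\<^sup>2 / 2 + - (t * b)\<^sup>2 / 2 = - (t * c)\<^sup>2 / 2"
      proof -
        have "t\<^sup>2 * a\<^sup>2 + t\<^sup>2 * b\<^sup>2 = t\<^sup>2 * c\<^sup>2" using assms by (simp add: distrib_left[symmetric])
        then show ?thesis by (simp add: power_mult_distrib field_simps)
      qed
      then show ?thesis by (simp only: of_real_mult[symmetric] exp_add[symmetric])
    qed
    also have "\<dots> = (\<integral>x. iexp ((t * c) * x) \<partial>stdN)" by (simp only: ch)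
    also have "\<dots> = char (distr stdN borel (\<lambda>x. c * x)) t"
      unfolding char_def by (subst integral_distr) (auto simp: mult.assoc)
    finally show "char (distr (stdN \<Otimes>\<^sub>M stdN) borel (\<lambda>(x, y). a * x + b * y)) t = char (distr stdN borel (\<lambda>x. c * x)) t" .
  qed
qed

abbreviation stdNs :: "nat \<Rightarrow> (nat \<Rightarrow> real) measure" where
  "stdNs p \<equiv> PiM {..<p} (\<lambda>_. stdN)"

lemma prob_space_stdNs: "prob_space (stdNs p)"
  by (rule prob_space_PiM) (rule prob_space_stdN)

lemma sets_stdNs: "sets (stdNs p) = sets (vecM p)"
  unfolding vecM_def by (rule sets_PiM_cong) simp_all

lemma distr_stdNs_scale:
  "distr (stdNs p) (vecM p) (\<lambda>x. \<lambda>j\<in>{..<p}. c * x j) = PiM {..<p} (\<lambda>_. distr stdN borel (\<lambda>x. c * x))"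
proof -
  have "product_prob_space (\<lambda>_::nat. stdN)"
    by (intro product_prob_spaceI prob_space_stdN)
  moreover have "product_prob_space (\<lambda>_::nat. distr stdN borel (\<lambda>x. x) :: real measure)"
    by (intro product_prob_spaceI prob_space.prob_space_distr prob_space_stdN) simp
  moreover have "distr (stdNs p) (PiM {..<p} (\<lambda>_. borel)) (compose {..<p} (\<lambda>x. c * x))
    = distr (stdNs p) (PiM {..<p} (\<lambda>_. distr stdN borel (\<lambda>x. x))) (compose {..<p} (\<lambda>x. c * x))"
    by (intro distr_cong sets_PiM_cong refl) simp
  moreover have "distr stdN (distr stdN borel (\<lambda>x. x)) (\<lambda>x. c * x) = distr stdN borel (\<lambda>x. c * x)"
    by (intro distr_cong refl) simp
  ultimately show ?thesis
    using distr_PiM_finite_prob_space[of "{..<p}" "\<lambda>_. stdN" "\<lambda>_. distr stdN borel (\<lambda>x. x)" "\<lambda>x. c * x"]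
    unfolding vecM_def compose_def by simp
qed

text \<open>Coordinates are independent, so it suffices to compare boxes, where both sides factor
  into the one-dimensional statement.\<close>

lemma distr_stdNs_pair:
  assumes "a\<^sup>2 + b\<^sup>2 = c\<^sup>2"
  shows "distr (stdNs p \<Otimes>\<^sub>M stdNs p) (vecM p) (\<lambda>(x, y). \<lambda>j\<in>{..<p}. a * x j + b * y j)
    = distr (stdNs p) (vecM p) (\<lambda>x. \<lambda>j\<in>{..<p}. c * x j)"
  unfolding distr_stdNs_scale
proof -
  let ?N = "\<lambda>_::nat. distr stdN borel (\<lambda>x. c * x)"
  let ?D = "distr (stdNs p \<Otimes>\<^sub>M stdNs p) (vecM p) (\<lambda>(x, y). \<lambda>j\<in>{..<p}. a * x j + b * y j)"
  interpret S: prob_space stdN by (rule prob_space_stdN)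
  interpret Ss: prob_space "stdNs p" by (rule prob_space_stdNs)
  interpret SS: product_sigma_finite "\<lambda>_::nat. stdN"
    by (intro product_sigma_finite.intro S.sigma_finite_measure_axioms)
  interpret N: product_sigma_finite ?N
    by (intro product_sigma_finite.intro prob_space_imp_sigma_finite S.prob_space_distr) simp
  have m: "(\<lambda>(x, y). \<lambda>j\<in>{..<p}. a * x j + b * y j) \<in> measurable (stdNs p \<Otimes>\<^sub>M stdNs p) (vecM p)"
    unfolding vecM_def by measurable
  show "?D = PiM {..<p} ?N"
  proof (rule N.PiM_eqI)
    show "sets ?D = sets (PiM {..<p} ?N)"
      by (simp add: vecM_def) (rule sets_PiM_cong, simp_all)
    fix A assume A: "\<And>i. i \<in> {..<p} \<Longrightarrow> A i \<in> sets (?N i)"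
    then have [measurable]: "A i \<in> sets borel" if "i < p" for i using that by simp
    have P: "PiE {..<p} A \<in> sets (vecM p)"
      unfolding vecM_def by (intro sets_PiM_I_finite) (use A in auto)
    have e: "indicator (PiE {..<p} A) (\<lambda>j\<in>{..<p}. a * x j + b * y j)
        = (\<Prod>j<p. indicator (A j) (a * x j + b * y j) :: ennreal)" for x y
    proof (cases "\<forall>j<p. a * x j + b * y j \<in> A j")
      case True then show ?thesis by (auto simp: PiE_iff)
    next
      case False
      then obtain j where "j < p" "a * x j + b * y j \<notin> A j" by auto
      then have "(\<lambda>j\<in>{..<p}. a * x j + b * y j) \<notin> PiE {..<p} A"
        by (force simp: PiE_iff)
      moreover have "(\<Prod>j<p. indicator (A j) (a * x j + b * y j) :: ennreal) = 0"
        by (rule prod_zero) (use \<open>j < p\<close> \<open>a * x j + b * y j \<notin> A j\<close> in \<open>auto intro!: bexI[of _ j]\<close>)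
      ultimately show ?thesis by simp
    qed
    have "emeasure ?D (PiE {..<p} A) = (\<integral>\<^sup>+z. indicator (PiE {..<p} A) z \<partial>?D)"
      using P by simp
    also have "\<dots> = (\<integral>\<^sup>+z. (case z of (x, y) \<Rightarrow> \<Prod>j<p. indicator (A j) (a * x j + b * y j)) \<partial>(stdNs p \<Otimes>\<^sub>M stdNs p))"
      by (subst nn_integral_distr[OF m]) (use P in \<open>auto simp: case_prod_beta' e\<close>)
    also have "\<dots> = (\<integral>\<^sup>+x. \<integral>\<^sup>+y. (\<Prod>j<p. indicator (A j) (a * x j + b * y j)) \<partial>stdNs p \<partial>stdNs p)"
      by (subst Ss.nn_integral_fst[symmetric]) (auto simp: case_prod_beta')
    also have "\<dots> = (\<integral>\<^sup>+x. (\<Prod>j<p. \<integral>\<^sup>+y. indicator (A j) (a * x j + b * y) \<partial>stdN) \<partial>stdNs p)"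
      by (intro nn_integral_cong SS.product_nn_integral_prod) auto
    also have "\<dots> = (\<Prod>j<p. \<integral>\<^sup>+x. \<integral>\<^sup>+y. indicator (A j) (a * x + b * y) \<partial>stdN \<partial>stdN)"
      by (intro SS.product_nn_integral_prod S.borel_measurable_nn_integral) (auto simp: case_prod_beta')
    also have "\<dots> = (\<Prod>j<p. emeasure (?N j) (A j))"
    proof (intro prod.cong refl)
      fix j assume j: "j \<in> {..<p}"
      have Aj: "A j \<in> sets borel" using A[OF j] by simp
      have "emeasure (?N j) (A j) = emeasure (distr (stdN \<Otimes>\<^sub>M stdN) borel (\<lambda>(x, y). a * x + b * y)) (A j)"
        by (simp only: distr_stdN_pair[OF assms])
      also have "\<dots> = (\<integral>\<^sup>+z. indicator (A j) z \<partial>distr (stdN \<Otimes>\<^sub>M stdN) borel (\<lambda>(x, y). a * x + b * y))"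
        using Aj by simp
      also have "\<dots> = (\<integral>\<^sup>+z. (case z of (x, y) \<Rightarrow> indicator (A j) (a * x + b * y)) \<partial>(stdN \<Otimes>\<^sub>M stdN))"
        by (subst nn_integral_distr) (use Aj in \<open>auto simp: case_prod_beta'\<close>)
      also have "\<dots> = (\<integral>\<^sup>+x. \<integral>\<^sup>+y. indicator (A j) (a * x + b * y) \<partial>stdN \<partial>stdN)"
        by (subst S.nn_integral_fst[symmetric]) (use Aj in \<open>auto simp: case_prod_beta'\<close>)
      finally show "(\<integral>\<^sup>+x. \<integral>\<^sup>+y. indicator (A j) (a * x + b * y) \<partial>stdN \<partial>stdN) = emeasure (?N j) (A j)" by simp
    qed
    finally show "emeasure ?D (PiE {..<p} A) = (\<Prod>j\<in>{..<p}. emeasure (?N j) (A j))" .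
  qed simp
qed

text \<open>Arbitrary bounded test functions let the induction integrate out the last summand: the
  averaged function \<open>G'\<close> is again measurable and bounded by 1, and
  \<open>distr_stdNs_pair\<close> merges the scales sqrt n and 1 into sqrt (n + 1).\<close>

lemma integral_sum_stdNs:
  fixes G :: "(nat \<Rightarrow> real) \<Rightarrow> real" and n :: nat
  assumes "G \<in> borel_measurable (vecM p)" "\<And>x. \<bar>G x\<bar> \<le> 1"
  shows "(\<integral>\<omega>. G (\<lambda>j\<in>{..<p}. \<Sum>i<n. \<omega> i j) \<partial>PiM {..<n} (\<lambda>_. stdNs p))
    = (\<integral>x. G (\<lambda>j\<in>{..<p}. sqrt n * x j) \<partial>stdNs p)"
  using assms
proof (induction n arbitrary: G)
  case 0
  interpret E: prob_space "PiM {} (\<lambda>_::nat. stdNs p)" by (rule prob_space_PiM) (rule prob_space_stdNs)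
  interpret Ss: prob_space "stdNs p" by (rule prob_space_stdNs)
  show ?case using E.prob_space Ss.prob_space by simp
next
  case (Suc n G)
  note Gm[measurable] = Suc.prems(1) and Gb = Suc.prems(2)
  let ?P = "PiM {..<n} (\<lambda>_. stdNs p)"
  interpret Ss: prob_space "stdNs p" by (rule prob_space_stdNs)
  interpret SS: product_sigma_finite "\<lambda>_::nat. stdNs p"
    by (intro product_sigma_finite.intro Ss.sigma_finite_measure_axioms)
  interpret P: prob_space ?P by (rule prob_space_PiM) (rule prob_space_stdNs)
  interpret P1: prob_space "PiM {..<Suc n} (\<lambda>_::nat. stdNs p)" by (rule prob_space_PiM) (rule prob_space_stdNs)
  interpret PP: pair_prob_space "stdNs p" "stdNs p" ..
  have c: "(\<lambda>\<omega>. \<omega> i j) \<in> borel_measurable (PiM I (\<lambda>_. stdNs p))" if "i \<in> I" "j < p" for i j and I :: "nat set"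
    by (rule measurable_compose[OF measurable_component_singleton[OF that(1)]]) (use that(2) in simp)
  have sm: "(\<lambda>\<omega>. \<lambda>j\<in>{..<p}. \<Sum>i<m. \<omega> i j) \<in> measurable (PiM {..<m} (\<lambda>_. stdNs p)) (vecM p)" for m :: nat
    unfolding vecM_def
  proof (rule measurable_restrict)
    fix j assume j: "j \<in> {..<p}"
    show "(\<lambda>\<omega>. \<Sum>i<m. \<omega> i j) \<in> borel_measurable (PiM {..<m} (\<lambda>_. stdNs p))"
      by (intro borel_measurable_sum c) (use j in auto)
  qed
  define G' where "G' w = (\<integral>y. G (\<lambda>j\<in>{..<p}. w j + y j) \<partial>stdNs p)" for w
  have G'm: "G' \<in> borel_measurable (vecM p)"
    unfolding G'_def[abs_def]
  proof (rule Ss.borel_measurable_lebesgue_integral)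
    have [measurable]: "(\<lambda>z. fst z j) \<in> borel_measurable (vecM p \<Otimes>\<^sub>M stdNs p)" if "j \<in> {..<p}" for j
      unfolding vecM_def by (rule measurable_compose[OF measurable_fst measurable_component_singleton[OF that]])
    have "(\<lambda>z. \<lambda>j\<in>{..<p}. fst z j + snd z j) \<in> measurable (vecM p \<Otimes>\<^sub>M stdNs p) (vecM p)"
      by (subst (2) vecM_def) measurable
    then show "(\<lambda>(w, y). G (\<lambda>j\<in>{..<p}. w j + y j)) \<in> borel_measurable (vecM p \<Otimes>\<^sub>M stdNs p)"
      unfolding case_prod_beta' by (rule measurable_compose) (rule Gm)
  qed
  have G'b: "\<bar>G' w\<bar> \<le> 1" for w
  proof -
    have "\<bar>G' w\<bar> \<le> (\<integral>y. \<bar>G (\<lambda>j\<in>{..<p}. w j + y j)\<bar> \<partial>stdNs p)"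
      unfolding G'_def by (rule integral_abs_bound)
    also have "\<dots> \<le> (\<integral>y. 1 \<partial>stdNs p)"
      by (rule integral_mono') (use Gb in auto)
    finally show ?thesis by (simp add: Ss.prob_space)
  qed
  have int: "integrable (PiM {..<Suc n} (\<lambda>_. stdNs p)) (\<lambda>\<omega>. G (\<lambda>j\<in>{..<p}. \<Sum>i<Suc n. \<omega> i j))"
  proof (rule P1.integrable_const_bound[of _ 1])
    show "(\<lambda>\<omega>. G (\<lambda>j\<in>{..<p}. \<Sum>i<Suc n. \<omega> i j)) \<in> borel_measurable (PiM {..<Suc n} (\<lambda>_. stdNs p))"
      by (rule measurable_compose[OF sm Gm])
  qed (use Gb in simp)
  have m1: "(\<lambda>(x, y). \<lambda>j\<in>{..<p}. sqrt n * x j + 1 * y j) \<in> measurable (stdNs p \<Otimes>\<^sub>M stdNs p) (vecM p)"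
    unfolding vecM_def by measurable
  have m2: "(\<lambda>x. \<lambda>j\<in>{..<p}. sqrt (Suc n) * x j) \<in> measurable (stdNs p) (vecM p)"
    unfolding vecM_def by measurable
  have e1: "(\<lambda>j\<in>{..<p}. \<Sum>i<Suc n. fun_upd \<omega> n y i j) = (\<lambda>j\<in>{..<p}. (\<lambda>j\<in>{..<p}. \<Sum>i<n. \<omega> i j) j + y j)" for \<omega> y
  proof (rule restrict_ext)
    fix j assume j: "j \<in> {..<p}"
    have "(\<Sum>i<n. fun_upd \<omega> n y i j) = (\<Sum>i<n. \<omega> i j)" by (intro sum.cong) auto
    then show "(\<Sum>i<Suc n. fun_upd \<omega> n y i j) = (\<lambda>j\<in>{..<p}. \<Sum>i<n. \<omega> i j) j + y j" using j by simp
  qed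
  have e2: "(\<lambda>j\<in>{..<p}. (\<lambda>j\<in>{..<p}. sqrt n * x j) j + y j) = (\<lambda>j\<in>{..<p}. sqrt n * x j + 1 * y j)" for x y :: "nat \<Rightarrow> real"
    by (rule restrict_ext) simp
  have "(\<integral>\<omega>. G (\<lambda>j\<in>{..<p}. \<Sum>i<Suc n. \<omega> i j) \<partial>PiM {..<Suc n} (\<lambda>_. stdNs p))
      = (\<integral>\<omega>. (\<integral>y. G (\<lambda>j\<in>{..<p}. \<Sum>i<Suc n. fun_upd \<omega> n y i j) \<partial>stdNs p) \<partial>?P)"
    using SS.product_integral_insert[of "{..<n}" n "\<lambda>\<omega>. G (\<lambda>j\<in>{..<p}. \<Sum>i<Suc n. \<omega> i j)"] int
    unfolding lessThan_Suc by simp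
  also have "\<dots> = (\<integral>\<omega>. G' (\<lambda>j\<in>{..<p}. \<Sum>i<n. \<omega> i j) \<partial>?P)"
    unfolding G'_def e1 ..
  also have "\<dots> = (\<integral>x. G' (\<lambda>j\<in>{..<p}. sqrt n * x j) \<partial>stdNs p)"
    by (rule Suc.IH[OF G'm G'b])
  also have "\<dots> = (\<integral>x. (\<integral>y. G (\<lambda>j\<in>{..<p}. sqrt n * x j + 1 * y j) \<partial>stdNs p) \<partial>stdNs p)"
    unfolding G'_def e2 ..
  also have "\<dots> = (\<integral>z. (case z of (x, y) \<Rightarrow> G (\<lambda>j\<in>{..<p}. sqrt n * x j + 1 * y j)) \<partial>(stdNs p \<Otimes>\<^sub>M stdNs p))"
  proof (rule PP.integral_fst, rule PP.P.integrable_const_bound[of _ 1])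
    have "(\<lambda>z. \<lambda>j\<in>{..<p}. sqrt n * fst z j + 1 * snd z j) \<in> measurable (stdNs p \<Otimes>\<^sub>M stdNs p) (vecM p)"
      unfolding vecM_def by measurable
    then show "(\<lambda>(x, y). G (\<lambda>j\<in>{..<p}. sqrt n * x j + 1 * y j)) \<in> borel_measurable (stdNs p \<Otimes>\<^sub>M stdNs p)"
      unfolding case_prod_beta' by (rule measurable_compose) (rule Gm)
  qed (use Gb in auto)
  also have "\<dots> = (\<integral>w. G w \<partial>distr (stdNs p \<Otimes>\<^sub>M stdNs p) (vecM p) (\<lambda>(x, y). \<lambda>j\<in>{..<p}. sqrt n * x j + 1 * y j))"
    by (subst integral_distr[OF m1 Gm]) (simp add: case_prod_beta')
  also have "\<dots> = (\<integral>w. G w \<partial>distr (stdNs p) (vecM p) (\<lambda>x. \<lambda>j\<in>{..<p}. sqrt (Suc n) * x j))"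
    by (subst distr_stdNs_pair[of _ _ "sqrt (Suc n)"]) auto
  also have "\<dots> = (\<integral>x. G (\<lambda>j\<in>{..<p}. sqrt (Suc n) * x j) \<partial>stdNs p)"
    by (rule integral_distr[OF m2 Gm])
  finally show ?case .
qed

section \<open>Moments of weighted sums of independent variables\<close>

definition qmom1 :: "real \<Rightarrow> real" where
  "qmom1 \<delta> = (\<integral>x. \<bar>x\<bar> powr (2 + \<delta>) \<partial>stdN)"

text \<open>The q-th power of c_\<delta> is this moment times (1 + \<delta>)^(q/2).\<close>

definition qmom2 :: "real \<Rightarrow> real" where
  "qmom2 \<delta> = (\<integral>x. \<bar>x\<^sup>2 - 1\<bar> powr (2 + \<delta>) \<partial>stdN)"

lemma integrable_stdN_power: "integrable stdN (\<lambda>x. x ^ k)"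
  unfolding stdN_def by (rule integrable_std_normal_distribution_moment)

lemma integral_stdN_moments:
  "(\<integral>x. x \<partial>stdN) = 0" "(\<integral>x. x\<^sup>2 \<partial>stdN) = 1" "(\<integral>x. x ^ 4 \<partial>stdN) = 3"
proof -
  show "(\<integral>x. x \<partial>stdN) = 0"
    using integral_std_normal_distribution_moment_odd[of 1] by (simp add: stdN_def)
  show "(\<integral>x. x\<^sup>2 \<partial>stdN) = 1"
    using std_normal_distribution_even_moments(1)[of 1] by (simp add: stdN_def)
  show "(\<integral>x. x ^ 4 \<partial>stdN) = 3"
    using std_normal_distribution_even_moments(1)[of 2] by (simp add: stdN_def fact_numeral)
qed

lemma powr_le_one_plus_power4:
  fixes y :: real
  assumes "0 < \<delta>" "\<delta> \<le> 1"
  shows "\<bar>y\<bar> powr (2 + \<delta>) \<le> 1 + y ^ 4"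
proof -
  have "\<bar>y\<bar> powr (2 + \<delta>) \<le> 1 + \<bar>y\<bar> powr 4"
    using assms by (intro powr_le_one_plus) auto
  also have "\<bar>y\<bar> powr 4 = y ^ 4" by (cases "y = 0") (auto simp: powr_numeral)
  finally show ?thesis .
qed

lemma integrable_stdN_qmom:
  assumes "0 < \<delta>" "\<delta> \<le> 1"
  shows "integrable stdN (\<lambda>x. \<bar>x\<bar> powr (2 + \<delta>))" "integrable stdN (\<lambda>x. \<bar>x\<^sup>2 - 1\<bar> powr (2 + \<delta>))"
proof -
  interpret S: prob_space stdN by (rule prob_space_stdN)
  have "integrable stdN (\<lambda>x. 1 + x ^ 4)" using integrable_stdN_power[of 4] by simp
  then show "integrable stdN (\<lambda>x. \<bar>x\<bar> powr (2 + \<delta>))"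
    by (rule Bochner_Integration.integrable_bound)
      (use powr_le_one_plus_power4[OF assms] in \<open>auto intro!: AE_I2\<close>)
  have "(x\<^sup>2 - 1) ^ 4 = x ^ 8 - 4 * x ^ 6 + 6 * x ^ 4 - 4 * x ^ 2 + 1" for x :: real
    by (simp add: eval_nat_numeral algebra_simps)
  then have "integrable stdN (\<lambda>x. 1 + (x\<^sup>2 - 1) ^ 4)" using integrable_stdN_power by simp
  then show "integrable stdN (\<lambda>x. \<bar>x\<^sup>2 - 1\<bar> powr (2 + \<delta>))"
    by (rule Bochner_Integration.integrable_bound)
      (use powr_le_one_plus_power4[OF assms] in \<open>auto intro!: AE_I2\<close>)
qed

lemma integral_chi2_variance: "(\<integral>x. (x\<^sup>2 - 1)\<^sup>2 \<partial>stdN) = 2"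
proof -
  interpret S: prob_space stdN by (rule prob_space_stdN)
  have "(x\<^sup>2 - 1)\<^sup>2 = x ^ 4 - 2 * x\<^sup>2 + 1" for x :: real
    by (simp add: eval_nat_numeral algebra_simps)
  then show ?thesis
    using integrable_stdN_power[of 4] integrable_stdN_power[of 2]
    by (simp add: integral_stdN_moments S.prob_space[unfolded space_stdN])
qed

text \<open>The two terms of Rosenthal's bound take the same shape: the sum of |a_k|^q is at most
  the q/2-th power of the sum of a_k^2, and Jensen bounds the q/2-th power of the variance of
  \<open>\<zeta>\<close> by its q-th moment. So 3 becomes 6.\<close>

lemma weighted_sum_stdNs:
  fixes a :: "nat \<Rightarrow> real" and \<zeta> :: "real \<Rightarrow> real"
  assumes \<delta>: "0 < \<delta>" "\<delta> \<le> 1"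
    and \<zeta>: "\<zeta> \<in> borel_measurable borel" "integrable stdN (\<lambda>x. \<bar>\<zeta> x\<bar> powr (2 + \<delta>))" "(\<integral>x. \<zeta> x \<partial>stdN) = 0"
  shows "integrable (stdNs p) (\<lambda>x. \<bar>\<Sum>k<p. a k * \<zeta> (x k)\<bar> powr (2 + \<delta>))"
    and "(\<integral>x. (\<Sum>k<p. a k * \<zeta> (x k))\<^sup>2 \<partial>stdNs p) = (\<Sum>k<p. (a k)\<^sup>2) * (\<integral>x. (\<zeta> x)\<^sup>2 \<partial>stdN)"
    and "(\<integral>x. \<bar>\<Sum>k<p. a k * \<zeta> (x k)\<bar> powr (2 + \<delta>) \<partial>stdNs p)
      \<le> 6 * (\<integral>x. \<bar>\<zeta> x\<bar> powr (2 + \<delta>) \<partial>stdN) * (\<Sum>k<p. (a k)\<^sup>2) powr ((2 + \<delta>) / 2)"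
proof -
  interpret S: prob_space stdN by (rule prob_space_stdN)
  let ?q = "2 + \<delta>"
  define m where "m = (\<integral>x. \<bar>\<zeta> x\<bar> powr ?q \<partial>stdN)"
  define s where "s = (\<integral>x. (\<zeta> x)\<^sup>2 \<partial>stdN)"
  define A where "A = (\<Sum>k<p. (a k)\<^sup>2)"
  have A0: "0 \<le> A" by (simp add: A_def sum_nonneg)
  have s0: "0 \<le> s" by (simp add: s_def)
  have m0: "0 \<le> m" by (simp add: m_def)
  have zm: "\<zeta> \<in> borel_measurable stdN" using \<zeta>(1) by simp
  have sm: "s powr (?q / 2) \<le> m"
    unfolding s_def m_def by (rule S.powr_le_moments(5)[OF \<delta> zm \<zeta>(2)])
  have R: "integrable (stdNs p) (\<lambda>x. \<bar>\<Sum>k\<in>{..<p}. a k * \<zeta> (x k)\<bar> powr ?q) \<and>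
    (\<integral>x. (\<Sum>k\<in>{..<p}. a k * \<zeta> (x k))\<^sup>2 \<partial>stdNs p) = (\<Sum>k\<in>{..<p}. \<integral>x. (a k * \<zeta> x)\<^sup>2 \<partial>stdN) \<and>
    (\<integral>x. \<bar>\<Sum>k\<in>{..<p}. a k * \<zeta> (x k)\<bar> powr ?q \<partial>stdNs p)
      \<le> 3 * ((\<Sum>k\<in>{..<p}. \<integral>x. (a k * \<zeta> x)\<^sup>2 \<partial>stdN) powr (?q / 2) + (\<Sum>k\<in>{..<p}. \<integral>x. \<bar>a k * \<zeta> x\<bar> powr ?q \<partial>stdN))"
    by (rule rosenthal_PiM[OF \<delta> prob_space_stdN finite_lessThan, of p "\<lambda>k x. a k * \<zeta> x"])
      (use \<zeta> in \<open>auto simp: abs_mult powr_mult\<close>)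
  have e1: "(\<Sum>k<p. \<integral>x. (a k * \<zeta> x)\<^sup>2 \<partial>stdN) = A * s"
    by (simp add: power_mult_distrib A_def s_def sum_distrib_right)
  have e2: "(\<Sum>k<p. \<integral>x. \<bar>a k * \<zeta> x\<bar> powr ?q \<partial>stdN) = (\<Sum>k<p. \<bar>a k\<bar> powr ?q) * m"
    by (simp add: abs_mult powr_mult m_def sum_distrib_right)
  show "integrable (stdNs p) (\<lambda>x. \<bar>\<Sum>k<p. a k * \<zeta> (x k)\<bar> powr ?q)" using R by blast
  show "(\<integral>x. (\<Sum>k<p. a k * \<zeta> (x k))\<^sup>2 \<partial>stdNs p) = (\<Sum>k<p. (a k)\<^sup>2) * (\<integral>x. (\<zeta> x)\<^sup>2 \<partial>stdN)"
    using R unfolding e1 A_def s_def by blast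
  have "(\<Sum>k<p. \<bar>a k\<bar> powr ?q) \<le> A powr (?q / 2)"
  proof -
    have "\<bar>a k\<bar> powr ?q \<le> A powr (\<delta> / 2) * (a k)\<^sup>2" if "k < p" for k
    proof -
      have "(a k)\<^sup>2 \<le> A" unfolding A_def using that by (intro member_le_sum) auto
      then have "((a k)\<^sup>2) powr (\<delta> / 2) \<le> A powr (\<delta> / 2)" using \<delta> by (intro powr_mono2) auto
      moreover have "\<bar>a k\<bar> powr ?q = ((a k)\<^sup>2) powr (\<delta> / 2) * (a k)\<^sup>2"
      proof (cases "a k = 0")
        case False
        have "(a k)\<^sup>2 = \<bar>a k\<bar> powr 2" using False by simp
        then have "((a k)\<^sup>2) powr (\<delta> / 2) = \<bar>a k\<bar> powr \<delta>" by (simp only: powr_powr) simp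
        moreover have "\<bar>a k\<bar> powr ?q = \<bar>a k\<bar> powr 2 * \<bar>a k\<bar> powr \<delta>" by (rule powr_add)
        ultimately show ?thesis using False by simp
      qed simp
      ultimately show ?thesis by (simp add: mult_right_mono)
    qed
    then have "(\<Sum>k<p. \<bar>a k\<bar> powr ?q) \<le> (\<Sum>k<p. A powr (\<delta> / 2) * (a k)\<^sup>2)" by (intro sum_mono) auto
    also have "\<dots> = A powr (\<delta> / 2) * A" by (simp add: A_def sum_distrib_left)
    also have "\<dots> = A powr (?q / 2)"
    proof -
      have "?q / 2 = \<delta> / 2 + 1" by simp
      then show ?thesis using A0 by (simp only: powr_add) simp
    qed
    finally show ?thesis .
  qed
  then have "(\<Sum>k<p. \<bar>a k\<bar> powr ?q) * m \<le> A powr (?q / 2) * m"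
    using m0 by (rule mult_right_mono)
  moreover have "(A * s) powr (?q / 2) \<le> A powr (?q / 2) * m"
    using sm A0 s0 by (simp add: powr_mult mult_left_mono)
  ultimately have "3 * ((A * s) powr (?q / 2) + (\<Sum>k<p. \<bar>a k\<bar> powr ?q) * m) \<le> 6 * m * A powr (?q / 2)"
    by (simp add: mult.commute)
  then show "(\<integral>x. \<bar>\<Sum>k<p. a k * \<zeta> (x k)\<bar> powr ?q \<partial>stdNs p)
      \<le> 6 * (\<integral>x. \<bar>\<zeta> x\<bar> powr ?q \<partial>stdN) * (\<Sum>k<p. (a k)\<^sup>2) powr (?q / 2)"
    using R unfolding e1 e2 m_def[symmetric] A_def[symmetric] by linarith
qed

lemma linear_stdNs:
  fixes a :: "nat \<Rightarrow> real"
  assumes \<delta>: "0 < \<delta>" "\<delta> \<le> 1"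
  shows "integrable (stdNs p) (\<lambda>x. \<bar>\<Sum>k<p. a k * x k\<bar> powr (2 + \<delta>))"
    and "(\<integral>x. (\<Sum>k<p. a k * x k)\<^sup>2 \<partial>stdNs p) = (\<Sum>k<p. (a k)\<^sup>2)"
    and "(\<integral>x. \<bar>\<Sum>k<p. a k * x k\<bar> powr (2 + \<delta>) \<partial>stdNs p)
      \<le> 6 * qmom1 \<delta> * (\<Sum>k<p. (a k)\<^sup>2) powr ((2 + \<delta>) / 2)"
  using weighted_sum_stdNs[OF \<delta>, of "\<lambda>x. x" p a, OF _ integrable_stdN_qmom(1)[OF \<delta>] integral_stdN_moments(1)]
  unfolding qmom1_def integral_stdN_moments by simp_all

lemma integral_chi2_mean: "(\<integral>x. x\<^sup>2 - 1 \<partial>stdN) = 0"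
proof -
  interpret S: prob_space stdN by (rule prob_space_stdN)
  show ?thesis using integrable_stdN_power[of 2]
    by (simp add: integral_stdN_moments S.prob_space[unfolded space_stdN])
qed

lemma chi_form_moments:
  assumes \<delta>: "0 < \<delta>" "\<delta> \<le> 1"
  shows "integrable (stdNs p) (\<lambda>x. \<bar>chi_form p a x\<bar> powr (2 + \<delta>))"
    and "(\<integral>x. (chi_form p a x)\<^sup>2 \<partial>stdNs p) = 2 * (\<Sum>k<p. (a k)\<^sup>2)"
    and "(\<integral>x. \<bar>chi_form p a x\<bar> powr (2 + \<delta>) \<partial>stdNs p) \<le> 6 * qmom2 \<delta> * (\<Sum>k<p. (a k)\<^sup>2) powr ((2 + \<delta>) / 2)"
  using weighted_sum_stdNs[OF \<delta>, of "\<lambda>x. x\<^sup>2 - 1", OF _ integrable_stdN_qmom(2)[OF \<delta>] integral_chi2_mean]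
  by (simp_all add: chi_form_def integral_chi2_variance qmom2_def mult.commute)

text \<open>The Gaussian law with covariance \<open>S = U diag(l) U\<^sup>T\<close> is the image of independent standard normals.\<close>
definition gvec :: "nat \<Rightarrow> (nat \<Rightarrow> nat \<Rightarrow> real) \<Rightarrow> (nat \<Rightarrow> real) \<Rightarrow> (nat \<Rightarrow> real) \<Rightarrow> nat \<Rightarrow> real" where
  "gvec p u l x = (\<lambda>i\<in>{..<p}. \<Sum>k<p. u i k * (sqrt (l k) * x k))"

lemma qform_spectral:
  assumes spec: "\<And>i j. i < p \<Longrightarrow> j < p \<Longrightarrow> (\<Sum>k<p. u i k * l k * u j k) = S i j"
  shows "qform p S w = (\<Sum>k<p. l k * (\<Sum>i<p. u i k * w i)\<^sup>2)"
proof -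
  have "qform p S w = (\<Sum>i<p. \<Sum>j<p. \<Sum>k<p. l k * ((u i k * w i) * (u j k * w j)))"
    unfolding qform_def
    by (intro sum.cong refl) (simp add: spec[symmetric] sum_distrib_left sum_distrib_right mult_ac)
  also have "\<dots> = (\<Sum>i<p. \<Sum>k<p. \<Sum>j<p. l k * ((u i k * w i) * (u j k * w j)))"
    by (intro sum.cong refl sum.swap)
  also have "\<dots> = (\<Sum>k<p. \<Sum>i<p. \<Sum>j<p. l k * ((u i k * w i) * (u j k * w j)))"
    by (rule sum.swap)
  also have "\<dots> = (\<Sum>k<p. l k * (\<Sum>i<p. u i k * w i)\<^sup>2)"
    by (intro sum.cong refl) (simp only: power2_eq_square sum_product, simp only: sum_distrib_left)
  finally show ?thesis .
qed

text \<open>Exhibits each eigenvalue as a value of the quadratic form, hence as nonnegative when S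
  is a covariance matrix.\<close>

lemma qform_eigenvector:
  assumes orth: "\<And>i j. i < p \<Longrightarrow> j < p \<Longrightarrow> (\<Sum>k<p. u k i * u k j) = (if i = j then 1 else 0)"
    and spec: "\<And>i j. i < p \<Longrightarrow> j < p \<Longrightarrow> (\<Sum>k<p. u i k * l k * u j k) = S i j"
    and k: "k < p"
  shows "qform p S (\<lambda>i. u i k) = l k"
proof -
  have "qform p S (\<lambda>i. u i k) = (\<Sum>m<p. l m * (\<Sum>i<p. u i m * u i k)\<^sup>2)"
    using spec by (rule qform_spectral)
  also have "\<dots> = (\<Sum>m<p. if m = k then l k else 0)"
    using k by (intro sum.cong refl) (simp add: orth)
  also have "\<dots> = l k" using k by simp
  finally show ?thesis .
qed

section \<open>The Gaussian law with a prescribed covariance\<close>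

locale gauss_law =
  fixes p :: nat and S u :: "nat \<Rightarrow> nat \<Rightarrow> real" and l :: "nat \<Rightarrow> real" and \<delta> :: real
  assumes \<delta>: "0 < \<delta>" "\<delta> \<le> 1"
    and l: "\<And>k. k < p \<Longrightarrow> 0 \<le> l k"
    and orth: "\<And>i j. i < p \<Longrightarrow> j < p \<Longrightarrow> (\<Sum>k<p. u k i * u k j) = (if i = j then 1 else 0)"
    and spec: "\<And>i j. i < p \<Longrightarrow> j < p \<Longrightarrow> (\<Sum>k<p. u i k * l k * u j k) = S i j"
begin

definition gl :: "(nat \<Rightarrow> real) measure" where
  "gl = distr (stdNs p) (vecM p) (gvec p u l)"

lemma measurable_gvec [measurable]: "gvec p u l \<in> measurable (stdNs p) (vecM p)"
  unfolding gvec_def vecM_def by measurable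

text \<open>Parseval for the orthonormal columns of \<open>u\<close>; the formulas for the norm and
  for the sum of squared entries are instances.\<close>

lemma sum_orth: "(\<Sum>i<p. (\<Sum>k<p. u i k * a k) * (\<Sum>k<p. u i k * b k)) = (\<Sum>k<p. a k * b k)"
proof -
  have "(\<Sum>i<p. (\<Sum>k<p. u i k * a k) * (\<Sum>m<p. u i m * b m))
      = (\<Sum>i<p. \<Sum>k<p. \<Sum>m<p. (a k * b m) * (u i k * u i m))"
    by (simp add: sum_product mult_ac)
  also have "\<dots> = (\<Sum>k<p. \<Sum>i<p. \<Sum>m<p. (a k * b m) * (u i k * u i m))"
    by (rule sum.swap)
  also have "\<dots> = (\<Sum>k<p. \<Sum>m<p. \<Sum>i<p. (a k * b m) * (u i k * u i m))"
    by (intro sum.cong refl sum.swap)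
  also have "\<dots> = (\<Sum>k<p. \<Sum>m<p. (a k * b m) * (if k = m then 1 else 0))"
    by (intro sum.cong refl) (simp add: sum_distrib_left[symmetric] orth)
  also have "\<dots> = (\<Sum>k<p. a k * b k)"
    by (simp add: if_distrib cong: if_cong)
  finally show ?thesis .
qed

lemma sqnorm_gvec: "sqnorm p (gvec p u l x) = (\<Sum>k<p. l k * (x k)\<^sup>2)"
proof -
  have "sqnorm p (gvec p u l x) = (\<Sum>i<p. (\<Sum>k<p. u i k * (sqrt (l k) * x k)) * (\<Sum>k<p. u i k * (sqrt (l k) * x k)))"
    by (simp add: sqnorm_def gvec_def power2_eq_square)
  also have "\<dots> = (\<Sum>k<p. l k * (x k)\<^sup>2)"
    unfolding sum_orth by (intro sum.cong refl) (simp add: l power2_eq_square)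
  finally show ?thesis .
qed

lemma sum_eigs: "(\<Sum>j<p. S j j) = (\<Sum>k<p. l k)"
proof -
  have "(\<Sum>j<p. S j j) = (\<Sum>j<p. \<Sum>k<p. u j k * l k * u j k)"
    by (simp add: spec)
  also have "\<dots> = (\<Sum>k<p. \<Sum>j<p. l k * (u j k * u j k))"
    by (subst sum.swap) (simp add: mult_ac)
  also have "\<dots> = (\<Sum>k<p. l k)"
    by (simp add: sum_distrib_left[symmetric] orth)
  finally show ?thesis .
qed

lemma qform_spec: "qform p S w = (\<Sum>k<p. l k * (\<Sum>i<p. u i k * w i)\<^sup>2)"
  using spec by (rule qform_spectral)

lemma qform_gvec: "qform p S (gvec p u l x) = (\<Sum>k<p. (l k)\<^sup>2 * (x k)\<^sup>2)"
proof -
  have "(\<Sum>i<p. u i k * gvec p u l x i) = sqrt (l k) * x k" if "k < p" for k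
  proof -
    have "(\<Sum>i<p. u i k * gvec p u l x i) = (\<Sum>i<p. \<Sum>m<p. (sqrt (l m) * x m) * (u i k * u i m))"
      by (simp add: gvec_def sum_distrib_left mult_ac)
    also have "\<dots> = (\<Sum>m<p. \<Sum>i<p. (sqrt (l m) * x m) * (u i k * u i m))" by (rule sum.swap)
    also have "\<dots> = (\<Sum>m<p. (sqrt (l m) * x m) * (if k = m then 1 else 0))"
      using that by (intro sum.cong refl) (simp add: sum_distrib_left[symmetric] orth)
    also have "\<dots> = sqrt (l k) * x k" using that by (simp add: if_distrib cong: if_cong)
    finally show ?thesis .
  qed
  then show ?thesis
    unfolding qform_spec by (intro sum.cong refl) (simp add: l power_mult_distrib power2_eq_square)
qed

lemma sum_eigs2: "(\<Sum>i<p. \<Sum>j<p. (S i j)\<^sup>2) = (\<Sum>k<p. (l k)\<^sup>2)"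
proof -
  have "(\<Sum>i<p. \<Sum>j<p. (S i j)\<^sup>2) = (\<Sum>i<p. \<Sum>j<p. (\<Sum>k<p. u j k * (u i k * l k)) * (\<Sum>k<p. u j k * (u i k * l k)))"
    by (intro sum.cong refl) (simp add: spec[symmetric] power2_eq_square mult_ac)
  also have "\<dots> = (\<Sum>i<p. \<Sum>k<p. (u i k * l k) * (u i k * l k))"
    unfolding sum_orth ..
  also have "\<dots> = (\<Sum>k<p. \<Sum>i<p. (l k)\<^sup>2 * (u i k * u i k))"
    by (subst sum.swap) (simp add: power2_eq_square mult_ac)
  also have "\<dots> = (\<Sum>k<p. (l k)\<^sup>2)"
    by (simp add: sum_distrib_left[symmetric] orth)
  finally show ?thesis .
qed

text \<open>An exact identity, because \<open>u\<close> preserves the norm: this is why the Gaussian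
  side of the comparison is V itself and not an approximation.\<close>

lemma sqnorm_chi: "sqnorm p (gvec p u l x) = chi_form p l x + (\<Sum>j<p. S j j)"
  unfolding sqnorm_gvec sum_eigs chi_form_def by (simp add: right_diff_distrib sum_subtractf)

lemma dotp_gvec: "dotp p w (gvec p u l x) = (\<Sum>k<p. (sqrt (l k) * (\<Sum>i<p. u i k * w i)) * x k)"
proof -
  have "dotp p w (gvec p u l x) = (\<Sum>i<p. \<Sum>k<p. (sqrt (l k) * (u i k * w i)) * x k)"
    unfolding dotp_def gvec_def by (simp add: sum_distrib_left mult_ac)
  also have "\<dots> = (\<Sum>k<p. \<Sum>i<p. (sqrt (l k) * (u i k * w i)) * x k)" by (rule sum.swap)
  finally show ?thesis by (simp add: sum_distrib_left sum_distrib_right)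
qed

lemma sum_dotp_coeff: "(\<Sum>k<p. (sqrt (l k) * (\<Sum>i<p. u i k * w i))\<^sup>2) = qform p S w"
  unfolding qform_spec by (intro sum.cong refl) (simp add: power_mult_distrib l)

lemma integral_gl:
  fixes f :: "(nat \<Rightarrow> real) \<Rightarrow> real"
  assumes "f \<in> borel_measurable (vecM p)"
  shows "(\<integral>y. f y \<partial>gl) = (\<integral>x. f (gvec p u l x) \<partial>stdNs p)"
    and "integrable gl f \<longleftrightarrow> integrable (stdNs p) (\<lambda>x. f (gvec p u l x))"
  unfolding gl_def using assms by (auto intro!: integral_distr integrable_distr_eq)

lemma measurable_vecM_coord [measurable (raw)]: "j < p \<Longrightarrow> (\<lambda>x. x j) \<in> borel_measurable (vecM p)"
  unfolding vecM_def by simp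

lemma measurable_vecM_forms [measurable]:
  "sqnorm p \<in> borel_measurable (vecM p)" "dotp p w \<in> borel_measurable (vecM p)"
  "qform p S \<in> borel_measurable (vecM p)"
  unfolding sqnorm_def[abs_def] dotp_def[abs_def] qform_def[abs_def] by measurable

lemma integrable_coord_stdNs:
  assumes "k < p"
  shows "integrable (stdNs p) (\<lambda>x. x k)" "(\<integral>x. x k \<partial>stdNs p) = 0"
proof -
  have d: "distr (stdNs p) stdN (\<lambda>x. x k) = stdN"
    by (rule distr_PiM_component) (use prob_space_stdN assms in auto)
  have m: "(\<lambda>x. x k) \<in> measurable (stdNs p) stdN"
    by (rule measurable_component_singleton) (use assms in simp)
  have "integrable (distr (stdNs p) stdN (\<lambda>x. x k)) (\<lambda>x. x)"
    unfolding d using integrable_stdN_power[of 1] by simp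
  then show "integrable (stdNs p) (\<lambda>x. x k)"
    by (subst (asm) integrable_distr_eq[OF m]) auto
  have "(\<integral>x. x \<partial>distr (stdNs p) stdN (\<lambda>x. x k)) = 0"
    unfolding d by (rule integral_stdN_moments)
  then show "(\<integral>x. x k \<partial>stdNs p) = 0"
    by (subst (asm) integral_distr[OF m]) auto
qed

lemma gl_square:
  shows "integrable gl (\<lambda>y. (dotp p w y)\<^sup>2)" "(\<integral>y. (dotp p w y)\<^sup>2 \<partial>gl) = qform p S w"
proof -
  interpret prob_space "stdNs p" by (rule prob_space_stdNs)
  have [measurable]: "dotp p w \<in> borel_measurable (vecM p)" by measurable
  have "integrable (stdNs p) (\<lambda>x. (dotp p w (gvec p u l x))\<^sup>2)"
    by (rule powr_le_moments(2)[OF \<delta>]) (measurable, simp only: dotp_gvec, rule linear_stdNs(1)[OF \<delta>])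
  then show "integrable gl (\<lambda>y. (dotp p w y)\<^sup>2)" by (subst integral_gl(2)) auto
  show "(\<integral>y. (dotp p w y)\<^sup>2 \<partial>gl) = qform p S w"
    by (subst integral_gl(1), measurable) (simp only: dotp_gvec linear_stdNs(2)[OF \<delta>] sum_dotp_coeff)
qed

lemma cov_law_gl: "cov_law gl p S \<delta>"
proof (intro cov_law.intro cov_law_axioms.intro)
  interpret prob_space "stdNs p" by (rule prob_space_stdNs)
  show "prob_space gl" unfolding gl_def by (rule prob_space_distr) measurable
  show "sets gl = sets (vecM p)" by (simp add: gl_def)
  show "(\<integral>y. y j \<partial>gl) = 0" if "j < p" for j
  proof -
    have "(\<integral>y. y j \<partial>gl) = (\<integral>x. (\<Sum>k<p. u j k * (sqrt (l k) * x k)) \<partial>stdNs p)"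
      by (subst integral_gl(1)) (use that in \<open>auto simp: gvec_def\<close>)
    also have "\<dots> = 0"
      by (subst Bochner_Integration.integral_sum) (auto simp: integrable_coord_stdNs)
    finally show ?thesis .
  qed
  show "(\<integral>y. y i * y j \<partial>gl) = S i j" if "i < p" "j < p" for i j
  proof -
    \<comment> \<open>Second moments of linear forms are known from \<open>gl_square\<close>.
      Covariances follow by polarisation, y_i y_j = ((y_i + y_j)^2 - y_i^2 - y_j^2) / 2.\<close>
    define e where "e i k = (if k = i then 1 else 0 :: real)" for i k :: nat
    have d: "dotp p (e i) y = y i" if "i < p" for i y
      unfolding dotp_def e_def using that by (simp add: if_distrib[where f = "\<lambda>c. c * _"] cong: if_cong)
    have da: "dotp p (\<lambda>k. e i k + e j k) y = y i + y j" for y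
      using d[OF that(1), of y] d[OF that(2), of y] by (simp add: dotp_def distrib_right sum.distrib)
    have sym: "S j i = S i j" using that by (simp add: spec[symmetric] mult_ac)
    have q: "qform p S (e i) = S i i" "qform p S (e j) = S j j"
      using that unfolding qform_def e_def
      by (simp_all add: if_distrib[where f = "\<lambda>c. c * _"] if_distrib[where f = "(*) _"] cong: if_cong)
    have qa: "qform p S (\<lambda>k. e i k + e j k) = S i i + 2 * S i j + S j j"
      using that sym unfolding qform_def e_def
      by (simp add: distrib_left distrib_right sum.distrib if_distrib[where f = "\<lambda>c. c * _"] if_distrib[where f = "(*) _"] cong: if_cong)
    have "(\<integral>y. y i * y j \<partial>gl) = (\<integral>y. ((dotp p (\<lambda>k. e i k + e j k) y)\<^sup>2 - (dotp p (e i) y)\<^sup>2 - (dotp p (e j) y)\<^sup>2) / 2 \<partial>gl)"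
      unfolding da d[OF that(1)] d[OF that(2)]
      by (intro Bochner_Integration.integral_cong refl) (simp add: power2_sum)
    also have "\<dots> = S i j"
      using gl_square by (simp add: q qa)
    finally show ?thesis .
  qed
  show "integrable gl (\<lambda>y. sqnorm p y powr (2 + \<delta>))"
  proof (subst integral_gl(2), measurable, rule Bochner_Integration.integrable_bound)
    let ?t = "\<bar>\<Sum>j<p. S j j\<bar> powr (2 + \<delta>)"
    show "integrable (stdNs p) (\<lambda>x. 8 * (\<bar>chi_form p l x\<bar> powr (2 + \<delta>) + ?t))"
      using chi_form_moments(1)[OF \<delta>, of p l] by simp
    show "AE x in stdNs p. norm (sqnorm p (gvec p u l x) powr (2 + \<delta>)) \<le> norm (8 * (\<bar>chi_form p l x\<bar> powr (2 + \<delta>) + ?t))"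
    proof (rule AE_I2)
      fix x
      have "\<bar>sqnorm p (gvec p u l x)\<bar> powr (2 + \<delta>) \<le> 8 * (\<bar>chi_form p l x\<bar> powr (2 + \<delta>) + ?t)"
        unfolding sqnorm_chi by (rule abs_add_powr_le) (use \<delta> in auto)
      then show "norm (sqnorm p (gvec p u l x) powr (2 + \<delta>)) \<le> norm (8 * (\<bar>chi_form p l x\<bar> powr (2 + \<delta>) + ?t))"
        by (simp add: sqnorm_nonneg)
    qed
  qed (measurable)
qed (use \<delta> in auto)

sublocale g: cov_law gl p S \<delta> by (rule cov_law_gl)

lemma dev_gvec: "g.dev (gvec p u l x) = chi_form p l x"
  by (simp add: g.dev_def sqnorm_chi)

lemma measurable_dev_vecM [measurable]: "g.dev \<in> borel_measurable (vecM p)"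
  unfolding g.dev_def[abs_def] by measurable

text \<open>For a Gaussian vector the variance of a linear form controls its q-th moment, so this
  moment can be charged to the quadratic form.\<close>

lemma gl_mom: "g.mom w \<le> 6 * qmom1 \<delta> * qform p S w powr ((2 + \<delta>) / 2)"
proof -
  have "g.mom w = (\<integral>x. \<bar>dotp p w (gvec p u l x)\<bar> powr (2 + \<delta>) \<partial>stdNs p)"
    unfolding g.mom_def by (rule integral_gl(1)) measurable
  also have "\<dots> \<le> 6 * qmom1 \<delta> * (\<Sum>k<p. (sqrt (l k) * (\<Sum>i<p. u i k * w i))\<^sup>2) powr ((2 + \<delta>) / 2)"
    unfolding dotp_gvec by (rule linear_stdNs(3)[OF \<delta>])
  finally show ?thesis unfolding sum_dotp_coeff .
qed

lemma gl_dev2: "(\<integral>y. (g.dev y)\<^sup>2 \<partial>gl) = 2 * (\<Sum>k<p. (l k)\<^sup>2)"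
proof -
  have "(\<integral>y. (g.dev y)\<^sup>2 \<partial>gl) = (\<integral>x. (g.dev (gvec p u l x))\<^sup>2 \<partial>stdNs p)"
    by (rule integral_gl(1)) measurable
  then show ?thesis unfolding dev_gvec chi_form_moments(2)[OF \<delta>] .
qed

lemma gl_devq: "(\<integral>y. \<bar>g.dev y\<bar> powr (2 + \<delta>) \<partial>gl) \<le> 6 * qmom2 \<delta> * (\<Sum>k<p. (l k)\<^sup>2) powr ((2 + \<delta>) / 2)"
proof -
  have "(\<integral>y. \<bar>g.dev y\<bar> powr (2 + \<delta>) \<partial>gl) = (\<integral>x. \<bar>g.dev (gvec p u l x)\<bar> powr (2 + \<delta>) \<partial>stdNs p)"
    by (rule integral_gl(1)) measurable
  then show ?thesis using chi_form_moments(3)[OF \<delta>, of p l] unfolding dev_gvec by simp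
qed

text \<open>In eigen-coordinates Y^T S Y = F + Z, with F the sum of l_k^2 and Z a centred chi-square
  form with weights l_k^2. The bound for Z is of order q, so Jensen first squares the integral of
  the q/2-th power; hence the square root. The sum of l_k^4 is at most F^2.\<close>

lemma gl_qform: "(\<integral>y. qform p S y powr ((2 + \<delta>) / 2) \<partial>gl)
    \<le> sqrt (8 * (6 * qmom2 \<delta> + 1)) * (\<Sum>k<p. (l k)\<^sup>2) powr ((2 + \<delta>) / 2)"
proof -
  interpret prob_space "stdNs p" by (rule prob_space_stdNs)
  let ?q = "2 + \<delta>"
  define F where "F = (\<Sum>k<p. (l k)\<^sup>2)"
  define Z where "Z x = chi_form p (\<lambda>k. (l k)\<^sup>2) x" for x
  have F0: "0 \<le> F" by (simp add: F_def sum_nonneg)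
  have m0: "0 \<le> qmom2 \<delta>" by (simp add: qmom2_def)
  have qZ: "qform p S (gvec p u l x) = Z x + F" for x
    unfolding qform_gvec Z_def F_def chi_form_def by (simp add: right_diff_distrib sum_subtractf)
  have qn: "0 \<le> qform p S y" for y by (rule g.qform_nonneg)
  have Zi: "integrable (stdNs p) (\<lambda>x. \<bar>Z x\<bar> powr ?q)"
    unfolding Z_def by (rule chi_form_moments(1)[OF \<delta>])
  have [measurable]: "Z \<in> borel_measurable (stdNs p)" unfolding Z_def[abs_def] by measurable
  have b: "(Z x + F) powr ?q \<le> 8 * (\<bar>Z x\<bar> powr ?q + F powr ?q)" for x
    using abs_add_powr_le[of ?q "Z x" F] \<delta> F0 qn[of "gvec p u l x"] by (simp add: qZ)
  have bi: "integrable (stdNs p) (\<lambda>x. 8 * (\<bar>Z x\<bar> powr ?q + F powr ?q))" using Zi by simp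
  have i: "integrable (stdNs p) (\<lambda>x. (Z x + F) powr ?q)"
    by (rule Bochner_Integration.integrable_bound[OF bi]) (measurable, use b in \<open>auto intro!: AE_I2\<close>)
  have e: "((Z x + F) powr (?q / 2)) powr 2 = (Z x + F) powr ?q" for x
    unfolding powr_powr by (rule arg_cong[where f = "(powr) (Z x + F)"]) simp
  have eF: "(F powr (?q / 2)) powr 2 = F powr ?q"
    unfolding powr_powr by (rule arg_cong[where f = "(powr) F"]) simp
  have "(\<integral>x. (Z x + F) powr (?q / 2) \<partial>stdNs p) powr 2 \<le> (\<integral>x. (Z x + F) powr ?q \<partial>stdNs p)"
    using jensen_powr(2)[of "\<lambda>x. (Z x + F) powr (?q / 2)" 2] i unfolding e by simp
  also have "\<dots> \<le> (\<integral>x. 8 * (\<bar>Z x\<bar> powr ?q + F powr ?q) \<partial>stdNs p)"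
    by (rule integral_mono[OF i bi b])
  also have "\<dots> = 8 * ((\<integral>x. \<bar>Z x\<bar> powr ?q \<partial>stdNs p) + F powr ?q)"
    using Zi by (simp add: prob_space)
  also have "\<dots> \<le> 8 * (6 * qmom2 \<delta> * F powr ?q + F powr ?q)"
  proof -
    have "(\<integral>x. \<bar>Z x\<bar> powr ?q \<partial>stdNs p) \<le> 6 * qmom2 \<delta> * (\<Sum>k<p. ((l k)\<^sup>2)\<^sup>2) powr (?q / 2)"
      unfolding Z_def by (rule chi_form_moments(3)[OF \<delta>])
    also have "\<dots> \<le> 6 * qmom2 \<delta> * (F\<^sup>2) powr (?q / 2)"
    proof (intro mult_left_mono powr_mono2)
      have "(\<Sum>k<p. ((l k)\<^sup>2)\<^sup>2) \<le> (\<Sum>k<p. (l k)\<^sup>2 * F)"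
        unfolding power2_eq_square[of "(l _)\<^sup>2"]
        by (intro sum_mono mult_left_mono) (auto simp: F_def intro!: member_le_sum)
      also have "\<dots> = F\<^sup>2" by (simp add: F_def sum_distrib_right power2_eq_square)
      finally show "(\<Sum>k<p. ((l k)\<^sup>2)\<^sup>2) \<le> F\<^sup>2" .
    qed (use \<delta> m0 in \<open>auto intro: sum_nonneg\<close>)
    also have "(F\<^sup>2) powr (?q / 2) = F powr ?q"
    proof -
      have "F\<^sup>2 = F powr 2" using F0 by simp
      then have "(F\<^sup>2) powr (?q / 2) = (F powr 2) powr (?q / 2)" by simp
      also have "\<dots> = F powr (2 * (?q / 2))" by (rule powr_powr)
      also have "2 * (?q / 2) = ?q" by simp
      finally show ?thesis .
    qed
    finally show ?thesis by simp
  qed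
  also have "\<dots> = 8 * (6 * qmom2 \<delta> + 1) * (F powr (?q / 2)) powr 2"
    unfolding eF by (simp add: algebra_simps)
  finally have le: "(\<integral>x. (Z x + F) powr (?q / 2) \<partial>stdNs p)\<^sup>2 \<le> (sqrt (8 * (6 * qmom2 \<delta> + 1)) * F powr (?q / 2))\<^sup>2"
    using m0 by (simp add: power_mult_distrib)
  have "(\<integral>x. (Z x + F) powr (?q / 2) \<partial>stdNs p) \<le> sqrt (8 * (6 * qmom2 \<delta> + 1)) * F powr (?q / 2)"
    by (rule power2_le_imp_le[OF le]) (use m0 in simp)
  then show ?thesis
    by (subst integral_gl(1), measurable) (simp only: qZ F_def)
qed

end

context cov_law
begin

lemma integral_qform:
  "integrable M (qform p S)" "(\<integral>x. qform p S x \<partial>M) = (\<Sum>i<p. \<Sum>j<p. (S i j)\<^sup>2)"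
proof -
  have e: "qform p S = (\<lambda>x. \<Sum>i<p. \<Sum>j<p. S i j * (x i * x j))"
    unfolding qform_def by (auto simp: mult_ac)
  show "integrable M (qform p S)" unfolding e
    by (auto intro!: Bochner_Integration.integrable_sum integrable_coord2)
  have "(\<integral>x. qform p S x \<partial>M) = (\<Sum>i<p. \<integral>x. (\<Sum>j<p. S i j * (x i * x j)) \<partial>M)"
    unfolding e by (rule Bochner_Integration.integral_sum) (auto intro!: Bochner_Integration.integrable_sum integrable_coord2)
  also have "\<dots> = (\<Sum>i<p. \<Sum>j<p. \<integral>x. S i j * (x i * x j) \<partial>M)"
    by (intro sum.cong refl Bochner_Integration.integral_sum) (auto intro!: integrable_coord2)
  finally show "(\<integral>x. qform p S x \<partial>M) = (\<Sum>i<p. \<Sum>j<p. (S i j)\<^sup>2)"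
    by (simp add: cov power2_eq_square)
qed

end

section \<open>Comparison with the Gaussian law\<close>

locale gauss_compare = gauss_law p S u l \<delta> + lindeberg \<mu> "gauss_law.gl p u l" p S \<delta>
  for \<mu> :: "(nat \<Rightarrow> real) measure" and p S u l \<delta>
begin

abbreviation F :: real where "F \<equiv> (\<Sum>i<p. \<Sum>j<p. (S i j)\<^sup>2)"
abbreviation EQ :: real where "EQ \<equiv> (\<integral>x. qform p S x powr ((2 + \<delta>) / 2) \<partial>\<mu>)"
abbreviation ED :: real where "ED \<equiv> (\<integral>x. m.mom x \<partial>\<mu>)"

text \<open>Jensen, from E X^T \<Sigma> X = f^2. Every f^q produced by Gaussian moments can thus be
  absorbed into E(X^T \<Sigma> X)^(q/2).\<close>

lemma F_powr_le: "F powr ((2 + \<delta>) / 2) \<le> EQ"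
  unfolding m.integral_qform(2)[symmetric]
  by (rule m.jensen_powr(2)[OF borel_measurable_integrable[OF m.integral_qform(1)] m.qform_nonneg _
        integrable_mom(1)[OF m.cov_law_axioms]]) (use \<delta> in simp)

text \<open>The mixed moment is rewritten so that the Gaussian vector is integrated first; then
  \<open>gl_mom\<close> applies and only the quadratic form of X remains.\<close>

lemma mom_swap: "(\<integral>y. m.mom y \<partial>gl) = (\<integral>x. g.mom x \<partial>\<mu>)"
proof -
  interpret P: pair_prob_space gl \<mu> ..
  let ?q = "2 + \<delta>"
  have [measurable]: "(\<lambda>z. fst z j) \<in> borel_measurable (gl \<Otimes>\<^sub>M \<mu>)" "(\<lambda>z. snd z j) \<in> borel_measurable (gl \<Otimes>\<^sub>M \<mu>)" if "j \<in> {..<p}" for j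
    using that by (auto intro!: measurable_compose[OF measurable_fst g.measurable_coord] measurable_compose[OF measurable_snd m.measurable_coord])
  have dm[measurable]: "(\<lambda>(y, x). dotp p y x) \<in> borel_measurable (gl \<Otimes>\<^sub>M \<mu>)"
    unfolding dotp_def case_prod_beta' by measurable
  have i: "integrable (gl \<Otimes>\<^sub>M \<mu>) (\<lambda>(y, x). \<bar>dotp p y x\<bar> powr ?q)"
  proof (rule P.Fubini_integrable)
    show "integrable gl (\<lambda>y. \<integral>x. norm (case (y, x) of (y, x) \<Rightarrow> \<bar>dotp p y x\<bar> powr ?q) \<partial>\<mu>)"
      using integrable_mom(2)[OF g.cov_law_axioms] by (simp add: m.mom_def[abs_def])
    show "AE y in gl. integrable \<mu> (\<lambda>x. case (y, x) of (y, x) \<Rightarrow> \<bar>dotp p y x\<bar> powr ?q)"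
      using m.integrable_dotp_powr by simp
  qed measurable
  show ?thesis
    using P.Fubini_integral[OF i] unfolding m.mom_def g.mom_def
    by (subst (2) dotp_commute) simp
qed

text \<open>Four pairings of laws occur. Two copies of X leave the D term; each pairing that
  involves a Gaussian vector is at most a multiple of \<open>EQ\<close>.\<close>

lemma hyb_bounds:
  assumes N: "1 \<le> N"
  defines "k1 \<equiv> 6 * qmom1 \<delta>" and "k3 \<equiv> sqrt (8 * (6 * qmom2 \<delta> + 1))"
  shows "hyb_bound \<mu> N + hyb_bound gl N \<le> 3 * (1 + 2 * k1 + k3 + k1 * k3) * (N powr ((2 + \<delta>) / 2) * EQ + N * ED)"
proof -
  let ?P = "N powr ((2 + \<delta>) / 2)"
  let ?G = "\<integral>y. qform p S y powr ((2 + \<delta>) / 2) \<partial>gl"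
  have k: "0 \<le> k1" "0 \<le> k3" by (simp_all add: k1_def k3_def qmom1_def qmom2_def)
  \<comment> \<open>For N at least 1 the linear factor in front of the Gaussian pairings may be
    raised to the power q/2 > 1, which merges them with the leading term.\<close>
  have NP: "N \<le> ?P"
    using N \<delta> powr_mono[of 1 "(2 + \<delta>) / 2" N] by simp
  have E0: "0 \<le> EQ" "0 \<le> ED" by (simp_all add: m.mom_nonneg)
  have G: "?G \<le> k3 * EQ"
  proof -
    have "?G \<le> k3 * F powr ((2 + \<delta>) / 2)" unfolding k3_def sum_eigs2 by (rule gl_qform)
    also have "\<dots> \<le> k3 * EQ" using k F_powr_le by (intro mult_left_mono) auto
    finally show ?thesis .
  qed
  have gm: "(\<integral>x. g.mom x \<partial>\<mu>) \<le> k1 * EQ"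
  proof -
    have "(\<integral>x. g.mom x \<partial>\<mu>) \<le> (\<integral>x. k1 * qform p S x powr ((2 + \<delta>) / 2) \<partial>\<mu>)"
      unfolding k1_def by (rule integral_mono)
        (use integrable_mom[OF m.cov_law_axioms] gl_mom in auto)
    then show ?thesis by simp
  qed
  have gg: "(\<integral>x. g.mom x \<partial>gl) \<le> k1 * (k3 * EQ)"
  proof -
    have "(\<integral>x. g.mom x \<partial>gl) \<le> (\<integral>x. k1 * qform p S x powr ((2 + \<delta>) / 2) \<partial>gl)"
      unfolding k1_def by (rule integral_mono)
        (use integrable_mom[OF g.cov_law_axioms] gl_mom in auto)
    also have "\<dots> = k1 * ?G" by simp
    also have "\<dots> \<le> k1 * (k3 * EQ)" using k G by (intro mult_left_mono) auto
    finally show ?thesis .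
  qed
  have n0: "0 \<le> (\<integral>x. g.mom x \<partial>\<mu>)" "0 \<le> (\<integral>x. g.mom x \<partial>gl)" "0 \<le> ?G"
    by (simp_all add: g.mom_nonneg)
  have 1: "hyb_bound \<mu> N \<le> 3 * (?P * EQ + (N * ED + ?P * (k1 * EQ)))"
    unfolding hyb_bound_def distrib_left[of N]
    using gm NP N k E0 n0 by (intro mult_left_mono add_mono mult_mono order_refl) auto
  have 2: "hyb_bound gl N \<le> 3 * (?P * (k3 * EQ) + (?P * (k1 * EQ) + ?P * (k1 * (k3 * EQ))))"
    unfolding hyb_bound_def distrib_left[of N] mom_swap
    using gm gg G NP N k E0 n0 by (intro mult_left_mono add_mono mult_mono order_refl) auto
  have "hyb_bound \<mu> N + hyb_bound gl N \<le> 3 * ((1 + 2 * k1 + k3 + k1 * k3) * (?P * EQ) + 1 * (N * ED))"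
    using 1 2 by (simp add: algebra_simps)
  also have "\<dots> \<le> 3 * ((1 + 2 * k1 + k3 + k1 * k3) * (?P * EQ) + (1 + 2 * k1 + k3 + k1 * k3) * (N * ED))"
    using k E0 N by (intro mult_left_mono add_left_mono mult_right_mono) auto
  also have "3 * (A * X + A * Y) = 3 * A * (X + Y)" for A X Y :: real
    by (simp add: algebra_simps)
  finally show ?thesis .
qed

text \<open>Pulled back to standard normals, the sum of n copies scales each coordinate by sqrt n,
  whose square cancels the division by n.\<close>

lemma integral_gl_power:
  fixes \<phi> :: "real \<Rightarrow> real"
  assumes \<phi>: "\<phi> \<in> borel_measurable borel" "\<And>x. \<bar>\<phi> x\<bar> \<le> 1" and n: "1 \<le> n"
  shows "(\<integral>\<omega>. \<phi> (sqnorm p (vsum {..<n} \<omega>) / n) \<partial>PiM {..<n} (\<lambda>_. gl)) = (\<integral>x. \<phi> (sqnorm p (gvec p u l x)) \<partial>stdNs p)"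
proof -
  interpret Ss: prob_space "stdNs p" by (rule prob_space_stdNs)
  note [measurable] = \<phi>(1)
  have m: "gvec p u l \<in> measurable (stdNs p) gl"
    using measurable_gvec by (simp add: gl_def)
  have "distr (PiM {..<n} (\<lambda>_. stdNs p)) (PiM {..<n} (\<lambda>_. gl)) (compose {..<n} (gvec p u l))
    = PiM {..<n} (\<lambda>_. distr (stdNs p) gl (gvec p u l))"
    by (rule distr_PiM_finite_prob_space[OF finite_lessThan])
      (auto intro!: product_prob_spaceI prob_space_stdNs g.prob_space_axioms m)
  also have "distr (stdNs p) gl (gvec p u l) = gl"
    unfolding gl_def by (rule distr_cong) auto
  finally have d: "PiM {..<n} (\<lambda>_. gl) = distr (PiM {..<n} (\<lambda>_. stdNs p)) (PiM {..<n} (\<lambda>_. gl)) (compose {..<n} (gvec p u l))" ..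
  have cm: "compose {..<n} (gvec p u l) \<in> measurable (PiM {..<n} (\<lambda>_. stdNs p)) (PiM {..<n} (\<lambda>_. gl))"
    unfolding compose_def
  proof (rule measurable_restrict)
    fix i assume i: "i \<in> {..<n}"
    show "(\<lambda>\<omega>. gvec p u l (\<omega> i)) \<in> measurable (PiM {..<n} (\<lambda>_. stdNs p)) gl"
      by (rule measurable_compose[OF _ m]) (rule measurable_component_singleton[OF i])
  qed
  have [measurable]: "(\<lambda>\<omega>. \<omega> i j) \<in> borel_measurable (PiM {..<n} (\<lambda>_. gl))" if "i \<in> {..<n}" "j \<in> {..<p}" for i j
    by (rule measurable_compose[OF measurable_component_singleton[OF that(1)] g.measurable_coord]) (use that in simp)
  have Gm: "(\<lambda>\<omega>. \<phi> (sqnorm p (vsum {..<n} \<omega>) / n)) \<in> borel_measurable (PiM {..<n} (\<lambda>_. gl))"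
    unfolding sqnorm_def vsum_def by measurable
  define G where "G w = \<phi> ((\<Sum>k<p. l k * (w k)\<^sup>2) / n)" for w
  have "G \<in> borel_measurable (vecM p)" unfolding G_def[abs_def] by measurable
  note gs = integral_sum_stdNs[OF this, of n]
  have s: "sqnorm p (vsum {..<n} (compose {..<n} (gvec p u l) \<omega>)) = (\<Sum>k<p. l k * (\<Sum>i<n. \<omega> i k)\<^sup>2)" for \<omega>
  proof -
    have "vsum {..<n} (compose {..<n} (gvec p u l) \<omega>) j = gvec p u l (\<lambda>k. \<Sum>i<n. \<omega> i k) j" if "j < p" for j
    proof -
      have "vsum {..<n} (compose {..<n} (gvec p u l) \<omega>) j = (\<Sum>i<n. \<Sum>k<p. u j k * (sqrt (l k) * \<omega> i k))"
        using that by (simp add: vsum_def compose_def gvec_def)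
      also have "\<dots> = (\<Sum>k<p. \<Sum>i<n. u j k * (sqrt (l k) * \<omega> i k))" by (rule sum.swap)
      finally show ?thesis using that by (simp add: gvec_def sum_distrib_left)
    qed
    then have "sqnorm p (vsum {..<n} (compose {..<n} (gvec p u l) \<omega>)) = sqnorm p (gvec p u l (\<lambda>k. \<Sum>i<n. \<omega> i k))"
      by (simp add: sqnorm_def)
    then show ?thesis by (simp add: sqnorm_gvec)
  qed
  have "(\<integral>\<omega>. \<phi> (sqnorm p (vsum {..<n} \<omega>) / n) \<partial>PiM {..<n} (\<lambda>_. gl))
      = (\<integral>\<omega>. \<phi> (sqnorm p (vsum {..<n} (compose {..<n} (gvec p u l) \<omega>)) / n) \<partial>PiM {..<n} (\<lambda>_. stdNs p))"
    by (subst d, rule integral_distr[OF cm Gm])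
  also have "\<dots> = (\<integral>\<omega>. G (\<lambda>j\<in>{..<p}. \<Sum>i<n. \<omega> i j) \<partial>PiM {..<n} (\<lambda>_. stdNs p))"
    by (simp add: s G_def)
  also have "\<dots> = (\<integral>x. G (\<lambda>j\<in>{..<p}. sqrt n * x j) \<partial>stdNs p)"
    by (rule gs) (simp add: G_def \<phi>)
  also have "\<dots> = (\<integral>x. \<phi> (sqnorm p (gvec p u l x)) \<partial>stdNs p)"
  proof -
    have "G (\<lambda>j\<in>{..<p}. sqrt n * x j) = \<phi> (sqnorm p (gvec p u l x))" for x
    proof -
      have "(\<Sum>k<p. l k * ((\<lambda>j\<in>{..<p}. sqrt n * x j) k)\<^sup>2) / n = (\<Sum>k<p. l k * (x k)\<^sup>2)"
        using n by (simp add: power_mult_distrib sum_divide_distrib mult_ac)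
      then show ?thesis by (simp add: G_def sqnorm_gvec)
    qed
    then show ?thesis by simp
  qed
  finally show ?thesis .
qed

end

section \<open>Kolmogorov distance\<close>

text \<open>The step descends on [0, 3], so at scale \<psi> the threshold moves by 3 /
  \<psi>.\<close>

lemma (in prob_space) smooth_sandwich:
  assumes [measurable]: "R \<in> borel_measurable M" and \<psi>: "0 < \<psi>"
  shows "measure M {x \<in> space M. R x \<le> t} \<le> (\<integral>x. smooth_step (\<psi> * (R x - t)) \<partial>M)"
    and "(\<integral>x. smooth_step (\<psi> * (R x - t)) \<partial>M) \<le> measure M {x \<in> space M. R x \<le> t + 3 / \<psi>}"
proof -
  have "continuous_on UNIV smooth_step"
    using smooth_step_deriv(1) by (intro continuous_at_imp_continuous_on) (auto intro: DERIV_isCont)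
  then have [measurable]: "smooth_step \<in> borel_measurable borel" by (rule borel_measurable_continuous_onI)
  have si: "integrable M (\<lambda>x. smooth_step (\<psi> * (R x - t)))"
    by (rule integrable_const_bound[of _ 1]) (use smooth_step_bounds in auto)
  have ii: "integrable M (indicator {x \<in> space M. R x \<le> s} :: _ \<Rightarrow> real)" for s
    by (rule integrable_const_bound[of _ 1]) (auto simp: indicator_def)
  have m: "measure M {x \<in> space M. R x \<le> s} = (\<integral>x. indicator {x \<in> space M. R x \<le> s} x \<partial>M)" for s
    by simp
  show "measure M {x \<in> space M. R x \<le> t} \<le> (\<integral>x. smooth_step (\<psi> * (R x - t)) \<partial>M)"
    unfolding m
  proof (rule integral_mono[OF ii si])
    fix x
    show "indicator {x \<in> space M. R x \<le> t} x \<le> smooth_step (\<psi> * (R x - t))"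
    proof (cases "R x \<le> t")
      case True
      then have "\<psi> * (R x - t) \<le> 0" using \<psi> by (simp add: mult_nonneg_nonpos)
      then show ?thesis by (simp add: smooth_step_le0 indicator_def)
    qed (simp add: smooth_step_bounds)
  qed
  show "(\<integral>x. smooth_step (\<psi> * (R x - t)) \<partial>M) \<le> measure M {x \<in> space M. R x \<le> t + 3 / \<psi>}"
    unfolding m
  proof (rule integral_mono[OF si ii])
    fix x assume x: "x \<in> space M"
    show "smooth_step (\<psi> * (R x - t)) \<le> indicator {x \<in> space M. R x \<le> t + 3 / \<psi>} x"
    proof (cases "R x \<le> t + 3 / \<psi>")
      case True
      then show ?thesis using x smooth_step_bounds by simp
    next
      case False
      then have "3 \<le> \<psi> * (R x - t)" using \<psi> by (simp add: field_simps)
      then show ?thesis using False by (simp add: smooth_step_ge3)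
    qed
  qed
qed

text \<open>Concentration is required of V alone: for both directions the shift of the threshold is
  charged to V, on an interval contained in [t - 3 / \<psi>, t + 3 / \<psi>].\<close>

lemma kolmogorov_from_smooth:
  assumes M: "prob_space M" "prob_space N"
    and R: "R \<in> borel_measurable M" and V: "V \<in> borel_measurable N" and \<psi>: "0 < \<psi>"
    and \<Delta>: "\<And>t. \<bar>(\<integral>x. smooth_step (\<psi> * (R x - t)) \<partial>M) - (\<integral>x. smooth_step (\<psi> * (V x - t)) \<partial>N)\<bar> \<le> \<Delta>"
    and \<epsilon>: "\<And>t. measure N {x \<in> space N. \<bar>V x - t\<bar> \<le> 3 / \<psi>} \<le> \<epsilon>"
  shows "\<bar>measure M {x \<in> space M. R x \<le> t} - measure N {x \<in> space N. V x \<le> t}\<bar> \<le> \<Delta> + \<epsilon>"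
proof -
  interpret M: prob_space M by fact
  interpret N: prob_space N by fact
  note [measurable] = R V
  let ?h = "3 / \<psi>"
  have h: "0 < ?h" using \<psi> by simp
  have c: "measure N {x \<in> space N. V x \<le> b} \<le> measure N {x \<in> space N. V x \<le> a} + \<epsilon>"
    if "b \<le> s + ?h" "s - ?h \<le> a" for a b s
  proof -
    have "measure N {x \<in> space N. V x \<le> b} \<le> measure N ({x \<in> space N. V x \<le> a} \<union> {x \<in> space N. \<bar>V x - s\<bar> \<le> ?h})"
      by (rule N.finite_measure_mono) (use that in auto)
    also have "\<dots> \<le> measure N {x \<in> space N. V x \<le> a} + measure N {x \<in> space N. \<bar>V x - s\<bar> \<le> ?h}"
      by (rule measure_Un_le) auto
    also have "\<dots> \<le> measure N {x \<in> space N. V x \<le> a} + \<epsilon>" using \<epsilon> by simp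
    finally show ?thesis .
  qed
  have up: "measure M {x \<in> space M. R x \<le> t} \<le> measure N {x \<in> space N. V x \<le> t} + (\<Delta> + \<epsilon>)"
    using M.smooth_sandwich(1)[OF R \<psi>, of t] N.smooth_sandwich(2)[OF V \<psi>, of t] \<Delta>[of t]
      c[of "t + ?h" t t] h by (simp add: abs_le_iff)
  have "(t - ?h) + 3 / \<psi> = t" by simp
  then have lo: "measure N {x \<in> space N. V x \<le> t} \<le> measure M {x \<in> space M. R x \<le> t} + (\<Delta> + \<epsilon>)"
    using M.smooth_sandwich(2)[OF R \<psi>, of "t - ?h"] N.smooth_sandwich(1)[OF V \<psi>, of "t - ?h"] \<Delta>[of "t - ?h"]
      c[of t t "t - ?h"] h by (simp add: abs_le_iff)
  from up lo show ?thesis by (simp add: abs_le_iff)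
qed

section \<open>The distance to V for an admissible law\<close>

text \<open>Pulling V back along coordinatewise squaring places it on the Gaussian space for which
  the concentration bound is proved.\<close>

lemma probV_eq:
  "probV p \<mu> lam t = measure (stdNs p) {x \<in> space (stdNs p). chi_form p (\<lambda>j. lam j / fk p \<mu> 2) x \<le> t}"
proof -
  interpret S: prob_space stdN by (rule prob_space_stdN)
  have pc: "prob_space chi2_1" unfolding chi2_1_def by (rule S.prob_space_distr) simp
  have fm: "(\<lambda>x. x\<^sup>2) \<in> measurable stdN chi2_1" by (simp add: chi2_1_def)
  have d: "distr stdN chi2_1 (\<lambda>x. x\<^sup>2) = chi2_1"
    unfolding chi2_1_def by (rule distr_cong) auto
  have "distr (stdNs p) (PiM {..<p} (\<lambda>_. chi2_1)) (compose {..<p} (\<lambda>x. x\<^sup>2)) = PiM {..<p} (\<lambda>_. distr stdN chi2_1 (\<lambda>x. x\<^sup>2))"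
    by (rule distr_PiM_finite_prob_space[OF finite_lessThan])
      (auto intro!: product_prob_spaceI prob_space_stdN pc fm)
  then have e: "PiM {..<p} (\<lambda>_. chi2_1) = distr (stdNs p) (PiM {..<p} (\<lambda>_. chi2_1)) (compose {..<p} (\<lambda>x. x\<^sup>2))"
    unfolding d ..
  have [measurable_cong]: "sets chi2_1 = sets borel" by (simp add: chi2_1_def)
  have m: "compose {..<p} (\<lambda>x. x\<^sup>2) \<in> measurable (stdNs p) (PiM {..<p} (\<lambda>_. chi2_1))"
    unfolding compose_def by measurable
  have A: "{\<eta> \<in> space (PiM {..<p} (\<lambda>_. chi2_1)). (\<Sum>j<p. lam j / fk p \<mu> 2 * (\<eta> j - 1)) \<le> t} \<in> sets (PiM {..<p} (\<lambda>_. chi2_1))"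
    by measurable
  have "probV p \<mu> lam t = measure (distr (stdNs p) (PiM {..<p} (\<lambda>_. chi2_1)) (compose {..<p} (\<lambda>x. x\<^sup>2)))
      {\<eta> \<in> space (PiM {..<p} (\<lambda>_. chi2_1)). (\<Sum>j<p. lam j / fk p \<mu> 2 * (\<eta> j - 1)) \<le> t}"
    unfolding probV_def using e by simp
  also have "\<dots> = measure (stdNs p) {x \<in> space (stdNs p). chi_form p (\<lambda>j. lam j / fk p \<mu> 2) x \<le> t}"
    unfolding measure_distr[OF m A]
    using measurable_space[OF m] by (intro arg_cong[where f = "measure (stdNs p)"]) (auto simp: chi_form_def compose_def)
  finally show ?thesis .
qed

text \<open>The factor (1 + \<delta>)^(q/2) in the q-th power of c_\<delta> is at least 1.\<close>

lemma cd_eq: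
  assumes "0 < \<delta>"
  shows "0 \<le> cd \<delta>" "qmom2 \<delta> \<le> cd \<delta> powr (2 + \<delta>)"
proof -
  show "0 \<le> cd \<delta>" using assms by (simp add: cd_def)
  have m0: "0 \<le> qmom2 \<delta>" by (simp add: qmom2_def)
  have "cd \<delta> powr (2 + \<delta>) = sqrt (1 + \<delta>) powr (2 + \<delta>) * (qmom2 \<delta> powr (1 / (2 + \<delta>))) powr (2 + \<delta>)"
    using assms by (simp add: cd_def qmom2_def powr_mult)
  also have "(qmom2 \<delta> powr (1 / (2 + \<delta>))) powr (2 + \<delta>) = qmom2 \<delta>"
    using assms m0 by (simp add: powr_powr)
  finally have "cd \<delta> powr (2 + \<delta>) = sqrt (1 + \<delta>) powr (2 + \<delta>) * qmom2 \<delta>" .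
  moreover have "1 \<le> sqrt (1 + \<delta>) powr (2 + \<delta>)"
    using assms by (intro ge_one_powr_ge_zero) auto
  ultimately show "qmom2 \<delta> \<le> cd \<delta> powr (2 + \<delta>)"
    using m0 mult_right_mono[of 1 "sqrt (1 + \<delta>) powr (2 + \<delta>)" "qmom2 \<delta>"] by simp
qed

lemma cd_0: "cd 0 = sqrt 2"
proof -
  have "\<bar>x\<^sup>2 - 1\<bar> powr 2 = (x\<^sup>2 - 1)\<^sup>2" for x :: real
    by (cases "x\<^sup>2 - 1 = 0") (auto simp: powr_numeral)
  then have "cd 0 = 2 powr (1 / 2)"
    by (simp add: cd_def integral_chi2_variance)
  then show ?thesis by (simp add: powr_half_sqrt)
qed

locale adm =
  fixes p :: nat and \<mu> :: "(nat \<Rightarrow> real) measure" and lam :: "nat \<Rightarrow> real" and \<delta> :: real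
  assumes \<delta>: "0 < \<delta>" "\<delta> \<le> 1" and adm: "admissible p \<mu> \<delta>" and eig: "eigs_of p \<mu> lam"
begin

abbreviation S :: "nat \<Rightarrow> nat \<Rightarrow> real" where "S \<equiv> \<lambda>i j. covm p \<mu> $$ (i, j)"

abbreviation f :: real where "f \<equiv> fk p \<mu> 2"

lemma S: "i < p \<Longrightarrow> j < p \<Longrightarrow> S i j = (\<integral>x. x i * x j \<partial>\<mu>)"
  by (simp add: covm_def)

lemma S_sym: "i < p \<Longrightarrow> j < p \<Longrightarrow> S i j = S j i"
  by (simp add: S mult.commute)

lemma covm_carrier: "covm p \<mu> \<in> carrier_mat p p"
  by (simp add: covm_def)

lemma fk1: "0 \<le> (\<Sum>j<p. S j j)" "fk p \<mu> 1 = (\<Sum>j<p. S j j)"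
proof -
  show *: "0 \<le> (\<Sum>j<p. S j j)" by (intro sum_nonneg) (simp add: S)
  have "covm p \<mu> ^\<^sub>m 1 = covm p \<mu>" using covm_carrier by simp
  then show "fk p \<mu> 1 = (\<Sum>j<p. S j j)"
    using * covm_carrier by (simp add: fk_def mtrace_def)
qed

text \<open>For a symmetric matrix the trace of the square is the sum of the squared entries, which
  is positive because \<Sigma> is not zero.\<close>

lemma f_sq: "0 < f" "f\<^sup>2 = (\<Sum>i<p. \<Sum>j<p. (S i j)\<^sup>2)"
proof -
  have "mtrace (covm p \<mu> ^\<^sub>m 2) = (\<Sum>i<p. \<Sum>j<p. (S i j)\<^sup>2)"
  proof -
    have "covm p \<mu> ^\<^sub>m 2 = covm p \<mu> * covm p \<mu>"
      using covm_carrier by (simp add: numeral_2_eq_2)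
    then have "mtrace (covm p \<mu> ^\<^sub>m 2) = (\<Sum>i<p. (covm p \<mu> * covm p \<mu>) $$ (i, i))"
      using covm_carrier by (simp add: mtrace_def)
    also have "\<dots> = (\<Sum>i<p. \<Sum>j<p. S i j * S j i)"
      using covm_carrier by (intro sum.cong refl) (simp add: scalar_prod_def lessThan_atLeast0)
    also have "\<dots> = (\<Sum>i<p. \<Sum>j<p. (S i j)\<^sup>2)"
      by (intro sum.cong refl) (simp add: S_sym power2_eq_square)
    finally show ?thesis .
  qed
  moreover have pos: "0 < (\<Sum>i<p. \<Sum>j<p. (S i j)\<^sup>2)"
  proof (rule ccontr)
    assume "\<not> 0 < (\<Sum>i<p. \<Sum>j<p. (S i j)\<^sup>2)"
    moreover have "0 \<le> (\<Sum>i<p. \<Sum>j<p. (S i j)\<^sup>2)" by (intro sum_nonneg) auto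
    ultimately have "(\<Sum>i<p. \<Sum>j<p. (S i j)\<^sup>2) = 0" by simp
    then have "S i j = 0" if "i < p" "j < p" for i j
      using that by (subst (asm) sum_nonneg_eq_0_iff) (auto simp: sum_nonneg sum_nonneg_eq_0_iff)
    then have "covm p \<mu> = 0\<^sub>m p p" using covm_carrier by (intro eq_matI) auto
    then show False using adm by (simp add: admissible_def)
  qed
  ultimately have f: "f = sqrt (\<Sum>i<p. \<Sum>j<p. (S i j)\<^sup>2)" by (simp add: fk_def powr_half_sqrt)
  show "0 < f" using pos f by simp
  show "f\<^sup>2 = (\<Sum>i<p. \<Sum>j<p. (S i j)\<^sup>2)" using pos f by simp
qed

lemma Kfun_eq: "Kfun p \<mu> x = \<bar>sqnorm p x - (\<Sum>j<p. S j j)\<bar> / f"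
  using f_sq(1) by (simp add: Kfun_def fk1(2)[simplified] abs_divide)

text \<open>Finiteness of K_\<delta> gives the moment of |X|^2 once the trace is added back to the
  centred variable.\<close>

lemma cov_law_\<mu>: "cov_law \<mu> p S \<delta>"
proof (intro cov_law.intro cov_law_axioms.intro)
  have ps: "prob_space \<mu>" and sets: "sets \<mu> = sets (vecM p)" using adm by (auto simp: admissible_def)
  interpret prob_space \<mu> by (rule ps)
  show "prob_space \<mu>" "sets \<mu> = sets (vecM p)" by fact+
  show "(\<integral>x. x j \<partial>\<mu>) = 0" if "j < p" for j using adm that by (simp add: admissible_def)
  show "(\<integral>x. x i * x j \<partial>\<mu>) = S i j" if "i < p" "j < p" for i j using that by (simp add: S)
  let ?q = "2 + \<delta>"
  let ?t = "\<Sum>j<p. S j j"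
  show "integrable \<mu> (\<lambda>x. sqnorm p x powr ?q)"
  proof (rule Bochner_Integration.integrable_bound)
    show "integrable \<mu> (\<lambda>x. 8 * (f powr ?q * Kfun p \<mu> x powr ?q + \<bar>?t\<bar> powr ?q))"
      using adm by (simp add: admissible_def)
    have "(\<lambda>x. x j) \<in> borel_measurable \<mu>" if "j \<in> {..<p}" for j
      using that by (subst measurable_cong_sets[OF sets refl]) (simp add: vecM_def)
    note [measurable] = this
    show "(\<lambda>x. sqnorm p x powr ?q) \<in> borel_measurable \<mu>"
      unfolding sqnorm_def by measurable
    show "AE x in \<mu>. norm (sqnorm p x powr ?q) \<le> norm (8 * (f powr ?q * Kfun p \<mu> x powr ?q + \<bar>?t\<bar> powr ?q))"
    proof (rule AE_I2)
      fix x
      have "\<bar>(sqnorm p x - ?t) + ?t\<bar> powr ?q \<le> 8 * (\<bar>sqnorm p x - ?t\<bar> powr ?q + \<bar>?t\<bar> powr ?q)"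
        by (rule abs_add_powr_le) (use \<delta> in auto)
      moreover have "\<bar>sqnorm p x - ?t\<bar> powr ?q = f powr ?q * Kfun p \<mu> x powr ?q"
        using f_sq(1) by (simp add: Kfun_eq powr_divide)
      ultimately show "norm (sqnorm p x powr ?q) \<le> norm (8 * (f powr ?q * Kfun p \<mu> x powr ?q + \<bar>?t\<bar> powr ?q))"
        by (simp add: sqnorm_nonneg)
    qed
  qed
qed (use \<delta> in auto)

text \<open>The Gaussian law is built from \<open>lam\<close> in its given order. Nonnegativity of
  the eigenvalues is read off from the quadratic form.\<close>

lemma obtains_gauss:
  obtains u where "gauss_compare \<mu> p S u lam \<delta>"
proof -
  interpret m: cov_law \<mu> p S \<delta> by (rule cov_law_\<mu>)
  have T: "transpose_mat (covm p \<mu>) = covm p \<mu>"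
    by (rule eq_matI) (auto simp: covm_def mult.commute)
  have C: "char_poly (covm p \<mu>) = (\<Prod>j<p. [:- lam j, 1:])" using eig by (simp add: eigs_of_def)
  show ?thesis
  proof (rule symmetric_spectral_sums[OF covm_carrier T C])
    fix u
    assume u: "\<And>i j. i < p \<Longrightarrow> j < p \<Longrightarrow> (\<Sum>k<p. u k i * u k j) = (if i = j then 1 else 0)"
      "\<And>i j. i < p \<Longrightarrow> j < p \<Longrightarrow> (\<Sum>k<p. u i k * lam k * u j k) = S i j"
    have "0 \<le> lam k" if "k < p" for k
    proof -
      have "qform p S (\<lambda>i. u i k) = lam k" using u that by (rule qform_eigenvector)
      then show ?thesis using m.qform_nonneg[of "\<lambda>i. u i k"] by simp
    qed
    then have g: "gauss_law p S u lam \<delta>"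
      using \<delta> u by (intro gauss_law.intro)
    interpret g: gauss_law p S u lam \<delta> by (rule g)
    have "gauss_compare \<mu> p S u lam \<delta>"
      using g cov_law_\<mu> g.cov_law_gl by (intro gauss_compare.intro lindeberg.intro)
    then show thesis by (rule that)
  qed
qed

lemma quadS_eq: "quadS p \<mu> x = qform p S x"
  by (simp add: quadS_def qform_def)

end

text \<open>The scale \<psi> / f cancels the powers of f. The factor 32 is the 4 of
  \<open>smooth_expansion\<close> times the Hoelder constant 8 of the step; \<open>8 * C + 7\<close>
  adds the coefficients of the hybrid moments and of the moments of \<open>dev\<close>.\<close>

lemma rate_algebra:
  fixes n \<psi> f \<kappa> E D k C hb kk \<delta> :: real
  assumes n: "1 \<le> n" and f: "0 < f" and \<psi>: "0 < \<psi>" and \<kappa>: "0 < \<kappa>" and nn: "0 \<le> E" "0 \<le> D" "0 \<le> k" "0 \<le> C"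
    and hb: "hb \<le> C * (n powr ((2 + \<delta>) / 2) * E + n * (f powr (2 + \<delta>) * D))"
    and kk: "kk \<le> 7 * (f powr (2 + \<delta>) * k)"
  shows "n * (2 * (\<psi> / f)\<^sup>2 * ((2 * (\<kappa> / sqrt n * (n * f\<^sup>2) + (f * \<kappa>)\<^sup>2 / (\<kappa> / sqrt n)) + (f * \<kappa>)\<^sup>2) / n\<^sup>2)
      + 4 * (8 * (\<psi> / f) powr (2 + \<delta>)) / n powr (2 + \<delta>) * (8 * hb + kk))
    \<le> (8 + 32 * (8 * C + 7)) * (\<psi>\<^sup>2 * (\<kappa>\<^sup>2 / n + \<kappa> / sqrt n)
      + \<psi> powr (2 + \<delta>) * (k / n powr (1 + \<delta>) + E / (n powr (\<delta> / 2) * f powr (2 + \<delta>)) + D / n powr \<delta>))"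
proof -
  define s where "s = sqrt n"
  have s: "0 < s" "n = s\<^sup>2" using n by (simp_all add: s_def)
  let ?q = "2 + \<delta>"
  let ?A = "\<psi>\<^sup>2 * (\<kappa>\<^sup>2 / n + \<kappa> / s)"
  let ?B1 = "k / n powr (1 + \<delta>)" and ?B2 = "E / (n powr (\<delta> / 2) * f powr ?q)" and ?B3 = "D / n powr \<delta>"
  have n0: "0 < n" using n by simp
  \<comment> \<open>The weight \<theta> = \<kappa> / sqrt n makes the two halves of the cross-term
    bound equal: both are \<kappa> f^2 sqrt n.\<close>
  have 1: "n * (2 * (\<psi> / f)\<^sup>2 * ((2 * (\<kappa> / s * (n * f\<^sup>2) + (f * \<kappa>)\<^sup>2 / (\<kappa> / s)) + (f * \<kappa>)\<^sup>2) / n\<^sup>2))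
      = \<psi>\<^sup>2 * (8 * (\<kappa> / s) + 2 * (\<kappa>\<^sup>2 / n))"
    unfolding s(2) using s(1) f \<kappa> by (simp add: field_simps power2_eq_square)
  have 2: "\<dots> \<le> 8 * ?A"
  proof -
    have "0 \<le> \<kappa>\<^sup>2 / n" using n0 by simp
    then have "\<psi>\<^sup>2 * (8 * (\<kappa> / s) + 2 * (\<kappa>\<^sup>2 / n)) \<le> \<psi>\<^sup>2 * (8 * (\<kappa>\<^sup>2 / n + \<kappa> / s))"
      by (intro mult_left_mono) auto
    also have "\<dots> = 8 * ?A" by (rule mult.left_commute)
    finally show ?thesis .
  qed
  have p2: "n * n powr (?q / 2) / n powr ?q = 1 / n powr (\<delta> / 2)"
  proof -
    have "n * n powr (?q / 2) = n powr (1 + ?q / 2)" using n0 by (simp add: powr_add)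
    then have "n * n powr (?q / 2) / n powr ?q = n powr (1 + ?q / 2 - ?q)" by (simp only: powr_diff)
    also have "1 + ?q / 2 - ?q = - (\<delta> / 2)" by (simp add: field_simps)
    finally show ?thesis by (simp add: powr_minus_divide)
  qed
  have p3: "n * n / n powr ?q = 1 / n powr \<delta>"
  proof -
    have "n * n = n powr 2" using n0 by (simp add: powr_numeral power2_eq_square)
    then show ?thesis using n0 by (simp add: powr_add)
  qed
  have p1: "n / n powr ?q = 1 / n powr (1 + \<delta>)"
  proof -
    have "n powr ?q = n powr (1 + (1 + \<delta>))" by simp
    also have "\<dots> = n * n powr (1 + \<delta>)" using n0 by (simp only: powr_add) simp
    finally show ?thesis using n0 by simp
  qed
  have a: "(\<psi> / f) powr ?q = \<psi> powr ?q / f powr ?q" using f \<psi> by (simp add: powr_divide)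
  have "n * (4 * (8 * (\<psi> / f) powr ?q) / n powr ?q * (8 * hb + kk))
      \<le> n * (4 * (8 * (\<psi> / f) powr ?q) / n powr ?q
        * (8 * (C * (n powr (?q / 2) * E + n * (f powr ?q * D))) + 7 * (f powr ?q * k)))"
    using n0 by (intro mult_left_mono add_mono hb kk) auto
  also have "\<dots> = 32 * \<psi> powr ?q * (8 * C * ((n * n powr (?q / 2) / n powr ?q) * E / f powr ?q + (n * n / n powr ?q) * D)
      + 7 * ((n / n powr ?q) * k))"
    unfolding a using f n0 by (simp add: field_simps)
  also have "\<dots> = 32 * \<psi> powr ?q * (8 * C * (?B2 + ?B3) + 7 * ?B1)"
    unfolding p1 p2 p3 by simp
  also have "\<dots> \<le> 32 * \<psi> powr ?q * ((8 * C + 7) * (?B2 + ?B3) + (8 * C + 7) * ?B1)"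
    using nn by (intro mult_left_mono add_mono mult_right_mono) auto
  also have "\<dots> = 32 * (8 * C + 7) * (\<psi> powr ?q * (?B1 + ?B2 + ?B3))"
    by (simp add: algebra_simps)
  finally have 3: "n * (4 * (8 * (\<psi> / f) powr ?q) / n powr ?q * (8 * hb + kk)) \<le> 32 * (8 * C + 7) * (\<psi> powr ?q * (?B1 + ?B2 + ?B3))" .
  have A0: "0 \<le> ?A" using \<kappa> n0 s by simp
  have B0: "0 \<le> \<psi> powr ?q * (?B1 + ?B2 + ?B3)" using nn by simp
  have "n * (2 * (\<psi> / f)\<^sup>2 * ((2 * (\<kappa> / s * (n * f\<^sup>2) + (f * \<kappa>)\<^sup>2 / (\<kappa> / s)) + (f * \<kappa>)\<^sup>2) / n\<^sup>2)
      + 4 * (8 * (\<psi> / f) powr ?q) / n powr ?q * (8 * hb + kk))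
      \<le> 8 * ?A + 32 * (8 * C + 7) * (\<psi> powr ?q * (?B1 + ?B2 + ?B3))"
    using 1 2 3 by (simp only: distrib_left)
  also have "\<dots> \<le> (8 + 32 * (8 * C + 7)) * ?A + (8 + 32 * (8 * C + 7)) * (\<psi> powr ?q * (?B1 + ?B2 + ?B3))"
    using A0 B0 nn by (intro add_mono mult_right_mono) auto
  finally show ?thesis unfolding s_def[symmetric] by (simp only: distrib_left)
qed

text \<open>The constant of \<open>hyb_bounds\<close>; it depends on \<delta> alone because
  \<open>k1\<close> and \<open>k3\<close> involve only moments of a standard normal.\<close>

definition swap_const :: "real \<Rightarrow> real" where
  "swap_const \<delta> = 3 * (1 + 2 * (6 * qmom1 \<delta>) + sqrt (8 * (6 * qmom2 \<delta> + 1)) + 6 * qmom1 \<delta> * sqrt (8 * (6 * qmom2 \<delta> + 1)))"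

lemma swap_const_nonneg: "0 \<le> swap_const \<delta>"
  by (simp add: swap_const_def qmom1_def qmom2_def)

context adm
begin

lemma powr_root: "0 < q \<Longrightarrow> 0 \<le> I \<Longrightarrow> (I powr (1 / q)) powr q = (I :: real)"
  by (simp add: powr_powr)

text \<open>Lindeberg replacement for the rescaled step; \<open>integral_gl_power\<close> turns the
  Gaussian side into V without further error.\<close>

lemma smooth_bound:
  assumes n: "1 \<le> n" and \<psi>: "0 < \<psi>"
  shows "\<bar>(\<integral>\<omega>. smooth_step (\<psi> * (Rn p \<mu> n \<omega> - t)) \<partial>sampleM n \<mu>)
      - (\<integral>x. smooth_step (\<psi> * (chi_form p (\<lambda>j. lam j / f) x - t)) \<partial>stdNs p)\<bar>
    \<le> (8 + 32 * (8 * swap_const \<delta> + 7)) * Ld p \<mu> \<delta> n \<psi>"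
proof -
  obtain u where gc: "gauss_compare \<mu> p S u lam \<delta>" by (rule obtains_gauss)
  interpret gauss_compare \<mu> p S u lam \<delta> by (rule gc)
  let ?q = "2 + \<delta>"
  have q0: "0 < ?q" using \<delta> by simp
  define a where "a = \<psi> / f"
  define b where "b = \<psi> * ((\<Sum>j<p. S j j) / f + t)"
  have a0: "0 < a" using \<psi> f_sq(1) by (simp add: a_def)
  have arg: "a * y - b = \<psi> * ((y - (\<Sum>j<p. S j j)) / f - t)" for y
    by (simp add: a_def b_def algebra_simps diff_divide_distrib)
  \<comment> \<open>One number serves both laws: it dominates K_0, and it dominates c_0 = sqrt 2, so
    that 2 f^2, the variance of the Gaussian squared norm, is at most (f \<kappa>)^2.\<close>
  define \<kappa> where "\<kappa> = Kd p \<mu> 0 + cd 0"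
  have Kd0: "0 \<le> Kd p \<mu> 0" by (simp add: Kd_def)
  have \<kappa>: "sqrt 2 \<le> \<kappa>" "Kd p \<mu> 0 \<le> \<kappa>" "0 < \<kappa>"
    using Kd0 by (simp_all add: \<kappa>_def cd_0 add_nonneg_pos)
  have dev: "Kfun p \<mu> x = \<bar>m.dev x\<bar> / f" for x by (simp add: Kfun_eq m.dev_def)
  have Km: "(\<integral>x. (m.dev x)\<^sup>2 \<partial>\<mu>) \<le> (f * \<kappa>)\<^sup>2"
  proof -
    have "Kfun p \<mu> x powr (2 + 0) = (m.dev x)\<^sup>2 / f\<^sup>2" for x
    proof -
      have "0 \<le> Kfun p \<mu> x" by (simp add: Kfun_def)
      then have "Kfun p \<mu> x powr (2 + 0) = (Kfun p \<mu> x)\<^sup>2" by (simp add: powr_numeral)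
      then show ?thesis by (simp add: dev power_divide)
    qed
    then have "Kd p \<mu> 0 = ((\<integral>x. (m.dev x)\<^sup>2 \<partial>\<mu>) / f\<^sup>2) powr (1 / 2)"
      by (simp add: Kd_def)
    then have "(Kd p \<mu> 0)\<^sup>2 = (\<integral>x. (m.dev x)\<^sup>2 \<partial>\<mu>) / f\<^sup>2"
      by (simp add: powr_half_sqrt)
    moreover have "(Kd p \<mu> 0)\<^sup>2 \<le> \<kappa>\<^sup>2" using Kd0 \<kappa> by (intro power_mono) auto
    ultimately have "(\<integral>x. (m.dev x)\<^sup>2 \<partial>\<mu>) / f\<^sup>2 \<le> \<kappa>\<^sup>2" by simp
    then show ?thesis using f_sq(1) by (simp add: power_mult_distrib field_simps)
  qed
  have lam2: "(\<Sum>k<p. (lam k)\<^sup>2) = f\<^sup>2" using f_sq(2) sum_eigs2 by simp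
  have Kv: "(\<integral>x. (g.dev x)\<^sup>2 \<partial>gl) \<le> (f * \<kappa>)\<^sup>2"
  proof -
    have "(sqrt 2)\<^sup>2 \<le> \<kappa>\<^sup>2" using \<kappa> by (intro power_mono) auto
    then have "2 * f\<^sup>2 \<le> \<kappa>\<^sup>2 * f\<^sup>2" by (intro mult_right_mono) auto
    then show ?thesis unfolding gl_dev2 lam2 by (simp add: power_mult_distrib mult.commute)
  qed
  have fq: "(f\<^sup>2) powr (?q / 2) = f powr ?q"
  proof -
    have "(f\<^sup>2) powr (?q / 2) = (f powr 2) powr (?q / 2)" using f_sq(1) by (simp add: powr_numeral)
    also have "\<dots> = f powr (2 * (?q / 2))" by (rule powr_powr)
    also have "2 * (?q / 2) = ?q" by simp
    finally show ?thesis .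
  qed
  \<comment> \<open>The constant 7 is 1 for the law of X plus 6 for the Gaussian law, the latter
    from \<open>weighted_sum_stdNs\<close>.\<close>
  have kk: "(\<integral>x. \<bar>m.dev x\<bar> powr ?q \<partial>\<mu>) + (\<integral>x. \<bar>g.dev x\<bar> powr ?q \<partial>gl) \<le> 7 * (f powr ?q * (Kd p \<mu> \<delta> + cd \<delta>) powr ?q)"
  proof -
    let ?K = "Kd p \<mu> \<delta> + cd \<delta>"
    have K0: "0 \<le> Kd p \<mu> \<delta>" "0 \<le> cd \<delta>" using cd_eq(1)[OF \<delta>(1)] by (simp_all add: Kd_def)
    have "Kd p \<mu> \<delta> powr ?q = (\<integral>x. Kfun p \<mu> x powr ?q \<partial>\<mu>)"
      unfolding Kd_def by (rule powr_root[OF q0]) simp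
    also have "\<dots> = (\<integral>x. \<bar>m.dev x\<bar> powr ?q \<partial>\<mu>) / f powr ?q"
      using f_sq(1) by (simp add: dev powr_divide)
    finally have "(\<integral>x. \<bar>m.dev x\<bar> powr ?q \<partial>\<mu>) = f powr ?q * Kd p \<mu> \<delta> powr ?q"
      using f_sq(1) by simp
    also have "\<dots> \<le> f powr ?q * ?K powr ?q"
      using K0 q0 by (intro mult_left_mono powr_mono2) auto
    finally have 1: "(\<integral>x. \<bar>m.dev x\<bar> powr ?q \<partial>\<mu>) \<le> f powr ?q * ?K powr ?q" .
    have "qmom2 \<delta> \<le> ?K powr ?q"
      using cd_eq(2)[OF \<delta>(1)] powr_mono2[of ?q "cd \<delta>" ?K] K0 q0 by simp
    then have "6 * qmom2 \<delta> * f powr ?q \<le> 6 * ?K powr ?q * f powr ?q"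
      by (intro mult_right_mono mult_left_mono) auto
    then have 2: "(\<integral>x. \<bar>g.dev x\<bar> powr ?q \<partial>gl) \<le> 6 * ?K powr ?q * f powr ?q"
      using gl_devq unfolding lam2 fq by linarith
    from 1 2 show ?thesis by (simp add: mult_ac)
  qed
  have ED: "(\<integral>x. m.mom x \<partial>\<mu>) \<le> f powr ?q * (Dd p \<mu> \<delta> + dd \<delta>) powr ?q"
  proof -
    interpret P: pair_prob_space \<mu> \<mu> ..
    have i: "integrable (\<mu> \<Otimes>\<^sub>M \<mu>) (\<lambda>(w, x). Dfun p \<mu> (w, x) powr ?q)"
      using adm by (simp add: admissible_def case_prod_beta')
    have "Dd p \<mu> \<delta> powr ?q = (\<integral>z. Dfun p \<mu> z powr ?q \<partial>(\<mu> \<Otimes>\<^sub>M \<mu>))"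
      unfolding Dd_def by (rule powr_root[OF q0]) simp
    also have "\<dots> = (\<integral>w. (\<integral>x. Dfun p \<mu> (w, x) powr ?q \<partial>\<mu>) \<partial>\<mu>)"
      using P.integral_fst[OF i] by (simp add: case_prod_beta')
    also have "\<dots> = (\<integral>w. m.mom w / f powr ?q \<partial>\<mu>)"
      using f_sq(1) by (simp add: Dfun_def abs_divide powr_divide m.mom_def)
    finally have "(\<integral>x. m.mom x \<partial>\<mu>) = f powr ?q * Dd p \<mu> \<delta> powr ?q"
      using f_sq(1) by simp
    also have "\<dots> \<le> f powr ?q * (Dd p \<mu> \<delta> + dd \<delta>) powr ?q"
    proof (intro mult_left_mono powr_mono2)
      show "Dd p \<mu> \<delta> \<le> Dd p \<mu> \<delta> + dd \<delta>" using \<delta> by (simp add: dd_def)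
    qed (use q0 in \<open>simp_all add: Dd_def\<close>)
    finally show ?thesis .
  qed
  let ?E = "\<integral>x. quadS p \<mu> x powr (?q / 2) \<partial>\<mu>"
  have hb: "hyb_bound \<mu> n + hyb_bound gl n \<le> swap_const \<delta> * (n powr (?q / 2) * ?E + n * (f powr ?q * (Dd p \<mu> \<delta> + dd \<delta>) powr ?q))"
  proof -
    have "hyb_bound \<mu> n + hyb_bound gl n \<le> swap_const \<delta> * (n powr (?q / 2) * ?E + n * (\<integral>x. m.mom x \<partial>\<mu>))"
      using hyb_bounds[of "real n"] n by (simp only: swap_const_def quadS_eq of_nat_1 of_nat_le_iff mult.assoc)
    also have "\<dots> \<le> swap_const \<delta> * (n powr (?q / 2) * ?E + n * (f powr ?q * (Dd p \<mu> \<delta> + dd \<delta>) powr ?q))"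
      using ED by (intro mult_left_mono add_left_mono swap_const_nonneg) auto
    finally show ?thesis .
  qed
  have n1: "1 \<le> real n" using n by simp
  have \<theta>: "0 < \<kappa> / sqrt n" using \<kappa> n by simp
  have c: "\<bar>- a\<^sup>2 * bdiff 1 (a * x - b)\<bar> \<le> 2 * a\<^sup>2" for x
    using mult_left_mono[OF bdiff1_bound[of "a * x - b"], of "a\<^sup>2"] by (simp add: abs_mult mult.commute)
  have bd: "\<bar>step_fun a b x\<bar> \<le> 1" for x
    using smooth_step_bounds by (simp add: step_fun_def)
  have "\<bar>(\<integral>\<omega>. step_fun a b (sqnorm p (vsum {..<n} \<omega>) / n) \<partial>PiM {..<n} (\<lambda>_. \<mu>))
      - (\<integral>\<omega>. step_fun a b (sqnorm p (vsum {..<n} \<omega>) / n) \<partial>PiM {..<n} (\<lambda>_. gl))\<bar>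
    \<le> n * (2 * a\<^sup>2 * ((2 * (\<kappa> / sqrt n * (n * (\<Sum>i<p. \<Sum>j<p. (S i j)\<^sup>2)) + (f * \<kappa>)\<^sup>2 / (\<kappa> / sqrt n)) + (f * \<kappa>)\<^sup>2) / (real n)\<^sup>2)
      + 4 * (8 * a powr ?q) / n powr ?q * (8 * (hyb_bound \<mu> n + hyb_bound gl n)
        + (\<integral>x. \<bar>m.dev x\<bar> powr ?q \<partial>\<mu>) + (\<integral>x. \<bar>g.dev x\<bar> powr ?q \<partial>gl)))"
    by (rule lindeberg_swap[OF step_fun_deriv step_fun_holder[OF \<delta> a0] c bd \<theta> Km Kv n])
  also have "\<dots> \<le> (8 + 32 * (8 * swap_const \<delta> + 7)) * Ld p \<mu> \<delta> n \<psi>"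
    unfolding f_sq(2)[symmetric] a_def Ld_def \<kappa>_def[symmetric] add.assoc[of "8 * _"]
    by (rule rate_algebra[OF n1 f_sq(1) \<psi> \<kappa>(3) _ _ _ swap_const_nonneg hb kk])
      (simp_all add: Bochner_Integration.integral_nonneg)
  also have "(\<integral>\<omega>. step_fun a b (sqnorm p (vsum {..<n} \<omega>) / n) \<partial>PiM {..<n} (\<lambda>_. \<mu>))
      = (\<integral>\<omega>. smooth_step (\<psi> * (Rn p \<mu> n \<omega> - t)) \<partial>sampleM n \<mu>)"
  proof -
    have "Rn p \<mu> n \<omega> = (sqnorm p (vsum {..<n} \<omega>) / n - (\<Sum>j<p. S j j)) / f" for \<omega>
    proof -
      have "real n * sqnorm p (\<lambda>j. c j / real n) = sqnorm p c / n" for c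
        using n by (simp add: sqnorm_def power_divide sum_divide_distrib sum_distrib_left power2_eq_square)
      then have "real n * sqnorm p (\<lambda>j. (\<Sum>i<n. \<omega> i j) / real n) = sqnorm p (vsum {..<n} \<omega>) / n"
        unfolding vsum_def[abs_def] .
      then show ?thesis unfolding Rn_def fk1(2) by simp
    qed
    then show ?thesis unfolding step_fun_def arg sampleM_def by simp
  qed
  also have "(\<integral>\<omega>. step_fun a b (sqnorm p (vsum {..<n} \<omega>) / n) \<partial>PiM {..<n} (\<lambda>_. gl))
      = (\<integral>x. smooth_step (\<psi> * (chi_form p (\<lambda>j. lam j / f) x - t)) \<partial>stdNs p)"
  proof -
    have "continuous_on UNIV (step_fun a b)"
      using step_fun_deriv(1) by (intro continuous_at_imp_continuous_on) (auto intro: DERIV_isCont)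
    then have "step_fun a b \<in> borel_measurable borel" by (rule borel_measurable_continuous_onI)
    from integral_gl_power[OF this bd n]
    have "(\<integral>\<omega>. step_fun a b (sqnorm p (vsum {..<n} \<omega>) / n) \<partial>PiM {..<n} (\<lambda>_. gl)) = (\<integral>x. step_fun a b (sqnorm p (gvec p u lam x)) \<partial>stdNs p)" .
    moreover have "step_fun a b (sqnorm p (gvec p u lam x)) = smooth_step (\<psi> * (chi_form p (\<lambda>j. lam j / f) x - t))" for x
      unfolding step_fun_def arg sqnorm_chi by (simp add: chi_form_def sum_divide_distrib)
    ultimately show ?thesis by simp
  qed
  finally show ?thesis .
qed

lemma kolmogorov_bound:
  assumes n: "1 \<le> n" and \<psi>: "0 < \<psi>"
  shows "\<bar>probR p \<mu> n t - probV p \<mu> lam t\<bar>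
    \<le> (8 + 32 * (8 * swap_const \<delta> + 7)) * Ld p \<mu> \<delta> n \<psi>
      + exp (1 / 2) * (\<integral>\<xi>. \<bar>\<xi>\<bar> powr (- 1 / 2) \<partial>stdN) * sqrt (3 / \<psi>)"
  unfolding probR_def probV_eq
proof (rule kolmogorov_from_smooth[OF _ prob_space_stdNs _ _ \<psi> smooth_bound[OF n \<psi>] chi_form_concentration])
  interpret m: cov_law \<mu> p S \<delta> by (rule cov_law_\<mu>)
  show "prob_space (sampleM n \<mu>)"
    unfolding sampleM_def by (rule prob_space_PiM) (rule m.prob_space_axioms)
  have [measurable]: "(\<lambda>\<omega>. \<omega> i j) \<in> borel_measurable (sampleM n \<mu>)" if "i \<in> {..<n}" "j \<in> {..<p}" for i j
    unfolding sampleM_def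
    by (rule measurable_compose[OF measurable_component_singleton[OF that(1)] m.measurable_coord]) (use that in simp)
  show "Rn p \<mu> n \<in> borel_measurable (sampleM n \<mu>)"
    unfolding Rn_def[abs_def] sqnorm_def by measurable
  obtain u where gc: "gauss_compare \<mu> p S u lam \<delta>" by (rule obtains_gauss)
  interpret gauss_compare \<mu> p S u lam \<delta> by (rule gc)
  have "(\<Sum>j<p. (lam j / f)\<^sup>2) = (\<Sum>j<p. (lam j)\<^sup>2) / f\<^sup>2"
    by (simp add: power_divide sum_divide_distrib)
  also have "(\<Sum>j<p. (lam j)\<^sup>2) = f\<^sup>2" using f_sq(2) sum_eigs2 by simp
  finally show "(\<Sum>j<p. (lam j / f)\<^sup>2) = 1" using f_sq(1) by simp
  show "0 < 3 / \<psi>" using \<psi> by simp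
qed simp

end

section \<open>From the error bound to the rate and the limit\<close>

lemma sqrt_div_powr:
  assumes "0 < \<psi>"
  shows "sqrt (3 / \<psi>) = sqrt 3 * \<psi> powr (- 1 / 2)"
  using assms by (simp add: real_sqrt_divide powr_minus_divide powr_half_sqrt)

definition rate_const :: "real \<Rightarrow> real" where
  "rate_const \<delta> = 8 + 32 * (8 * swap_const \<delta> + 7) + exp (1 / 2) * (\<integral>\<xi>. \<bar>\<xi>\<bar> powr (- 1 / 2) \<partial>stdN) * sqrt 3"

text \<open>The equation for \<psi> equates the replacement error L with the order of the smoothing
  error sqrt (3 / \<psi>), so a single power of \<psi> remains.\<close>

lemma rate_bound:
  assumes "0 < \<delta>" "\<delta> \<le> 1" "admissible p \<mu> \<delta>" "eigs_of p \<mu> lam" "1 \<le> n" "0 < \<psi>"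
    and L: "Ld p \<mu> \<delta> n \<psi> = \<psi> powr (-1/2)"
  shows "\<bar>probR p \<mu> n t - probV p \<mu> lam t\<bar> \<le> rate_const \<delta> * \<psi> powr (-1/2)"
proof -
  interpret adm p \<mu> lam \<delta> using assms by (intro adm.intro)
  show ?thesis
    using kolmogorov_bound[OF assms(5,6), of t]
    unfolding L sqrt_div_powr[OF assms(6)] rate_const_def by (simp add: algebra_simps)
qed

text \<open>If \<open>\<psi> \<le> B\<close> then \<open>L(n, \<psi>)\<close> is at most a constant times \<open>Q + \<surd>Q\<close>, while it equals \<open>\<psi> powr (-1/2) \<ge> B powr (-1/2)\<close>.\<close>
lemma Ld_le_Qd:
  assumes \<delta>: "0 < \<delta>" and \<psi>: "0 < \<psi>" "\<psi> \<le> B"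
  shows "0 \<le> Qd p \<mu> \<delta> n"
    and "Ld p \<mu> \<delta> n \<psi> \<le> B\<^sup>2 * (Qd p \<mu> \<delta> n + sqrt (Qd p \<mu> \<delta> n)) + B powr (2 + \<delta>) * Qd p \<mu> \<delta> n"
proof -
  let ?k = "Kd p \<mu> 0 + cd 0" and ?Q = "Qd p \<mu> \<delta> n"
  let ?R = "(Kd p \<mu> \<delta> + cd \<delta>) powr (2 + \<delta>) / real n powr (1 + \<delta>)
     + (\<integral>x. quadS p \<mu> x powr ((2 + \<delta>) / 2) \<partial>\<mu>) / (real n powr (\<delta> / 2) * fk p \<mu> 2 powr (2 + \<delta>))
     + (Dd p \<mu> \<delta> + dd \<delta>) powr (2 + \<delta>) / real n powr \<delta>"
  have R0: "0 \<le> ?R" by (intro add_nonneg_nonneg divide_nonneg_nonneg) auto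
  have k0: "0 \<le> ?k\<^sup>2 / n" "0 \<le> ?k" by (auto simp: Kd_def cd_0)
  have Q: "?Q = ?k\<^sup>2 / n + ?R" by (simp add: Qd_def)
  show Q0: "0 \<le> ?Q" unfolding Q using R0 k0 by simp
  have kQ: "?k\<^sup>2 / n \<le> ?Q" "?R \<le> ?Q" unfolding Q using R0 k0 by simp_all
  \<comment> \<open>The summand of L with sqrt n in the denominator is the square root of a summand
    of Q. This is why Q need not list it and why sqrt Q appears in the bound.\<close>
  have "?k / sqrt n = sqrt (?k\<^sup>2 / n)" using k0 by (simp add: real_sqrt_divide)
  also have "\<dots> \<le> sqrt ?Q" using kQ by simp
  finally have ks: "?k / sqrt n \<le> sqrt ?Q" .
  have "Ld p \<mu> \<delta> n \<psi> = \<psi>\<^sup>2 * (?k\<^sup>2 / n + ?k / sqrt n) + \<psi> powr (2 + \<delta>) * ?R"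
    by (simp add: Ld_def)
  also have "\<dots> \<le> B\<^sup>2 * (?Q + sqrt ?Q) + B powr (2 + \<delta>) * ?Q"
    using kQ ks Q0 R0 k0 \<psi> \<delta> by (intro add_mono mult_mono power_mono powr_mono2) auto
  finally show "Ld p \<mu> \<delta> n \<psi> \<le> B\<^sup>2 * (?Q + sqrt ?Q) + B powr (2 + \<delta>) * ?Q" .
qed

text \<open>If \<psi> stayed below some B > 0 for infinitely many n, L would tend to 0 along them,
  although there it is at least B^(-1/2).\<close>

lemma psi_at_top:
  assumes \<delta>: "0 < \<delta>"
    and \<psi>: "\<And>n. 1 \<le> n \<Longrightarrow> 0 < \<psi>s n \<and> Ld (ps n) (\<mu>s n) \<delta> n (\<psi>s n) = \<psi>s n powr (-1/2)"
    and Q: "(\<lambda>n. Qd (ps n) (\<mu>s n) \<delta> n) \<longlonglongrightarrow> 0"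
  shows "filterlim \<psi>s at_top sequentially"
  unfolding filterlim_at_top_gt[where c = 0]
proof (intro allI impI)
  fix B :: real assume B: "0 < B"
  let ?Q = "\<lambda>n. Qd (ps n) (\<mu>s n) \<delta> n"
  have "(\<lambda>n. B\<^sup>2 * (?Q n + sqrt (?Q n)) + B powr (2 + \<delta>) * ?Q n) \<longlonglongrightarrow> B\<^sup>2 * (0 + sqrt 0) + B powr (2 + \<delta>) * 0"
    by (intro tendsto_intros Q)
  then have "(\<lambda>n. B\<^sup>2 * (?Q n + sqrt (?Q n)) + B powr (2 + \<delta>) * ?Q n) \<longlonglongrightarrow> 0" by simp
  then have "\<forall>\<^sub>F n in sequentially. B\<^sup>2 * (?Q n + sqrt (?Q n)) + B powr (2 + \<delta>) * ?Q n < B powr (-1/2)"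
    by (rule order_tendstoD(2)) (use B in simp)
  then show "\<forall>\<^sub>F n in sequentially. B \<le> \<psi>s n"
    using eventually_ge_at_top[of 1]
  proof eventually_elim
    case (elim n)
    show ?case
    proof (rule ccontr)
      assume "\<not> B \<le> \<psi>s n"
      then have le: "\<psi>s n \<le> B" by simp
      have "B powr (-1/2) \<le> \<psi>s n powr (-1/2)" using \<psi>[OF elim(2)] le by (intro powr_mono2') auto
      also have "\<dots> \<le> B\<^sup>2 * (?Q n + sqrt (?Q n)) + B powr (2 + \<delta>) * ?Q n"
        using Ld_le_Qd(2)[OF \<delta> _ le, of "ps n" "\<mu>s n" n] \<psi>[OF elim(2)] by simp
      finally show False using elim(1) by simp
    qed
  qed
qed

theorem mainTheorem2:
  fixes \<delta> :: real
  assumes "0 < \<delta>" and "\<delta> \<le> 1"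
  shows "(\<exists>C. \<forall>p \<mu> lam n \<psi>.
            admissible p \<mu> \<delta> \<longrightarrow> eigs_of p \<mu> lam \<longrightarrow> 1 \<le> n \<longrightarrow>
            0 < \<psi> \<longrightarrow> Ld p \<mu> \<delta> n \<psi> = \<psi> powr (-1/2) \<longrightarrow>
            (\<forall>t. \<bar>probR p \<mu> n t - probV p \<mu> lam t\<bar> \<le> C * \<psi> powr (-1/2)))
       \<and> (\<forall>(ps :: nat \<Rightarrow> nat) \<mu>s lams \<psi>s.
            (\<forall>n. admissible (ps n) (\<mu>s n) \<delta> \<and> eigs_of (ps n) (\<mu>s n) (lams n)) \<longrightarrow>
            (\<forall>n\<ge>1. 0 < \<psi>s n \<and> Ld (ps n) (\<mu>s n) \<delta> n (\<psi>s n) = \<psi>s n powr (-1/2)) \<longrightarrow>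
            (\<lambda>n. Qd (ps n) (\<mu>s n) \<delta> n) \<longlonglongrightarrow> 0 \<longrightarrow>
            filterlim \<psi>s at_top sequentially \<and>
            (\<lambda>n. SUP t. \<bar>probR (ps n) (\<mu>s n) n t - probV (ps n) (\<mu>s n) (lams n) t\<bar>) \<longlonglongrightarrow> 0)"
proof (intro conjI exI[of _ "rate_const \<delta>"] allI impI)
  fix p \<mu> lam n \<psi> t
  assume "admissible p \<mu> \<delta>" "eigs_of p \<mu> lam" "(1::nat) \<le> n" "0 < \<psi>" "Ld p \<mu> \<delta> n \<psi> = \<psi> powr (-1/2)"
  then show "\<bar>probR p \<mu> n t - probV p \<mu> lam t\<bar> \<le> rate_const \<delta> * \<psi> powr (-1/2)"
    by (rule rate_bound[OF assms])
next
  fix ps :: "nat \<Rightarrow> nat" and \<mu>s lams \<psi>s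
  assume adm: "\<forall>n. admissible (ps n) (\<mu>s n) \<delta> \<and> eigs_of (ps n) (\<mu>s n) (lams n)"
    and \<psi>: "\<forall>n\<ge>1. 0 < \<psi>s n \<and> Ld (ps n) (\<mu>s n) \<delta> n (\<psi>s n) = \<psi>s n powr (-1/2)"
    and Q: "(\<lambda>n. Qd (ps n) (\<mu>s n) \<delta> n) \<longlonglongrightarrow> 0"
  show lim: "filterlim \<psi>s at_top sequentially"
    using \<psi> Q by (intro psi_at_top[OF assms(1)]) auto
  let ?d = "\<lambda>n t. \<bar>probR (ps n) (\<mu>s n) n t - probV (ps n) (\<mu>s n) (lams n) t\<bar>"
  have b: "?d n t \<le> rate_const \<delta> * \<psi>s n powr (-1/2)" if "1 \<le> n" for n t
    using adm \<psi> that by (intro rate_bound[OF assms]) auto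
  show "(\<lambda>n. SUP t. ?d n t) \<longlonglongrightarrow> 0"
  proof (rule tendsto_sandwich)
    show "\<forall>\<^sub>F n in sequentially. 0 \<le> (SUP t. ?d n t)"
      using eventually_ge_at_top[of 1]
    proof eventually_elim
      case (elim n)
      \<comment> \<open>A supremum of reals is known to dominate its members only for a bounded
        family; the rate supplies the bound, for n at least 1.\<close>
      have "bdd_above (range (?d n))" using b[OF elim] by (intro bdd_aboveI2)
      then have "?d n 0 \<le> (SUP t. ?d n t)" by (intro cSUP_upper) auto
      then show ?case by linarith
    qed
    show "\<forall>\<^sub>F n in sequentially. (SUP t. ?d n t) \<le> rate_const \<delta> * \<psi>s n powr (-1/2)"
      using eventually_ge_at_top[of 1] by eventually_elim (intro cSUP_least b, auto)
    have "((\<lambda>x. x powr (-1/2)) \<longlongrightarrow> 0) (at_top :: real filter)"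
      by (rule tendsto_neg_powr) (auto simp: filterlim_ident)
    from tendsto_mult_left[OF filterlim_compose[OF this lim], of "rate_const \<delta>"]
    show "(\<lambda>n. rate_const \<delta> * \<psi>s n powr (-1/2)) \<longlonglongrightarrow> 0" by simp
  qed simp
qed

end
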